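(* Let $0<\delta<1$ and let $\phi$ be either the hinge loss $\phi_h$ or a twice smooth classifying loss. Suppose $f_\rho^\phi\in Lip^{(r,c_0)}$ for some $r>0$, $c_0>0$ (for $\phi=\phi_h$: some pointwise minimizer $f_\rho^{\phi_h}$ lies in $Lip^{(r,c_0)}$). Let $\lambda=m^{-1}$ and $\sigma=m^{-1/(2r+d)}$. Then for every $0<\nu<\frac{r}{2r+d}$, with probability at least $1-\delta$ over the i.i.d. sample $D$ of size $m$, $$\mathcal R(\mathrm{sign}(f_{D,\sigma,\lambda}))-\mathcal R(f_c)\le C\,m^{-\frac{r}{2r+d}+\nu}\log\frac4\delta,$$ where $C>0$ is a constant independent of $m$ and $\delta$.
   Context: Setting: $X=[0,1]^d$, $Y=\{-1,1\}$, $\rho$ is an unknown Borel probability measure on $Z=X\times Y$ with marginal $\rho_X$ on $X$ and conditional distributions $\rho(\cdot|x)$; $\eta(x)=\mathbf P[y=1|x]$. The sample $D=\{(x_i,y_i)\}_{i=1}^m$ is drawn i.i.d. from $\rho$. For a classifier $\mathcal C:X\to Y$, $\mathcal R(\mathcal C)=\mathbf P[\mathcal C(x)\ne y]$; the Bayes rule is $f_c(x)=1$ if $\eta(x)\ge 1/2$ and $f_c(x)=-1$ otherwise. For a loss $\phi:\mathbf R\to\mathbf R_+$, $\mathcal E^\phi(f)=\int_Z\phi(yf(x))\,d\rho$ and $f_\rho^\phi(x)$ denotes a minimizer over $t\in\mathbf R$ of $\int_Y\phi(yt)\,d\rho(y|x)$. A classifying loss is a convex $\phi:\mathbf R\to\mathbf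 R_+$, differentiable at $0$ with $\phi'(0)<0$, whose smallest zero is $1$. A twice smooth classifying loss is a classifying loss that is differentiable with continuous derivative satisfying $|\phi'(u)-\phi'(v)|\le L^*|u-v|$ for all $u,v$ (some $L^*>0$), and whose modulus of convexity $\delta(\epsilon)=\inf\{\frac{\phi(u)+\phi(v)}2-\phi(\frac{u+v}2):|u-v|\ge\epsilon\}$ satisfies $\delta(\epsilon)\ge\mu\epsilon^2$ for some $\mu>0$. The hinge loss is $\phi_h(u)=\max\{1-u,0\}$. The Gaussian kernel is $G_\sigma(x,x')=\exp(-\|x-x'\|_2^2/\sigma^2)$, $\mathcal H_\sigma$ its RKHS with norm $\|\cdot\|_\sigma$, and $$f_{D,\sigma,\lambda}=\arg\min_{f\in\mathcal H_\sigma}\Big\{\frac1m\sum_{i=1}^m\phi(y_if(x_i))+\lambda\|f\|_\sigma^2\Big\}.$$ For $r=u+v$ with $u\in\{0,1,2,\dots\}$, $0<v\le1$, $Lip^{(r,c_0)}$ is the set of $f:X\to\mathbf R$ all of whose partial derivatives of total order $u$ exist and satisfy $|\partial^\alpha f(x)-\partial^\alpha f(x')|\le c_0\|x-x'\|_2^{v}$ for all $|\alpha|=u$, $x,x'\in X$. *)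

theory Defs
  imports "HOL-Probability.Probability"
begin

definition unit_cube :: "(real^'d) set" where
  "unit_cube = {x. \<forall>i. 0 \<le> x $ i \<and> x $ i \<le> 1}"

definition hinge_loss :: "real \<Rightarrow> real" where
  "hinge_loss u = max (1 - u) 0"

definition classifying_loss :: "(real \<Rightarrow> real) \<Rightarrow> bool" where
  "classifying_loss \<phi> \<longleftrightarrow>
     convex_on UNIV \<phi> \<and> (\<forall>u. 0 \<le> \<phi> u) \<and>
     \<phi> differentiable (at 0) \<and> deriv \<phi> 0 < 0 \<and>
     \<phi> 1 = 0 \<and> (\<forall>u<1. \<phi> u \<noteq> 0)"

definition modulus_of_convexity :: "(real \<Rightarrow> real) \<Rightarrow> real \<Rightarrow> real" where
  "modulus_of_convexity \<phi> \<epsilon> =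
     Inf {(\<phi> u + \<phi> v) / 2 - \<phi> ((u + v) / 2) | u v. \<bar>u - v\<bar> \<ge> \<epsilon>}"

definition twice_smooth_classifying_loss :: "(real \<Rightarrow> real) \<Rightarrow> bool" where
  "twice_smooth_classifying_loss \<phi> \<longleftrightarrow>
     classifying_loss \<phi> \<and>
     (\<exists>\<phi>'. (\<forall>u. (\<phi> has_real_derivative \<phi>' u) (at u)) \<and> continuous_on UNIV \<phi>' \<and>
        (\<exists>L>0. \<forall>u v. \<bar>\<phi>' u - \<phi>' v\<bar> \<le> L * \<bar>u - v\<bar>)) \<and>
     (\<exists>\<mu>>0. \<forall>\<epsilon>>0. modulus_of_convexity \<phi> \<epsilon> \<ge> \<mu> * \<epsilon>\<^sup>2)"

text \<open>Conditional phi-risk at a point x with eta = P[y=1|x]: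
  integral over Y of phi(y t) d rho(y|x).\<close>
definition cond_phi_risk :: "(real \<Rightarrow> real) \<Rightarrow> real \<Rightarrow> real \<Rightarrow> real" where
  "cond_phi_risk \<phi> e t = e * \<phi> t + (1 - e) * \<phi> (- t)"

text \<open>F ds is the iterated partial derivative of f along the coordinate directions in
  the list ds (the head is applied last); partial derivatives are taken within X.\<close>
definition lip_class :: "real \<Rightarrow> real \<Rightarrow> (real^'d \<Rightarrow> real) \<Rightarrow> bool" where
  "lip_class r c0 f \<longleftrightarrow>
     (let u = nat (\<lceil>r\<rceil> - 1); v = r - real u in
      \<exists>F :: 'd list \<Rightarrow> real^'d \<Rightarrow> real.
        (\<forall>x\<in>unit_cube. F [] x = f x) \<and>
        (\<forall>ds i. length ds < u \<longrightarrow> (\<forall>x\<in>unit_cube.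
           ((\<lambda>t. F ds (x + t *\<^sub>R axis i 1)) has_real_derivative F (i # ds) x)
             (at 0 within {t. x + t *\<^sub>R axis i 1 \<in> unit_cube}))) \<and>
        (\<forall>ds. length ds = u \<longrightarrow> (\<forall>x\<in>unit_cube. \<forall>x'\<in>unit_cube.
           \<bar>F ds x - F ds x'\<bar> \<le> c0 * norm (x - x') powr v)))"

section \<open>Gaussian kernel and its RKHS on X (Moore--Aronszajn completion)\<close>

definition gauss_kernel :: "real \<Rightarrow> real^'d \<Rightarrow> real^'d \<Rightarrow> real" where
  "gauss_kernel \<sigma> x x' = exp (- (norm (x - x'))\<^sup>2 / \<sigma>\<^sup>2)"

definition kcomb_eval :: "real \<Rightarrow> (real \<times> (real^'d)) list \<Rightarrow> real^'d \<Rightarrow> real" where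
  "kcomb_eval \<sigma> L x = (\<Sum>(a, t)\<leftarrow>L. a * gauss_kernel \<sigma> x t)"

definition kcomb_norm2 :: "real \<Rightarrow> (real \<times> (real^'d)) list \<Rightarrow> real" where
  "kcomb_norm2 \<sigma> L = (\<Sum>(a, t)\<leftarrow>L. \<Sum>(b, s)\<leftarrow>L. a * b * gauss_kernel \<sigma> t s)"

definition kcomb_diff :: "(real \<times> (real^'d)) list \<Rightarrow> (real \<times> (real^'d)) list \<Rightarrow> (real \<times> (real^'d)) list" where
  "kcomb_diff L M = L @ map (\<lambda>(b, s). (- b, s)) M"

definition rkhs_approx :: "real \<Rightarrow> (nat \<Rightarrow> (real \<times> (real^'d)) list) \<Rightarrow> (real^'d \<Rightarrow> real) \<Rightarrow> bool" where
  "rkhs_approx \<sigma> g f \<longleftrightarrow>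
     (\<forall>k. \<forall>(a, t)\<in>set (g k). t \<in> unit_cube) \<and>
     (\<forall>e>0. \<exists>N. \<forall>k\<ge>N. \<forall>l\<ge>N. kcomb_norm2 \<sigma> (kcomb_diff (g k) (g l)) < e) \<and>
     (\<forall>x\<in>unit_cube. (\<lambda>k. kcomb_eval \<sigma> (g k) x) \<longlonglongrightarrow> f x)"

text \<open>Functions on X are represented extensionally (value 0 outside X).\<close>
definition in_rkhs :: "real \<Rightarrow> (real^'d \<Rightarrow> real) \<Rightarrow> bool" where
  "in_rkhs \<sigma> f \<longleftrightarrow> (\<forall>x. x \<notin> unit_cube \<longrightarrow> f x = 0) \<and> (\<exists>g. rkhs_approx \<sigma> g f)"

text \<open>Squared RKHS norm ||f||_sigma^2 (the limit is independent of the approximating sequence).\<close>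
definition rkhs_norm2 :: "real \<Rightarrow> (real^'d \<Rightarrow> real) \<Rightarrow> real" where
  "rkhs_norm2 \<sigma> f = Inf {c. \<exists>g. rkhs_approx \<sigma> g f \<and> (\<lambda>k. kcomb_norm2 \<sigma> (g k)) \<longlonglongrightarrow> c}"

definition reg_objective ::
  "(real \<Rightarrow> real) \<Rightarrow> real \<Rightarrow> real \<Rightarrow> nat \<Rightarrow> (nat \<Rightarrow> (real^'d) \<times> real) \<Rightarrow> (real^'d \<Rightarrow> real) \<Rightarrow> real" where
  "reg_objective \<phi> \<sigma> lam m D f =
     (1 / real m) * (\<Sum>i<m. \<phi> (snd (D i) * f (fst (D i)))) + lam * rkhs_norm2 \<sigma> f"

definition is_reg_minimizer ::
  "(real \<Rightarrow> real) \<Rightarrow> real \<Rightarrow> real \<Rightarrow> nat \<Rightarrow> (nat \<Rightarrow> (real^'d) \<times> real) \<Rightarrow> (real^'d \<Rightarrow> real) \<Rightarrow> bool" where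
  "is_reg_minimizer \<phi> \<sigma> lam m D f \<longleftrightarrow>
     in_rkhs \<sigma> f \<and> (\<forall>g. in_rkhs \<sigma> g \<longrightarrow> reg_objective \<phi> \<sigma> lam m D f \<le> reg_objective \<phi> \<sigma> lam m D g)"

definition sign_clf :: "(real^'d \<Rightarrow> real) \<Rightarrow> real^'d \<Rightarrow> real" where
  "sign_clf f x = (if f x \<ge> 0 then 1 else -1)"

definition bayes_rule :: "(real^'d \<Rightarrow> real) \<Rightarrow> real^'d \<Rightarrow> real" where
  "bayes_rule \<eta> x = (if \<eta> x \<ge> 1/2 then 1 else -1)"

definition misclass_risk :: "((real^'d) \<times> real) measure \<Rightarrow> (real^'d \<Rightarrow> real) \<Rightarrow> real" where
  "misclass_risk \<rho> C = measure \<rho> {z. C (fst z) \<noteq> snd z}"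

end

theory Submission
  imports Defs "HOL-Computational_Algebra.Polynomial"
begin

text \<open>
  Expanding \<open>exp (2 (x - z) \<bullet> (t - z) / \<sigma>\<^sup>2)\<close> into a power series gives explicit features of the Gaussian
  kernel around any point \<open>z\<close>, and truncating the series at order \<open>n\<close> costs a factor
  \<open>(sqrt 2 * norm (x - z) / \<sigma>) ^ n\<close>. On cells of side \<open>\<sigma> m powr (- \<kappa>)\<close> a fixed order suffices,
  so the ball of radius of order \<open>sqrt m\<close> has a net of accuracy \<open>1 / m\<close> whose logarithmic size is
  \<open>\<sigma> powr (- d)\<close> up to an arbitrarily small power of \<open>m\<close>. This is what the loss \<open>\<nu>\<close> in the exponent pays for.

  For the approximation error, \<open>f\<rho>\<close> is extended beyond the cube by polynomial extrapolation along rays and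
  then averaged against an alternating sum of dilated Gaussians, which reproduces polynomials.
  The average is an inner product with the square-integrable features of the kernel, so it is uniformly close
  to a finite kernel combination of squared norm \<open>O(\<sigma> powr (- d))\<close>, with error \<open>O(\<sigma> powr r)\<close>.

  With \<open>p = 1\<close> for the hinge loss and \<open>p = 2\<close> for smooth losses, the excess loss of a function
  at sup-distance \<open>\<epsilon>\<close> from \<open>f\<rho>\<close> is \<open>O(\<epsilon> ^ p)\<close>, the \<open>p\<close>-th power of the excess misclassification risk is
  bounded by the excess loss, and for \<open>p = 2\<close> so is the variance. An exponential moment
  bound with parameter \<open>s\<close> of order \<open>m powr (- (2 - p) r / (2 r + d))\<close> and a union bound over the net then
  give the rate in both cases.
\<close>

text \<open>The RKHS is given only as a completion whose norm is an infimum over approximating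
  sequences, so the estimates are carried out on finite kernel combinations. In one direction, an
  element of norm below a bound is replaced by a uniformly close combination. In the other, a
  Gaussian average is controlled by a quadratic inequality against all combinations
  (\<open>dual_norm2_le\<close>), and an almost optimal combination in that inequality is the
  approximant. With \<lambda> = 1 / m the minimiser may have norm, and hence sup norm, of order sqrt
  m, which would spoil the exponential moments. It is therefore clipped to [-1, 1] before any
  deviation bound is applied. The minimiser depends on the sample in a way about which nothing
  measurable is known. The good event is thus built from the net and one comparison function alone,
  and on it every minimiser is treated by a deterministic argument.\<close>

section \<open>Power series features of the Gaussian kernel\<close>

text \<open>Monomials are indexed by words over the coordinates instead of multi-indices. A monomial
  of degree k then occurs once per ordering, which absorbs all multinomial coefficients, and the
  words match the lists of directions in \<open>lip_class\<close>.\<close>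

definition coord_prod :: "'d list \<Rightarrow> real^'d \<Rightarrow> real" where
  "coord_prod l h = (\<Prod>i\<leftarrow>l. h $ i)"

lemma coord_prod_simps [simp]:
  "coord_prod [] h = 1" "coord_prod (i # l) h = h $ i * coord_prod l h"
  by (simp_all add: coord_prod_def)

lemma finite_lists_length [simp]: "finite {l :: 'd::finite list. length l = k}"
  using finite_lists_length_eq[of "UNIV :: 'd set" k] by simp

lemma finite_lists_length_less [simp]: "finite {l :: 'd::finite list. length l < k}"
  by (rule finite_subset[OF _ finite_lists_length_le[of "UNIV :: 'd set" k]]) auto

lemma sum_lists_length_Suc:
  fixes g :: "'d::finite list \<Rightarrow> real"
  shows "(\<Sum>l | length l = Suc k. g l) = (\<Sum>i\<in>UNIV. \<Sum>l | length l = k. g (i # l))"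
proof -
  have "{l :: 'd list. length l = Suc k} = (\<lambda>(i, l). i # l) ` (UNIV \<times> {l. length l = k})"
    by (force simp: length_Suc_conv image_iff)
  moreover have "inj_on (\<lambda>(i, l). i # l) (UNIV \<times> {l :: 'd list. length l = k})"
    by (auto simp: inj_on_def)
  ultimately have "(\<Sum>l | length l = Suc k. g l) = (\<Sum>(i, l)\<in>UNIV \<times> {l. length l = k}. g (i # l))"
    by (simp add: sum.reindex case_prod_unfold)
  then show ?thesis by (simp add: sum.cartesian_product)
qed

lemma sum_lists_length_less:
  fixes g :: "'d::finite list \<Rightarrow> real"
  shows "(\<Sum>l | length l < n. g l) = (\<Sum>k<n. \<Sum>l | length l = k. g l)"
proof (induction n)
  case (Suc n)
  have "{l :: 'd list. length l < Suc n} = {l. length l < n} \<union> {l. length l = n}" by auto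
  then have "(\<Sum>l | length l < Suc n. g l) = (\<Sum>l | length l < n. g l) + (\<Sum>l | length l = n. g l)"
    by (simp add: sum.union_disjoint disjoint_iff)
  with Suc show ?case by simp
qed simp

lemma inner_power_lists:
  fixes x t :: "real^'d"
  shows "(x \<bullet> t) ^ k = (\<Sum>l | length l = k. coord_prod l x * coord_prod l t)"
proof (induction k)
  case (Suc k)
  have "(x \<bullet> t) ^ Suc k = (\<Sum>i\<in>UNIV. x $ i * t $ i) * (\<Sum>l | length l = k. coord_prod l x * coord_prod l t)"
    unfolding power_Suc Suc by (simp add: inner_vec_def)
  then show ?case
    unfolding sum_lists_length_Suc by (simp add: sum_product mult_ac)
qed simp

text \<open>The square root splits the coefficient of the degree-k term of the exponential series
  evenly between the two arguments, so that the kernel becomes a sum of products of one function at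
  both points.\<close>

definition gauss_feature :: "real \<Rightarrow> 'd list \<Rightarrow> real^'d \<Rightarrow> real" where
  "gauss_feature \<sigma> l h =
     exp (- (norm h)\<^sup>2 / \<sigma>\<^sup>2) * sqrt ((2 / \<sigma>\<^sup>2) ^ length l / fact (length l)) * coord_prod l h"

lemma sum_gauss_feature_length:
  "(\<Sum>l | length l = k. gauss_feature \<sigma> l h * gauss_feature \<sigma> l h') =
     exp (- (norm h)\<^sup>2 / \<sigma>\<^sup>2) * exp (- (norm h')\<^sup>2 / \<sigma>\<^sup>2) * ((2 / \<sigma>\<^sup>2 * (h \<bullet> h')) ^ k / fact k)"
proof -
  define E where "E = exp (- (norm h)\<^sup>2 / \<sigma>\<^sup>2) * exp (- (norm h')\<^sup>2 / \<sigma>\<^sup>2)"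
  define c where "c = (2 / \<sigma>\<^sup>2) ^ k / (fact k :: real)"
  have "c \<ge> 0" by (simp add: c_def)
  have "(\<Sum>l | length l = k. gauss_feature \<sigma> l h * gauss_feature \<sigma> l h')
      = (\<Sum>l | length l = k. (E * (sqrt c * sqrt c)) * (coord_prod l h * coord_prod l h'))"
    by (intro sum.cong) (auto simp: gauss_feature_def E_def c_def mult_ac)
  also have "\<dots> = E * c * (h \<bullet> h') ^ k"
    using \<open>c \<ge> 0\<close> by (simp add: sum_distrib_left[symmetric] inner_power_lists)
  finally show ?thesis by (simp add: E_def c_def power_mult_distrib power_divide)
qed

text \<open>Grouping the words by length keeps the expansion a series over the naturals with finite
  inner sums. The centre z is free because the kernel depends only on x - t.\<close>

lemma gauss_feature_sums:
  "(\<lambda>k. \<Sum>l | length l = k. gauss_feature \<sigma> l (x - z) * gauss_feature \<sigma> l (t - z)) sums gauss_kernel \<sigma> x t"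
proof -
  define h h' where "h = x - z" and "h' = t - z"
  have "(\<lambda>k. (2 / \<sigma>\<^sup>2 * (h \<bullet> h')) ^ k /\<^sub>R fact k) sums exp (2 / \<sigma>\<^sup>2 * (h \<bullet> h'))"
    by (rule exp_converges)
  then have "(\<lambda>k. exp (- (norm h)\<^sup>2 / \<sigma>\<^sup>2) * exp (- (norm h')\<^sup>2 / \<sigma>\<^sup>2) * ((2 / \<sigma>\<^sup>2 * (h \<bullet> h')) ^ k / fact k))
    sums (exp (- (norm h)\<^sup>2 / \<sigma>\<^sup>2) * exp (- (norm h')\<^sup>2 / \<sigma>\<^sup>2) * exp (2 / \<sigma>\<^sup>2 * (h \<bullet> h')))"
    by (intro sums_mult) (simp add: divide_inverse mult.commute)
  moreover have "exp (- (norm h)\<^sup>2 / \<sigma>\<^sup>2) * exp (- (norm h')\<^sup>2 / \<sigma>\<^sup>2) * exp (2 / \<sigma>\<^sup>2 * (h \<bullet> h'))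
      = gauss_kernel \<sigma> x t"
  proof -
    have "x - t = h - h'" by (simp add: h_def h'_def)
    then have "(norm (x - t))\<^sup>2 = (norm h)\<^sup>2 + (norm h')\<^sup>2 - 2 * (h \<bullet> h')"
      by (simp add: power2_norm_eq_inner inner_diff inner_commute)
    then have "- (norm (x - t))\<^sup>2 / \<sigma>\<^sup>2 = - (norm h)\<^sup>2 / \<sigma>\<^sup>2 + - (norm h')\<^sup>2 / \<sigma>\<^sup>2 + 2 / \<sigma>\<^sup>2 * (h \<bullet> h')"
      by (simp add: diff_divide_distrib add_divide_distrib)
    then show ?thesis unfolding gauss_kernel_def by (simp only: exp_add)
  qed
  ultimately show ?thesis unfolding sum_gauss_feature_length h_def h'_def by simp
qed

section \<open>Kernel combinations in feature coordinates\<close>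

lemma gauss_kernel_commute: "gauss_kernel \<sigma> x t = gauss_kernel \<sigma> t x"
  by (simp add: gauss_kernel_def norm_minus_commute)

lemma gauss_kernel_self [simp]: "gauss_kernel \<sigma> x x = 1"
  by (simp add: gauss_kernel_def)

text \<open>Coordinates of the represented RKHS element in the feature space centred at z. The
  coordinates change with z, their inner products do not (\<open>kcomb_inner_sums\<close>).\<close>

definition kcomb_coeff :: "real \<Rightarrow> real^'d \<Rightarrow> (real \<times> (real^'d)) list \<Rightarrow> 'd list \<Rightarrow> real" where
  "kcomb_coeff \<sigma> z L l = (\<Sum>(a, t)\<leftarrow>L. a * gauss_feature \<sigma> l (t - z))"

text \<open>The RKHS inner product, written through the reproducing property: pairing with a kernel
  section is evaluation.\<close>

definition kcomb_inner :: "real \<Rightarrow> (real \<times> (real^'d)) list \<Rightarrow> (real \<times> (real^'d)) list \<Rightarrow> real" where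
  "kcomb_inner \<sigma> L M = (\<Sum>(a, t)\<leftarrow>L. a * kcomb_eval \<sigma> M t)"

lemma kcomb_coeff_simps [simp]:
  "kcomb_coeff \<sigma> z [] l = 0"
  "kcomb_coeff \<sigma> z (p # L) l = fst p * gauss_feature \<sigma> l (snd p - z) + kcomb_coeff \<sigma> z L l"
  by (simp_all add: kcomb_coeff_def case_prod_unfold)

lemma kcomb_eval_simps [simp]:
  "kcomb_eval \<sigma> [] x = 0"
  "kcomb_eval \<sigma> (p # L) x = fst p * gauss_kernel \<sigma> x (snd p) + kcomb_eval \<sigma> L x"
  by (simp_all add: kcomb_eval_def case_prod_unfold)

lemma kcomb_inner_simps [simp]:
  "kcomb_inner \<sigma> [] M = 0"
  "kcomb_inner \<sigma> (p # L) M = fst p * kcomb_eval \<sigma> M (snd p) + kcomb_inner \<sigma> L M"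
  by (simp_all add: kcomb_inner_def case_prod_unfold)

lemma kcomb_norm2_inner:
  fixes L :: "(real \<times> (real^'d)) list"
  shows "kcomb_norm2 \<sigma> L = kcomb_inner \<sigma> L L"
proof -
  have "(\<Sum>(b, s)\<leftarrow>M. a * b * gauss_kernel \<sigma> t s) = a * kcomb_eval \<sigma> M t" for a M and t :: "real^'d"
    by (induction M) (auto simp: algebra_simps)
  then show ?thesis by (simp add: kcomb_norm2_def kcomb_inner_def)
qed

lemma kcomb_eval_sums:
  "(\<lambda>k. \<Sum>l | length l = k. kcomb_coeff \<sigma> z L l * gauss_feature \<sigma> l (x - z)) sums kcomb_eval \<sigma> L x"
proof (induction L)
  case (Cons p L)
  have "(\<lambda>k. fst p * (\<Sum>l | length l = k. gauss_feature \<sigma> l (x - z) * gauss_feature \<sigma> l (snd p - z))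
      + (\<Sum>l | length l = k. kcomb_coeff \<sigma> z L l * gauss_feature \<sigma> l (x - z))) sums kcomb_eval \<sigma> (p # L) x"
    by (auto intro!: sums_add sums_mult gauss_feature_sums Cons)
  then show ?case
    by (simp add: sum_distrib_left sum.distrib[symmetric] algebra_simps)
qed simp

text \<open>Parseval's identity for the features. Symmetry, positivity and the Cauchy-Schwarz
  inequality for the kernel form are all read off from it.\<close>

lemma kcomb_inner_sums:
  "(\<lambda>k. \<Sum>l | length l = k. kcomb_coeff \<sigma> z L l * kcomb_coeff \<sigma> z M l) sums kcomb_inner \<sigma> L M"
proof (induction L)
  case (Cons p L)
  have "(\<lambda>k. fst p * (\<Sum>l | length l = k. kcomb_coeff \<sigma> z M l * gauss_feature \<sigma> l (snd p - z))
      + (\<Sum>l | length l = k. kcomb_coeff \<sigma> z L l * kcomb_coeff \<sigma> z M l)) sums kcomb_inner \<sigma> (p # L) M"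
    by (auto intro!: sums_add sums_mult kcomb_eval_sums Cons)
  then show ?case
    by (simp add: sum_distrib_left sum.distrib[symmetric] algebra_simps)
qed simp

lemma kcomb_inner_commute: "kcomb_inner \<sigma> L M = kcomb_inner \<sigma> M L"
  using kcomb_inner_sums[of \<sigma> 0 L M] kcomb_inner_sums[of \<sigma> 0 M L]
  by (simp add: mult.commute sums_unique2)

lemma kcomb_eval_eq_inner: "kcomb_eval \<sigma> L x = kcomb_inner \<sigma> [(1, x)] L"
  by simp

lemma kcomb_norm2_sums:
  "(\<lambda>k. \<Sum>l | length l = k. (kcomb_coeff \<sigma> z L l)\<^sup>2) sums kcomb_norm2 \<sigma> L"
  using kcomb_inner_sums[of \<sigma> z L L] by (simp add: kcomb_norm2_inner power2_eq_square)

lemma kcomb_norm2_nonneg: "kcomb_norm2 \<sigma> L \<ge> 0"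
  by (rule sums_le[OF _ sums_zero kcomb_norm2_sums[of \<sigma> 0 L]]) (simp add: sum_nonneg)

lemma kcomb_coeff_le_norm: "\<bar>kcomb_coeff \<sigma> z L l\<bar> \<le> sqrt (kcomb_norm2 \<sigma> L)"
proof -
  have "(kcomb_coeff \<sigma> z L l)\<^sup>2 \<le> (\<Sum>m | length m = length l. (kcomb_coeff \<sigma> z L m)\<^sup>2)"
    by (rule member_le_sum) auto
  also have "\<dots> = (\<Sum>k\<in>{length l}. \<Sum>m | length m = k. (kcomb_coeff \<sigma> z L m)\<^sup>2)" by simp
  also have "\<dots> \<le> kcomb_norm2 \<sigma> L"
    unfolding sums_unique[OF kcomb_norm2_sums[of \<sigma> z L]]
    by (rule sum_le_suminf) (auto simp: sum_nonneg sums_summable[OF kcomb_norm2_sums])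
  finally show ?thesis by (simp add: real_le_rsqrt)
qed

text \<open>A single kernel section has norm 1, and its coordinate around the origin is the feature
  itself.\<close>

lemma gauss_feature_le_1: "\<bar>gauss_feature \<sigma> l h\<bar> \<le> 1"
  using kcomb_coeff_le_norm[of \<sigma> 0 "[(1, h)]" l] by (simp add: kcomb_norm2_inner)

text \<open>The finite inequality holds for the words of length below n; letting n grow gives the
  claim, since both sides converge by Parseval.\<close>

lemma kcomb_Cauchy_Schwarz: "\<bar>kcomb_inner \<sigma> L M\<bar> \<le> sqrt (kcomb_norm2 \<sigma> L) * sqrt (kcomb_norm2 \<sigma> M)"
proof -
  define c where "c L l = kcomb_coeff \<sigma> 0 L l" for L :: "(real \<times> (real^'a)) list" and l
  have lim: "(\<lambda>n. \<Sum>l | length l < n. c L l * c M l) \<longlonglongrightarrow> kcomb_inner \<sigma> L M" for L M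
    unfolding sum_lists_length_less c_def using kcomb_inner_sums[of \<sigma> 0 L M] by (simp add: sums_def)
  have "(\<lambda>n. (\<Sum>l | length l < n. c L l * c M l)\<^sup>2) \<longlonglongrightarrow> (kcomb_inner \<sigma> L M)\<^sup>2"
    by (intro tendsto_power lim)
  moreover have "(\<lambda>n. (\<Sum>l | length l < n. (c L l)\<^sup>2) * (\<Sum>l | length l < n. (c M l)\<^sup>2))
      \<longlonglongrightarrow> kcomb_norm2 \<sigma> L * kcomb_norm2 \<sigma> M"
    unfolding kcomb_norm2_inner power2_eq_square by (intro tendsto_mult lim)
  ultimately have "(kcomb_inner \<sigma> L M)\<^sup>2 \<le> kcomb_norm2 \<sigma> L * kcomb_norm2 \<sigma> M"
    by (rule LIMSEQ_le) (auto intro!: exI[of _ 0] Cauchy_Schwarz_ineq_sum)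
  then show ?thesis by (simp add: real_sqrt_mult[symmetric] real_le_rsqrt)
qed

lemma kcomb_eval_le_norm: "\<bar>kcomb_eval \<sigma> L x\<bar> \<le> sqrt (kcomb_norm2 \<sigma> L)"
  using kcomb_Cauchy_Schwarz[of \<sigma> "[(1, x)]" L]
  unfolding kcomb_eval_eq_inner by (simp add: kcomb_norm2_inner)

text \<open>The bound (n + j)! >= j! is crude, but it costs only a factor exp y, which the Gaussian
  prefactor in \<open>kcomb_eval_truncation\<close> cancels.\<close>

lemma exp_tail_le:
  fixes y :: real
  assumes "y \<ge> 0"
  shows "(\<Sum>k=n..<N. y ^ k / fact k) \<le> y ^ n * exp y"
proof -
  have "(\<Sum>k=n..<N. y ^ k / fact k) = (\<Sum>j<N - n. y ^ (n + j) / fact (n + j))"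
    by (rule sum.reindex_bij_witness[where i="\<lambda>j. n + j" and j="\<lambda>k. k - n"]) auto
  also have "\<dots> \<le> (\<Sum>j<N - n. y ^ n * (y ^ j / fact j))"
  proof (rule sum_mono)
    fix j
    have "y ^ (n + j) / fact (n + j) \<le> y ^ (n + j) / fact j"
      using assms by (intro divide_left_mono) (auto simp: fact_mono)
    then show "y ^ (n + j) / fact (n + j) \<le> y ^ n * (y ^ j / fact j)"
      by (simp add: power_add)
  qed
  also have "\<dots> = y ^ n * (\<Sum>j<N - n. y ^ j /\<^sub>R fact j)"
    by (simp add: sum_distrib_left divide_inverse mult.commute)
  also have "\<dots> \<le> y ^ n * exp y"
  proof (rule mult_left_mono)
    show "(\<Sum>j<N - n. y ^ j /\<^sub>R fact j) \<le> exp y"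
      unfolding exp_def by (rule sum_le_suminf) (use assms summable_exp_generic[of y] in \<open>auto simp del: real_scaleR_def intro!: scaleR_nonneg_nonneg\<close>)
  qed (use assms in simp)
  finally show ?thesis .
qed

text \<open>Cauchy-Schwarz on the words of length at least n: the coefficients contribute at most
  the norm, and the squared features sum to exp (- y) times a tail of exp y, hence to at most y ^ n,
  where y = 2 * norm (x - z) ^ 2 / \<sigma> ^ 2. The error does not depend on the number of terms of
  L.\<close>

lemma kcomb_eval_truncation:
  fixes x z :: "real^'d"
  assumes "\<sigma> > 0"
  shows "\<bar>kcomb_eval \<sigma> L x - (\<Sum>l | length l < n. kcomb_coeff \<sigma> z L l * gauss_feature \<sigma> l (x - z))\<bar>
           \<le> sqrt (kcomb_norm2 \<sigma> L) * (sqrt 2 * norm (x - z) / \<sigma>) ^ n"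
proof -
  define c where "c l = kcomb_coeff \<sigma> z L l" for l :: "'d list"
  define g where "g l = gauss_feature \<sigma> l (x - z)" for l :: "'d list"
  define y where "y = 2 * (norm (x - z))\<^sup>2 / \<sigma>\<^sup>2"
  have "y \<ge> 0" by (simp add: y_def)
  have fin: "finite {l :: 'd list. n \<le> length l \<and> length l < N}" for N
    by (rule finite_subset[OF _ finite_lists_length_less[of N]]) auto
  have tail: "(\<Sum>l | n \<le> length l \<and> length l < N. g l ^ 2) \<le> y ^ n" for N
  proof (cases "n \<le> N")
    case True
    have "{l :: 'd list. length l < N} = {l. length l < n} \<union> {l. n \<le> length l \<and> length l < N}"
      using True by auto
    then have "(\<Sum>l | length l < N. g l ^ 2)
        = (\<Sum>l | length l < n. g l ^ 2) + (\<Sum>l | n \<le> length l \<and> length l < N. g l ^ 2)"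
      using fin by (simp only:) (intro sum.union_disjoint, auto)
    then have "(\<Sum>l | n \<le> length l \<and> length l < N. g l ^ 2)
        = (\<Sum>k<N. \<Sum>l | length l = k. g l ^ 2) - (\<Sum>k<n. \<Sum>l | length l = k. g l ^ 2)"
      by (simp add: sum_lists_length_less)
    also have "\<dots> = (\<Sum>k=n..<N. \<Sum>l | length l = k. g l ^ 2)"
      using True sum_diff_nat_ivl[of 0 n N "\<lambda>k. \<Sum>l | length l = k. g l ^ 2"] by (simp add: atLeast0LessThan)
    also have "\<dots> = (\<Sum>k=n..<N. exp (- y) * (y ^ k / fact k))"
    proof (rule sum.cong)
      fix k
      show "(\<Sum>l | length l = k. g l ^ 2) = exp (- y) * (y ^ k / fact k)"
        using sum_gauss_feature_length[where k=k and \<sigma>=\<sigma> and h="x - z" and h'="x - z"]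
        by (simp add: g_def power2_eq_square[of "gauss_feature \<sigma> _ _"] y_def power2_norm_eq_inner exp_add[symmetric])
    qed simp
    also have "\<dots> = exp (- y) * (\<Sum>k=n..<N. y ^ k / fact k)" by (simp add: sum_distrib_left)
    also have "\<dots> \<le> exp (- y) * (y ^ n * exp y)"
      by (intro mult_left_mono exp_tail_le \<open>y \<ge> 0\<close>) auto
    finally show ?thesis by (simp add: exp_minus field_simps)
  next
    case False
    then have "{l :: 'd list. n \<le> length l \<and> length l < N} = {}" by auto
    then show ?thesis using \<open>y \<ge> 0\<close> by (simp only: sum.empty zero_le_power)
  qed
  have norm: "(\<Sum>l | n \<le> length l \<and> length l < N. c l ^ 2) \<le> kcomb_norm2 \<sigma> L" for N
  proof -
    have "(\<Sum>l | n \<le> length l \<and> length l < N. c l ^ 2) \<le> (\<Sum>l | length l < N. c l ^ 2)"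
      by (rule sum_mono2) auto
    also have "\<dots> \<le> kcomb_norm2 \<sigma> L"
      unfolding sums_unique[OF kcomb_norm2_sums[of \<sigma> z L]] sum_lists_length_less c_def
      by (rule sum_le_suminf) (auto simp: sum_nonneg sums_summable[OF kcomb_norm2_sums])
    finally show ?thesis .
  qed
  have lim: "(\<lambda>N. (\<Sum>l | length l < N. c l * g l) - (\<Sum>l | length l < n. c l * g l))
      \<longlonglongrightarrow> kcomb_eval \<sigma> L x - (\<Sum>l | length l < n. c l * g l)"
    using kcomb_eval_sums[of \<sigma> z L x]
    by (intro tendsto_diff tendsto_const) (simp add: sums_def sum_lists_length_less c_def g_def)
  have part: "\<bar>(\<Sum>l | length l < N. c l * g l) - (\<Sum>l | length l < n. c l * g l)\<bar>
      \<le> sqrt (kcomb_norm2 \<sigma> L) * sqrt (y ^ n)" if "N \<ge> n" for N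
  proof -
    have "{l :: 'd list. length l < N} = {l. length l < n} \<union> {l. n \<le> length l \<and> length l < N}"
      using that by auto
    then have eq: "(\<Sum>l | length l < N. c l * g l) - (\<Sum>l | length l < n. c l * g l)
        = (\<Sum>l | n \<le> length l \<and> length l < N. c l * g l)"
      using fin by (subst \<open>_ = _ \<union> _\<close>, subst sum.union_disjoint) auto
    have "(\<Sum>l | n \<le> length l \<and> length l < N. c l * g l)\<^sup>2
        \<le> (\<Sum>l | n \<le> length l \<and> length l < N. c l ^ 2) * (\<Sum>l | n \<le> length l \<and> length l < N. g l ^ 2)"
      by (rule Cauchy_Schwarz_ineq_sum)
    also have "\<dots> \<le> kcomb_norm2 \<sigma> L * y ^ n"
      by (intro mult_mono norm tail sum_nonneg kcomb_norm2_nonneg) auto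
    finally show ?thesis unfolding eq by (simp add: real_sqrt_mult[symmetric] real_le_rsqrt)
  qed
  have "\<bar>kcomb_eval \<sigma> L x - (\<Sum>l | length l < n. c l * g l)\<bar> \<le> sqrt (kcomb_norm2 \<sigma> L) * sqrt (y ^ n)"
    by (rule LIMSEQ_le_const2[OF tendsto_rabs[OF lim]]) (use part in blast)
  moreover have "sqrt (y ^ n) = (sqrt 2 * norm (x - z) / \<sigma>) ^ n"
    using assms by (simp add: real_sqrt_power y_def real_sqrt_divide real_sqrt_mult)
  ultimately show ?thesis by (simp add: c_def g_def)
qed

section \<open>Linear operations on kernel combinations\<close>

lemma kcomb_eval_append: "kcomb_eval \<sigma> (L @ M) x = kcomb_eval \<sigma> L x + kcomb_eval \<sigma> M x"
  by (induction L) auto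

lemma kcomb_inner_append_left: "kcomb_inner \<sigma> (L @ M) K = kcomb_inner \<sigma> L K + kcomb_inner \<sigma> M K"
  by (induction L) auto

lemma kcomb_inner_append_right: "kcomb_inner \<sigma> K (L @ M) = kcomb_inner \<sigma> K L + kcomb_inner \<sigma> K M"
  by (metis kcomb_inner_commute kcomb_inner_append_left)

definition kcomb_scale :: "real \<Rightarrow> (real \<times> (real^'d)) list \<Rightarrow> (real \<times> (real^'d)) list" where
  "kcomb_scale c L = map (\<lambda>(a, t). (c * a, t)) L"

lemma kcomb_eval_scale: "kcomb_eval \<sigma> (kcomb_scale c L) x = c * kcomb_eval \<sigma> L x"
  by (induction L) (auto simp: kcomb_scale_def algebra_simps)

lemma kcomb_inner_scale_left: "kcomb_inner \<sigma> (kcomb_scale c L) K = c * kcomb_inner \<sigma> L K"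
  by (induction L) (auto simp: kcomb_scale_def algebra_simps)

lemma kcomb_inner_scale_right: "kcomb_inner \<sigma> K (kcomb_scale c L) = c * kcomb_inner \<sigma> K L"
  by (metis kcomb_inner_commute kcomb_inner_scale_left)

lemma kcomb_norm2_scale: "kcomb_norm2 \<sigma> (kcomb_scale c L) = c\<^sup>2 * kcomb_norm2 \<sigma> L"
  by (simp add: kcomb_norm2_inner kcomb_inner_scale_left kcomb_inner_scale_right power2_eq_square)

lemma kcomb_diff_scale: "kcomb_diff L M = L @ kcomb_scale (- 1) M"
  by (simp add: kcomb_diff_def kcomb_scale_def)

lemma kcomb_eval_diff: "kcomb_eval \<sigma> (kcomb_diff L M) x = kcomb_eval \<sigma> L x - kcomb_eval \<sigma> M x"
  by (simp add: kcomb_diff_scale kcomb_eval_append kcomb_eval_scale)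

lemma kcomb_norm2_diff:
  "kcomb_norm2 \<sigma> (kcomb_diff L M) = kcomb_norm2 \<sigma> L - 2 * kcomb_inner \<sigma> L M + kcomb_norm2 \<sigma> M"
proof -
  define K where "K = kcomb_scale (- 1) M"
  have "kcomb_inner \<sigma> K N = - kcomb_inner \<sigma> M N" "kcomb_inner \<sigma> N K = - kcomb_inner \<sigma> N M" for N
    by (simp_all add: K_def kcomb_inner_scale_left kcomb_inner_scale_right)
  then show ?thesis
    by (simp add: kcomb_norm2_inner kcomb_diff_scale K_def[symmetric] kcomb_inner_append_left
        kcomb_inner_append_right kcomb_inner_commute[of \<sigma> M L])
qed

lemma kcomb_norm_diff_le:
  "\<bar>sqrt (kcomb_norm2 \<sigma> L) - sqrt (kcomb_norm2 \<sigma> M)\<bar> \<le> sqrt (kcomb_norm2 \<sigma> (kcomb_diff L M))"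
proof -
  have "(sqrt (kcomb_norm2 \<sigma> L) - sqrt (kcomb_norm2 \<sigma> M))\<^sup>2 \<le> kcomb_norm2 \<sigma> (kcomb_diff L M)"
    using kcomb_Cauchy_Schwarz[of \<sigma> L M]
    by (simp add: kcomb_norm2_diff power2_diff kcomb_norm2_nonneg)
  then show ?thesis by (simp add: real_le_rsqrt)
qed

section \<open>From finite combinations to the completed space\<close>

lemma rkhs_approx_norm_convergent:
  assumes "rkhs_approx \<sigma> g f"
  shows "\<exists>c\<ge>0. (\<lambda>k. kcomb_norm2 \<sigma> (g k)) \<longlonglongrightarrow> c"
proof -
  have "Cauchy (\<lambda>k. sqrt (kcomb_norm2 \<sigma> (g k)))"
  proof (rule CauchyI)
    fix e :: real assume "e > 0"
    then have "e\<^sup>2 > 0" by simp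
    then obtain N where N: "\<And>k l. k \<ge> N \<Longrightarrow> l \<ge> N \<Longrightarrow> kcomb_norm2 \<sigma> (kcomb_diff (g k) (g l)) < e\<^sup>2"
      using assms unfolding rkhs_approx_def by meson
    have "norm (sqrt (kcomb_norm2 \<sigma> (g k)) - sqrt (kcomb_norm2 \<sigma> (g l))) < e" if "k \<ge> N" "l \<ge> N" for k l
    proof -
      have "sqrt (kcomb_norm2 \<sigma> (kcomb_diff (g k) (g l))) < e"
        using N[OF that] \<open>e > 0\<close> by (metis abs_of_pos real_sqrt_abs real_sqrt_less_iff)
      then show ?thesis using kcomb_norm_diff_le[of \<sigma> "g k" "g l"] by simp
    qed
    then show "\<exists>M. \<forall>m\<ge>M. \<forall>n\<ge>M. norm (sqrt (kcomb_norm2 \<sigma> (g m)) - sqrt (kcomb_norm2 \<sigma> (g n))) < e"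
      by blast
  qed
  then obtain c where "(\<lambda>k. sqrt (kcomb_norm2 \<sigma> (g k))) \<longlonglongrightarrow> c"
    by (metis Cauchy_convergent_iff convergent_def)
  then have "(\<lambda>k. (sqrt (kcomb_norm2 \<sigma> (g k)))\<^sup>2) \<longlonglongrightarrow> c\<^sup>2" by (rule tendsto_power)
  then show ?thesis by (intro exI[of _ "c\<^sup>2"]) (simp add: kcomb_norm2_nonneg)
qed

text \<open>The strict bound selects an approximating sequence whose squared norms converge below B.
  Since evaluation is bounded by the norm, the Cauchy property is uniform in x, so one late member
  of the sequence serves on the whole cube.\<close>

lemma rkhs_uniform_approx:
  assumes f: "in_rkhs \<sigma> f" and B: "rkhs_norm2 \<sigma> f < B" and "e > 0"
  obtains L where "\<forall>p\<in>set L. snd p \<in> unit_cube" "kcomb_norm2 \<sigma> L < B"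
    "\<forall>x\<in>unit_cube. \<bar>f x - kcomb_eval \<sigma> L x\<bar> \<le> e"
proof -
  have "{c. \<exists>g. rkhs_approx \<sigma> g f \<and> (\<lambda>k. kcomb_norm2 \<sigma> (g k)) \<longlonglongrightarrow> c} \<noteq> {}"
    using f rkhs_approx_norm_convergent unfolding in_rkhs_def by blast
  then obtain g c where g: "rkhs_approx \<sigma> g f" and c: "(\<lambda>k. kcomb_norm2 \<sigma> (g k)) \<longlonglongrightarrow> c" "c < B"
    using B cInf_lessD[of "{c. \<exists>g. rkhs_approx \<sigma> g f \<and> (\<lambda>k. kcomb_norm2 \<sigma> (g k)) \<longlonglongrightarrow> c}" B]
    unfolding rkhs_norm2_def by blast
  have "e\<^sup>2 > 0" using \<open>e > 0\<close> by simp
  then obtain N where N: "\<And>k l. k \<ge> N \<Longrightarrow> l \<ge> N \<Longrightarrow> kcomb_norm2 \<sigma> (kcomb_diff (g k) (g l)) < e\<^sup>2"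
    using g unfolding rkhs_approx_def by meson
  obtain N' where N': "\<And>k. k \<ge> N' \<Longrightarrow> kcomb_norm2 \<sigma> (g k) < B"
    using order_tendstoD(2)[OF c] unfolding eventually_sequentially by blast
  define k where "k = max N N'"
  have "\<bar>f x - kcomb_eval \<sigma> (g k) x\<bar> \<le> e" if "x \<in> unit_cube" for x
  proof -
    have "(\<lambda>l. \<bar>kcomb_eval \<sigma> (g l) x - kcomb_eval \<sigma> (g k) x\<bar>) \<longlonglongrightarrow> \<bar>f x - kcomb_eval \<sigma> (g k) x\<bar>"
      using g that unfolding rkhs_approx_def by (intro tendsto_intros) auto
    moreover have "\<bar>kcomb_eval \<sigma> (g l) x - kcomb_eval \<sigma> (g k) x\<bar> \<le> e" if "l \<ge> N" for l
    proof -
      have "\<bar>kcomb_eval \<sigma> (g l) x - kcomb_eval \<sigma> (g k) x\<bar> \<le> sqrt (kcomb_norm2 \<sigma> (kcomb_diff (g l) (g k)))"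
        using kcomb_eval_le_norm[of \<sigma> "kcomb_diff (g l) (g k)" x] by (simp add: kcomb_eval_diff)
      also have "\<dots> \<le> sqrt (e\<^sup>2)"
        using N[of l k] that by (intro real_sqrt_le_mono) (simp add: k_def)
      finally show ?thesis using \<open>e > 0\<close> by simp
    qed
    ultimately show ?thesis by (intro LIMSEQ_le_const2) blast+
  qed
  moreover have "kcomb_norm2 \<sigma> (g k) < B" using N'[of k] by (simp add: k_def)
  moreover have "\<forall>p\<in>set (g k). snd p \<in> unit_cube" using g unfolding rkhs_approx_def by fastforce
  ultimately show ?thesis using that by blast
qed

text \<open>The constant sequence approximates f. An upper bound on the norm is the direction
  required of a competitor in the minimisation.\<close>

lemma kcomb_in_rkhs:
  fixes L :: "(real \<times> (real^'d)) list" and \<sigma> :: real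
  assumes "\<forall>p\<in>set L. snd p \<in> unit_cube"
  defines "f \<equiv> \<lambda>x. if x \<in> unit_cube then kcomb_eval \<sigma> L x else 0"
  shows "in_rkhs \<sigma> f" "rkhs_norm2 \<sigma> f \<le> kcomb_norm2 \<sigma> L"
proof -
  have "kcomb_norm2 \<sigma> (kcomb_diff L L) = 0"
    by (simp add: kcomb_norm2_diff) (simp add: kcomb_norm2_inner)
  then have ap: "rkhs_approx \<sigma> (\<lambda>_. L) f"
    unfolding rkhs_approx_def f_def using assms by auto
  then show "in_rkhs \<sigma> f" unfolding in_rkhs_def f_def by auto
  have "bdd_below {c. \<exists>g. rkhs_approx \<sigma> g f \<and> (\<lambda>k. kcomb_norm2 \<sigma> (g k)) \<longlonglongrightarrow> c}"
  proof (rule bdd_belowI[of _ 0])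
    fix c assume "c \<in> {c. \<exists>g. rkhs_approx \<sigma> g f \<and> (\<lambda>k. kcomb_norm2 \<sigma> (g k)) \<longlonglongrightarrow> c}"
    then obtain g where "rkhs_approx \<sigma> g f" "(\<lambda>k. kcomb_norm2 \<sigma> (g k)) \<longlonglongrightarrow> c" by blast
    from this(2) show "0 \<le> c" by (rule LIMSEQ_le_const) (auto simp: kcomb_norm2_nonneg)
  qed
  then show "rkhs_norm2 \<sigma> f \<le> kcomb_norm2 \<sigma> L"
    unfolding rkhs_norm2_def using ap by (intro cInf_lower) auto
qed

lemma rkhs_norm2_nonneg:
  assumes "in_rkhs \<sigma> f"
  shows "rkhs_norm2 \<sigma> f \<ge> 0"
  unfolding rkhs_norm2_def
proof (rule cInf_greatest)
  show "{c. \<exists>g. rkhs_approx \<sigma> g f \<and> (\<lambda>k. kcomb_norm2 \<sigma> (g k)) \<longlonglongrightarrow> c} \<noteq> {}"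
    using assms rkhs_approx_norm_convergent unfolding in_rkhs_def by blast
  fix c assume "c \<in> {c. \<exists>g. rkhs_approx \<sigma> g f \<and> (\<lambda>k. kcomb_norm2 \<sigma> (g k)) \<longlonglongrightarrow> c}"
  then obtain g where "rkhs_approx \<sigma> g f" "(\<lambda>k. kcomb_norm2 \<sigma> (g k)) \<longlonglongrightarrow> c" by blast
  from this(2) show "0 \<le> c" by (rule LIMSEQ_le_const) (auto simp: kcomb_norm2_nonneg)
qed

section \<open>A net for balls of the RKHS\<close>

text \<open>The cut-off at 1 is where the loss vanishes, so clipping never increases the loss
  (\<open>loss_basic\<close>). The sign, with 0 counted as in \<open>sign_clf\<close>, is
  kept.\<close>

definition clip :: "real \<Rightarrow> real" where "clip t = max (- 1) (min 1 t)"

lemma abs_clip_le [simp]: "\<bar>clip t\<bar> \<le> 1"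
  by (simp add: clip_def)

lemma clip_diff_le: "\<bar>clip s - clip t\<bar> \<le> \<bar>s - t\<bar>"
  by (simp add: clip_def)

lemma clip_nonneg_iff: "clip t \<ge> 0 \<longleftrightarrow> t \<ge> 0"
  by (auto simp: clip_def)

lemma clip_measurable [measurable]: "clip \<in> borel_measurable borel"
  unfolding clip_def by measurable

lemma coord_prod_measurable [measurable]: "coord_prod l \<in> borel_measurable borel"
proof (induction l)
  case (Cons i l)
  have "(\<lambda>h :: real^'a. h $ i) \<in> borel_measurable borel"
    by (intro borel_measurable_continuous_onI continuous_intros)
  with Cons show ?case by (simp add: fun_eq_iff[symmetric] coord_prod_def)
qed (simp add: coord_prod_def)

lemma gauss_feature_measurable [measurable]: "gauss_feature \<sigma> l \<in> borel_measurable borel"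
  unfolding gauss_feature_def by measurable

definition grid_floor :: "nat \<Rightarrow> real^'d \<Rightarrow> real^'d" where
  "grid_floor n x = (\<chi> i. of_int \<lfloor>real n * x $ i\<rfloor> / real n)"

text \<open>The index n has to be included, since \<open>grid_floor\<close> leaves a coordinate
  equal to 1 in place; hence n + 1 values per axis.\<close>

definition grid :: "nat \<Rightarrow> (real^'d) set" where
  "grid n = {z. \<forall>i. z $ i \<in> (\<lambda>k. real k / real n) ` {..n}}"

lemma grid_eq_image: "grid n = (\<lambda>w. \<chi> i. w i) ` (UNIV \<rightarrow>\<^sub>E (\<lambda>k. real k / real n) ` {..n})"
proof (intro set_eqI iffI)
  fix z :: "real^'d" assume "z \<in> grid n"
  then show "z \<in> (\<lambda>w. \<chi> i. w i) ` (UNIV \<rightarrow>\<^sub>E (\<lambda>k. real k / real n) ` {..n})"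
    by (intro image_eqI[of _ _ "\<lambda>i. z $ i"]) (auto simp: grid_def vec_eq_iff)
qed (auto simp: grid_def PiE_iff)

lemma finite_grid: "finite (grid n)"
  unfolding grid_eq_image by (intro finite_imageI finite_PiE) auto

lemma card_grid: "card (grid n :: (real^'d) set) \<le> (n + 1) ^ CARD('d)"
proof -
  define S where "S = (\<lambda>k. real k / real n) ` {..n}"
  have "card S \<le> n + 1" unfolding S_def using card_image_le[of "{..n}"] by simp
  have "card (grid n :: (real^'d) set) \<le> card ((UNIV :: 'd set) \<rightarrow>\<^sub>E S)"
    unfolding grid_eq_image S_def by (intro card_image_le finite_PiE) auto
  also have "\<dots> = card S ^ CARD('d)" by (simp add: card_funcsetE)
  also have "\<dots> \<le> (n + 1) ^ CARD('d)" using \<open>card S \<le> n + 1\<close> by (rule power_mono) simp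
  finally show ?thesis .
qed

lemma grid_floor_in_grid:
  assumes "x \<in> unit_cube" "n > 0"
  shows "grid_floor n x \<in> grid n"
proof -
  have "of_int \<lfloor>real n * x $ i\<rfloor> / real n \<in> (\<lambda>k. real k / real n) ` {..n}" for i
  proof (intro image_eqI[of _ _ "nat \<lfloor>real n * x $ i\<rfloor>"])
    have x: "0 \<le> x $ i" "x $ i \<le> 1" using assms by (auto simp: unit_cube_def)
    then have nn: "0 \<le> \<lfloor>real n * x $ i\<rfloor>" by simp
    then show "of_int \<lfloor>real n * x $ i\<rfloor> / real n = real (nat \<lfloor>real n * x $ i\<rfloor>) / real n" by simp
    have "real n * x $ i \<le> real n" using x mult_left_mono[of "x $ i" 1 "real n"] by simp
    then have "\<lfloor>real n * x $ i\<rfloor> \<le> int n" by linarith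
    then show "nat \<lfloor>real n * x $ i\<rfloor> \<in> {..n}" by simp
  qed
  then show ?thesis by (simp add: grid_def grid_floor_def)
qed

lemma norm_le_sqrt_card:
  fixes v :: "real^'d"
  assumes "\<And>i. \<bar>v $ i\<bar> \<le> c"
  shows "norm v \<le> sqrt (real CARD('d)) * c"
proof -
  have "c \<ge> 0" using assms[of undefined] by linarith
  have "(norm v)\<^sup>2 = (\<Sum>i\<in>UNIV. (v $ i)\<^sup>2)"
    by (simp add: power2_norm_eq_inner inner_vec_def power2_eq_square[of "_ $ _"])
  also have "\<dots> \<le> (\<Sum>i\<in>(UNIV :: 'd set). c\<^sup>2)"
  proof (rule sum_mono)
    fix i show "(v $ i)\<^sup>2 \<le> c\<^sup>2" using assms[of i] power_mono[of "\<bar>v $ i\<bar>" c 2] by simp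
  qed
  also have "\<dots> = (sqrt (real CARD('d)) * c)\<^sup>2" by (simp add: power_mult_distrib)
  finally show ?thesis by (rule power2_le_imp_le) (simp add: \<open>c \<ge> 0\<close>)
qed

lemma norm_diff_grid_floor:
  fixes x :: "real^'d"
  assumes "n > 0"
  shows "norm (x - grid_floor n x) \<le> sqrt (real CARD('d)) * (1 / real n)"
proof (rule norm_le_sqrt_card)
  fix i
  define y where "y = real n * x $ i"
  have "x $ i = y / real n" using assms by (simp add: y_def)
  then have "(x - grid_floor n x) $ i = (y - of_int \<lfloor>y\<rfloor>) / real n"
    by (simp add: grid_floor_def y_def[symmetric] diff_divide_distrib)
  moreover have "0 \<le> y - of_int \<lfloor>y\<rfloor>" "y - of_int \<lfloor>y\<rfloor> \<le> 1" by linarith+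
  ultimately show "\<bar>(x - grid_floor n x) $ i\<bar> \<le> 1 / real n"
    using assms by (simp add: divide_right_mono)
qed

text \<open>Near each grid point the element is replaced by the first terms of its feature expansion
  around that point, with rounded coefficients.\<close>

lemma rkhs_ball_net:
  fixes \<sigma> R e :: real and n n0 :: nat
  defines "S \<equiv> card {l :: 'd::finite list. length l < n}"
  assumes "\<sigma> > 0" "R \<ge> 0" "e > 0" "n0 > 0"
  obtains N :: "(real^'d \<Rightarrow> real) set" where "finite N"
    "\<And>q. q \<in> N \<Longrightarrow> q \<in> borel_measurable borel"
    "\<And>q x. q \<in> N \<Longrightarrow> \<bar>q x\<bar> \<le> 1"
    "real (card N) \<le> (2 * R / e + 3) ^ ((n0 + 1) ^ CARD('d) * S)"
    "\<And>f. in_rkhs \<sigma> f \<Longrightarrow> rkhs_norm2 \<sigma> f < R\<^sup>2 \<Longrightarrow>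
       \<exists>q\<in>N. \<forall>x\<in>unit_cube. \<bar>clip (f x) - q x\<bar>
         \<le> e + R * (sqrt 2 * (sqrt (real CARD('d)) * (1 / real n0)) / \<sigma>) ^ n + real S * e"
proof -
  define \<Lambda> where "\<Lambda> = {l :: 'd list. length l < n}"
  \<comment> \<open>Coefficients are at most R in absolute value by
    \<open>kcomb_coeff_le_norm\<close>, so rounding them down to multiples of e uses only the
    multiples from -K to K.\<close>
  define K where "K = \<lceil>R / e\<rceil>"
  define V where "V = (\<lambda>k::int. of_int k * e) ` {- K..K}"
  define J where "J = (grid n0 :: (real^'d) set)"
  \<comment> \<open>One table w covers all cells: the indicators select the expansion around the
    grid point of the cell containing x, and being indicators of Borel sets they keep q
    measurable.\<close>
  define q where "q w x = clip (\<Sum>z\<in>J. indicator {x. grid_floor n0 x = z} x *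
      (\<Sum>l\<in>\<Lambda>. w (z, l) * gauss_feature \<sigma> l (x - z)))" for w and x :: "real^'d"
  define N where "N = q ` (J \<times> \<Lambda> \<rightarrow>\<^sub>E V)"
  have fin: "finite \<Lambda>" "finite J" "finite V"
    by (auto simp: \<Lambda>_def J_def V_def finite_grid)
  have finN: "finite N" unfolding N_def by (intro finite_imageI finite_PiE) (auto simp: fin)
  have K: "K \<ge> 0" "real_of_int K \<le> R / e + 1"
    using divide_nonneg_pos[OF \<open>R \<ge> 0\<close> \<open>e > 0\<close>] unfolding K_def by linarith+
  have "real (card V) \<le> 2 * R / e + 3"
  proof -
    have "card V \<le> card {- K..K}" unfolding V_def by (rule card_image_le) simp
    also have "\<dots> = nat (2 * K + 1)" by simp
    finally have "real (card V) \<le> 2 * real_of_int K + 1" using K by linarith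
    then show ?thesis using K by simp
  qed
  have "card N \<le> card (J \<times> \<Lambda> \<rightarrow>\<^sub>E V)"
    unfolding N_def by (intro card_image_le finite_PiE) (auto simp: fin)
  also have "\<dots> = card V ^ (card J * S)"
    using fin by (simp add: card_funcsetE card_cartesian_product S_def \<Lambda>_def)
  finally have "real (card N) \<le> real (card V) ^ (card J * S)"
    by (metis of_nat_le_iff of_nat_power)
  also have "\<dots> \<le> (2 * R / e + 3) ^ (card J * S)"
    using \<open>real (card V) \<le> _\<close> by (rule power_mono) simp
  also have "\<dots> \<le> (2 * R / e + 3) ^ ((n0 + 1) ^ CARD('d) * S)"
    using assms card_grid[of n0, where 'd='d] by (intro power_increasing mult_right_mono) (auto simp: J_def)
  finally have cardN: "real (card N) \<le> (2 * R / e + 3) ^ ((n0 + 1) ^ CARD('d) * S)" .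
  have meas: "q w \<in> borel_measurable borel" for w
  proof -
    have [measurable]: "(\<lambda>x :: real^'d. x $ i) \<in> borel_measurable borel" for i
      by (intro borel_measurable_continuous_onI continuous_intros)
    have "{x. grid_floor n0 x = z} = (\<Inter>i. {x. of_int \<lfloor>real n0 * x $ i\<rfloor> / real n0 = z $ i})" for z :: "real^'d"
      by (auto simp: grid_floor_def vec_eq_iff)
    then have [measurable]: "{x. grid_floor n0 x = z} \<in> sets borel" for z :: "real^'d"
      by simp
    show ?thesis unfolding q_def by measurable
  qed
  \<comment> \<open>The three error terms are the distance from f to a finite combination, the
    truncation of its expansion, and the rounding of S coefficients against features bounded by
    1.\<close>
  have approx: "\<exists>q\<in>N. \<forall>x\<in>unit_cube. \<bar>clip (f x) - q x\<bar>
         \<le> e + R * (sqrt 2 * (sqrt (real CARD('d)) * (1 / real n0)) / \<sigma>) ^ n + real S * e"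
    if f: "in_rkhs \<sigma> f" "rkhs_norm2 \<sigma> f < R\<^sup>2" for f
  proof -
    obtain L where L: "\<forall>p\<in>set L. snd p \<in> unit_cube" "kcomb_norm2 \<sigma> L < R\<^sup>2"
      "\<forall>x\<in>unit_cube. \<bar>f x - kcomb_eval \<sigma> L x\<bar> \<le> e"
      using rkhs_uniform_approx[OF f \<open>e > 0\<close>] .
    have normL: "sqrt (kcomb_norm2 \<sigma> L) \<le> R"
      using L(2) \<open>R \<ge> 0\<close> by (simp add: real_le_lsqrt)
    define c where "c z l = kcomb_coeff \<sigma> z L l" for z l
    define w where "w = restrict (\<lambda>(z, l). of_int \<lfloor>c z l / e\<rfloor> * e) (J \<times> \<Lambda>)"
    have w_close: "\<bar>w (z, l) - c z l\<bar> \<le> e" if "z \<in> J" "l \<in> \<Lambda>" for z l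
    proof -
      have "\<bar>of_int \<lfloor>c z l / e\<rfloor> - c z l / e\<bar> \<le> 1" by linarith
      then have "\<bar>of_int \<lfloor>c z l / e\<rfloor> - c z l / e\<bar> * e \<le> e" using \<open>e > 0\<close> by simp
      also have "\<bar>of_int \<lfloor>c z l / e\<rfloor> - c z l / e\<bar> * e = \<bar>(of_int \<lfloor>c z l / e\<rfloor> - c z l / e) * e\<bar>"
        using \<open>e > 0\<close> by (simp add: abs_mult)
      finally show ?thesis using \<open>e > 0\<close> that by (simp add: w_def left_diff_distrib)
    qed
    have "w \<in> J \<times> \<Lambda> \<rightarrow>\<^sub>E V"
    proof (unfold w_def restrict_PiE_iff, intro ballI, clarsimp)
      fix z l
      have "\<bar>c z l\<bar> \<le> R" unfolding c_def using kcomb_coeff_le_norm normL order.trans by blast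
      then have "c z l / e \<le> R / e" "- (R / e) \<le> c z l / e"
        using \<open>e > 0\<close> by (auto simp: divide_le_cancel divide_right_mono minus_divide_left simp del: minus_divide_left[symmetric])
      then have "\<lfloor>c z l / e\<rfloor> \<in> {- K..K}"
        unfolding K_def by (auto simp: le_floor_iff floor_le_iff) linarith+
      then show "of_int \<lfloor>c z l / e\<rfloor> * e \<in> V" unfolding V_def by blast
    qed
    moreover have "\<bar>clip (f x) - q w x\<bar>
         \<le> e + R * (sqrt 2 * (sqrt (real CARD('d)) * (1 / real n0)) / \<sigma>) ^ n + real S * e"
      if x: "x \<in> unit_cube" for x
    proof -
      define z where "z = grid_floor n0 x"
      have z: "z \<in> J" unfolding z_def J_def using grid_floor_in_grid x \<open>n0 > 0\<close> by blast
      define G where "G l = gauss_feature \<sigma> l (x - z)" for l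
      have "(\<Sum>z'\<in>J. indicator {x. grid_floor n0 x = z'} x * (\<Sum>l\<in>\<Lambda>. w (z', l) * gauss_feature \<sigma> l (x - z')))
          = (\<Sum>z'\<in>J. if z = z' then (\<Sum>l\<in>\<Lambda>. w (z', l) * gauss_feature \<sigma> l (x - z')) else 0)"
        by (intro sum.cong) (auto simp: z_def)
      then have q: "q w x = clip (\<Sum>l\<in>\<Lambda>. w (z, l) * G l)"
        using z fin by (simp add: q_def G_def)
      have "\<bar>kcomb_eval \<sigma> L x - (\<Sum>l\<in>\<Lambda>. c z l * G l)\<bar> \<le> sqrt (kcomb_norm2 \<sigma> L) * (sqrt 2 * norm (x - z) / \<sigma>) ^ n"
        unfolding \<Lambda>_def c_def G_def by (rule kcomb_eval_truncation) fact
      also have "\<dots> \<le> R * (sqrt 2 * (sqrt (real CARD('d)) * (1 / real n0)) / \<sigma>) ^ n"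
        using norm_diff_grid_floor[OF \<open>n0 > 0\<close>, of x] \<open>\<sigma> > 0\<close> \<open>R \<ge> 0\<close> normL
        by (intro mult_mono power_mono divide_right_mono mult_left_mono) (auto simp: z_def kcomb_norm2_nonneg)
      finally have 1: "\<bar>kcomb_eval \<sigma> L x - (\<Sum>l\<in>\<Lambda>. c z l * G l)\<bar>
          \<le> R * (sqrt 2 * (sqrt (real CARD('d)) * (1 / real n0)) / \<sigma>) ^ n" .
      have "\<bar>(\<Sum>l\<in>\<Lambda>. c z l * G l) - (\<Sum>l\<in>\<Lambda>. w (z, l) * G l)\<bar> = \<bar>\<Sum>l\<in>\<Lambda>. (c z l - w (z, l)) * G l\<bar>"
        by (simp add: sum_subtractf left_diff_distrib)
      also have "\<dots> \<le> (\<Sum>l\<in>\<Lambda>. \<bar>(c z l - w (z, l)) * G l\<bar>)" by (rule sum_abs)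
      also have "\<dots> \<le> (\<Sum>l\<in>\<Lambda>. e)"
      proof (rule sum_mono)
        fix l assume "l \<in> \<Lambda>"
        then have "\<bar>c z l - w (z, l)\<bar> * \<bar>G l\<bar> \<le> e * 1"
          using w_close[OF z, of l] gauss_feature_le_1[of \<sigma> l "x - z"] \<open>e > 0\<close>
          by (intro mult_mono) (auto simp: G_def abs_minus_commute)
        then show "\<bar>(c z l - w (z, l)) * G l\<bar> \<le> e" by (simp add: abs_mult)
      qed
      also have "\<dots> = real S * e" by (simp add: S_def \<Lambda>_def)
      finally have 2: "\<bar>(\<Sum>l\<in>\<Lambda>. c z l * G l) - (\<Sum>l\<in>\<Lambda>. w (z, l) * G l)\<bar> \<le> real S * e" .
      have 3: "\<bar>f x - kcomb_eval \<sigma> L x\<bar> \<le> e" using L(3) x by blast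
      have "\<bar>clip (f x) - q w x\<bar> \<le> \<bar>f x - (\<Sum>l\<in>\<Lambda>. w (z, l) * G l)\<bar>"
        unfolding q by (rule clip_diff_le)
      then show ?thesis using 1 2 3 by linarith
    qed
    ultimately show ?thesis unfolding N_def by blast
  qed
  show ?thesis
    by (rule that[of N]) (use finN cardN meas approx in \<open>auto simp: N_def q_def\<close>)
qed

section \<open>Approximation by Gaussian averages\<close>

text \<open>Pairing of F with the discrete measure of the combination; for F in the RKHS this is the
  inner product of F with the combination.\<close>

definition kcomb_pair :: "(real^'d \<Rightarrow> real) \<Rightarrow> (real \<times> (real^'d)) list \<Rightarrow> real" where
  "kcomb_pair F L = (\<Sum>(a, t)\<leftarrow>L. a * F t)"

lemma kcomb_pair_simps [simp]:
  "kcomb_pair F [] = 0"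
  "kcomb_pair F (p # L) = fst p * F (snd p) + kcomb_pair F L"
  by (simp_all add: kcomb_pair_def case_prod_unfold)

lemma kcomb_pair_scale: "kcomb_pair F (kcomb_scale c L) = c * kcomb_pair F L"
  by (induction L) (auto simp: kcomb_scale_def algebra_simps)

lemma kcomb_pair_mult: "kcomb_pair (\<lambda>x. c * F x) L = c * kcomb_pair F L"
  by (induction L) (auto simp: algebra_simps)

lemma kcomb_pair_sum: "kcomb_pair (\<lambda>x. \<Sum>i\<in>I. F i x) L = (\<Sum>i\<in>I. kcomb_pair (F i) L)"
  by (induction L) (auto simp: sum.distrib sum_distrib_left)

lemma kcomb_norm2_Cons:
  "kcomb_norm2 \<sigma> ((s, x) # L) = s\<^sup>2 + 2 * s * kcomb_eval \<sigma> L x + kcomb_norm2 \<sigma> L"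
proof -
  have "kcomb_inner \<sigma> L ((s, x) # M) = s * kcomb_eval \<sigma> L x + kcomb_inner \<sigma> L M" for M
    by (simp add: kcomb_inner_commute[of \<sigma> L "(s, x) # M"] kcomb_inner_commute[of \<sigma> L M])
  then show ?thesis by (simp add: kcomb_norm2_inner power2_eq_square algebra_simps)
qed

text \<open>For a function given by an inner product with the features, the right-hand side below is a
  squared distance in feature space. The condition thus says that the function lies in the
  RKHS with squared norm at most \<open>B\<close>.\<close>

definition dual_norm2_le :: "real \<Rightarrow> (real^'d \<Rightarrow> real) \<Rightarrow> real \<Rightarrow> bool" where
  "dual_norm2_le \<sigma> F B \<longleftrightarrow> (\<forall>L. 0 \<le> B - 2 * kcomb_pair F L + kcomb_norm2 \<sigma> L)"

lemma dual_norm2_le_mono: "dual_norm2_le \<sigma> F B \<Longrightarrow> B \<le> B' \<Longrightarrow> dual_norm2_le \<sigma> F B'"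
  unfolding dual_norm2_le_def by (meson add_right_mono diff_right_mono order.trans)

text \<open>Young's inequality with a free weight s, obtained by applying the defining inequality to
  a multiple of L. It stands in for Cauchy-Schwarz between F and L.\<close>

lemma dual_norm2_le_scaled:
  assumes "dual_norm2_le \<sigma> F B" "s > 0"
  shows "2 * c * kcomb_pair F L \<le> s * c\<^sup>2 * B + kcomb_norm2 \<sigma> L / s"
proof (cases "c = 0")
  case False
  have "0 \<le> B - 2 * (1 / (s * c) * kcomb_pair F L) + (1 / (s * c))\<^sup>2 * kcomb_norm2 \<sigma> L"
    using assms(1)[unfolded dual_norm2_le_def, rule_format, of "kcomb_scale (1 / (s * c)) L"]
    by (simp add: kcomb_pair_scale kcomb_norm2_scale)
  then have "0 \<le> s * c\<^sup>2 * (B - 2 * (1 / (s * c) * kcomb_pair F L) + (1 / (s * c))\<^sup>2 * kcomb_norm2 \<sigma> L)"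
    using \<open>s > 0\<close> by simp
  also have "\<dots> = s * c\<^sup>2 * B - 2 * c * kcomb_pair F L + kcomb_norm2 \<sigma> L / s"
    using \<open>s > 0\<close> False by (simp add: field_simps power2_eq_square)
  finally show ?thesis by simp
qed (use assms kcomb_norm2_nonneg[of \<sigma> L] in simp)

lemma dual_norm2_le_mult:
  assumes "dual_norm2_le \<sigma> F B"
  shows "dual_norm2_le \<sigma> (\<lambda>x. c * F x) (c\<^sup>2 * B)"
  using dual_norm2_le_scaled[OF assms, of 1 c] by (simp add: dual_norm2_le_def kcomb_pair_mult algebra_simps)

text \<open>Taking the weight s equal to the number of summands shares
  \<open>kcomb_norm2 \<sigma> L\<close> equally among them.\<close>

lemma dual_norm2_le_sum:
  assumes "finite I" "I \<noteq> {}" "\<And>i. i \<in> I \<Longrightarrow> dual_norm2_le \<sigma> (F i) (B i)"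
  shows "dual_norm2_le \<sigma> (\<lambda>x. \<Sum>i\<in>I. c i * F i x) (\<Sum>i\<in>I. real (card I) * (c i)\<^sup>2 * B i)"
  unfolding dual_norm2_le_def
proof
  fix L
  have pos: "real (card I) > 0" using assms by (simp add: card_gt_0_iff)
  have "2 * kcomb_pair (\<lambda>x. \<Sum>i\<in>I. c i * F i x) L = (\<Sum>i\<in>I. 2 * c i * kcomb_pair (F i) L)"
    by (simp add: kcomb_pair_sum kcomb_pair_mult sum_distrib_left mult.assoc)
  also have "\<dots> \<le> (\<Sum>i\<in>I. real (card I) * (c i)\<^sup>2 * B i + kcomb_norm2 \<sigma> L / real (card I))"
    by (intro sum_mono dual_norm2_le_scaled assms pos)
  also have "\<dots> = (\<Sum>i\<in>I. real (card I) * (c i)\<^sup>2 * B i) + kcomb_norm2 \<sigma> L"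
    using pos by (simp add: sum.distrib)
  finally show "0 \<le> (\<Sum>i\<in>I. real (card I) * (c i)\<^sup>2 * B i)
      - 2 * kcomb_pair (\<lambda>x. \<Sum>i\<in>I. c i * F i x) L + kcomb_norm2 \<sigma> L" by simp
qed

text \<open>A combination that almost minimises the distance to \<open>F\<close> is almost orthogonal to the kernel
  sections, hence close to \<open>F\<close> uniformly on the cube.\<close>

lemma dual_norm2_le_approx:
  assumes F: "dual_norm2_le \<sigma> F B" and "e > 0"
  obtains L where "\<forall>p\<in>set L. snd p \<in> unit_cube" "kcomb_norm2 \<sigma> L \<le> 4 * B + 2 * e\<^sup>2"
    "\<forall>x\<in>unit_cube. \<bar>kcomb_eval \<sigma> L x - F x\<bar> \<le> e"
proof -
  define Q where "Q L = B - 2 * kcomb_pair F L + kcomb_norm2 \<sigma> L" for L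
  define \<L> where "\<L> = {L :: (real \<times> (real^'a)) list. \<forall>p\<in>set L. snd p \<in> unit_cube}"
  have Q: "Q L \<ge> 0" for L using F by (simp add: dual_norm2_le_def Q_def)
  have ne: "[] \<in> \<L>" by (simp add: \<L>_def)
  have bdd: "bdd_below (Q ` \<L>)" using Q by (intro bdd_belowI[of _ 0]) auto
  have "Inf (Q ` \<L>) < Inf (Q ` \<L>) + e\<^sup>2" using \<open>e > 0\<close> by simp
  then obtain L where L: "L \<in> \<L>" "Q L < Inf (Q ` \<L>) + e\<^sup>2"
    using cInf_lessD[of "Q ` \<L>"] ne by blast
  have "Inf (Q ` \<L>) \<le> Q []" using ne bdd by (intro cInf_lower) auto
  then have "Q L \<le> B + e\<^sup>2" using L by (simp add: Q_def kcomb_norm2_def)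
  \<comment> \<open>The weight 2 leaves half of the squared norm of L on the right, which can be
    moved to the left; this gives the factor 4.\<close>
  moreover have "2 * 1 * kcomb_pair F L \<le> 2 * 1\<^sup>2 * B + kcomb_norm2 \<sigma> L / 2"
    by (rule dual_norm2_le_scaled[OF F]) simp
  ultimately have "kcomb_norm2 \<sigma> L \<le> 4 * B + 2 * e\<^sup>2" by (simp add: Q_def)
  moreover have "\<bar>kcomb_eval \<sigma> L x - F x\<bar> \<le> e" if x: "x \<in> unit_cube" for x
  proof -
    \<comment> \<open>The residual at x is the best coefficient for an added kernel section there;
      the gain in Q is exactly its square.\<close>
    define s where "s = F x - kcomb_eval \<sigma> L x"
    have "(s, x) # L \<in> \<L>" using L x by (auto simp: \<L>_def)
    then have "Inf (Q ` \<L>) \<le> Q ((s, x) # L)" using bdd by (intro cInf_lower) auto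
    also have "Q ((s, x) # L) = Q L - s\<^sup>2"
      by (simp add: Q_def kcomb_norm2_Cons s_def power2_eq_square algebra_simps)
    finally have "s\<^sup>2 \<le> e\<^sup>2" using L by simp
    then have "\<bar>s\<bar> \<le> e" using \<open>e > 0\<close> by (simp add: abs_le_square_iff[symmetric])
    then show ?thesis by (simp add: s_def abs_minus_commute)
  qed
  ultimately show ?thesis using that L by (auto simp: \<L>_def)
qed

section \<open>Gaussian integrals and square-integrable features\<close>

lemma nn_integral_gauss:
  fixes x :: "real^'d"
  assumes "c > 0"
  shows "(\<integral>\<^sup>+v. ennreal (exp (- c * (norm (v - x))\<^sup>2)) \<partial>lborel) = ennreal (sqrt (pi / c) ^ CARD('d))"
proof -
  \<comment> \<open>The standard deviation for which the normal density is proportional to exp (- c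
    * (y - \<mu>) ^ 2).\<close>
  define s where "s = 1 / sqrt (2 * c)"
  have s: "s > 0" "2 * s\<^sup>2 = 1 / c" using assms by (auto simp: s_def power_divide)
  have one: "(\<integral>\<^sup>+y. ennreal (exp (- c * (y - \<mu>)\<^sup>2)) \<partial>lborel) = ennreal (sqrt (pi / c))" for \<mu> :: real
  proof -
    have eq: "exp (- c * (y - \<mu>)\<^sup>2) = sqrt (pi / c) * normal_density \<mu> s y" for y
    proof -
      have "2 * pi * s\<^sup>2 = pi / c" "- (y - \<mu>)\<^sup>2 / (2 * s\<^sup>2) = - c * (y - \<mu>)\<^sup>2"
        using s(2) by (simp_all add: mult.assoc mult.left_commute[of 2 pi])
      then show ?thesis using assms by (simp add: normal_density_def)
    qed
    have "(\<integral>\<^sup>+y. ennreal (normal_density \<mu> s y) \<partial>lborel) = 1"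
      using prob_space.emeasure_space_1[OF prob_space_normal_density[OF s(1), of \<mu>]]
      by (simp add: emeasure_density)
    then show ?thesis
      unfolding eq using assms s by (simp add: ennreal_mult nn_integral_cmult)
  qed
  have "exp (- c * (norm (v - x))\<^sup>2) = (\<Prod>b\<in>Basis. exp (- c * (v \<bullet> b - x \<bullet> b)\<^sup>2))" for v
  proof -
    have "(norm (v - x))\<^sup>2 = (\<Sum>b\<in>Basis. (v \<bullet> b - x \<bullet> b)\<^sup>2)"
      unfolding power2_norm_eq_inner euclidean_inner[of "v - x" "v - x"]
      by (simp add: power2_eq_square inner_diff_left)
    then show ?thesis by (simp add: exp_sum[symmetric] sum_negf sum_distrib_left)
  qed
  then have "(\<integral>\<^sup>+v. ennreal (exp (- c * (norm (v - x))\<^sup>2)) \<partial>lborel)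
      = (\<integral>\<^sup>+v. (\<Prod>b\<in>Basis. ennreal (exp (- c * (v \<bullet> b - x \<bullet> b)\<^sup>2))) \<partial>lborel)"
    by (simp add: prod_ennreal)
  also have "\<dots> = (\<Prod>b\<in>(Basis :: (real^'d) set). (\<integral>\<^sup>+y. ennreal (exp (- c * (y - x \<bullet> b)\<^sup>2)) \<partial>lborel))"
    by (intro nn_integral_lborel_prod) auto
  also have "\<dots> = ennreal (sqrt (pi / c)) ^ CARD('d)" unfolding one by simp
  finally show ?thesis using assms by (simp add: ennreal_power)
qed

lemma has_integral_gauss:
  fixes x :: "real^'d"
  assumes "c > 0"
  shows "has_bochner_integral lborel (\<lambda>v. exp (- c * (norm (v - x))\<^sup>2)) (sqrt (pi / c) ^ CARD('d))"
  using assms by (intro has_bochner_integral_nn_integral nn_integral_gauss) auto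

text \<open>Completing the square around the weighted mean p. The rates combine as a * b / (a + b):
  two equal rates 2 / \<sigma> ^ 2 give the kernel rate 1 / \<sigma> ^ 2, and unequal ones let a
  Gaussian be factored as a convolution.\<close>

lemma gauss_semigroup:
  fixes x u :: "real^'d"
  assumes "a > 0" "b > 0"
  shows "has_bochner_integral lborel (\<lambda>v. exp (- a * (norm (v - x))\<^sup>2) * exp (- b * (norm (v - u))\<^sup>2))
    (sqrt (pi / (a + b)) ^ CARD('d) * exp (- (a * b / (a + b)) * (norm (x - u))\<^sup>2))"
proof -
  define p where "p = (1 / (a + b)) *\<^sub>R (a *\<^sub>R x + b *\<^sub>R u)"
  have "a * (norm (v - x))\<^sup>2 + b * (norm (v - u))\<^sup>2
      = (a + b) * (norm (v - p))\<^sup>2 + (a * b / (a + b)) * (norm (x - u))\<^sup>2" for v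
  proof -
    have "(a + b) *\<^sub>R p = a *\<^sub>R x + b *\<^sub>R u" using assms by (simp add: p_def)
    then have vp: "(a + b) * (v \<bullet> p) = a * (v \<bullet> x) + b * (v \<bullet> u)"
      by (metis inner_add_right inner_scaleR_right)
    have pp: "(a + b) * ((a + b) * (p \<bullet> p)) = a * a * (x \<bullet> x) + 2 * a * b * (x \<bullet> u) + b * b * (u \<bullet> u)"
    proof -
      have "(a + b) * ((a + b) * (p \<bullet> p)) = ((a + b) *\<^sub>R p) \<bullet> ((a + b) *\<^sub>R p)" by simp
      also have "\<dots> = (a *\<^sub>R x + b *\<^sub>R u) \<bullet> (a *\<^sub>R x + b *\<^sub>R u)"
        using \<open>(a + b) *\<^sub>R p = a *\<^sub>R x + b *\<^sub>R u\<close> by simp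
      finally show ?thesis by (simp add: inner_add inner_commute algebra_simps)
    qed
    have "(a + b) * ((a + b) * (norm (v - p))\<^sup>2) + a * b * (norm (x - u))\<^sup>2
        = (a + b) * ((a + b) * (v \<bullet> v)) - 2 * (a + b) * ((a + b) * (v \<bullet> p)) + (a + b) * ((a + b) * (p \<bullet> p))
          + a * b * (x \<bullet> x - 2 * (x \<bullet> u) + u \<bullet> u)"
      unfolding power2_norm_eq_inner by (simp add: inner_diff inner_commute algebra_simps)
    also have "\<dots> = (a + b) * (a * (norm (v - x))\<^sup>2 + b * (norm (v - u))\<^sup>2)"
      unfolding vp pp power2_norm_eq_inner by (simp add: inner_diff inner_commute algebra_simps)
    finally have "(a * (norm (v - x))\<^sup>2 + b * (norm (v - u))\<^sup>2)
        = ((a + b) * ((a + b) * (norm (v - p))\<^sup>2) + a * b * (norm (x - u))\<^sup>2) / (a + b)"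
      using assms by (simp add: nonzero_eq_divide_eq mult.commute)
    then show ?thesis using assms by (simp add: add_divide_distrib)
  qed
  then have "- a * (norm (v - x))\<^sup>2 + - b * (norm (v - u))\<^sup>2
      = - (a + b) * (norm (v - p))\<^sup>2 + - (a * b / (a + b)) * (norm (x - u))\<^sup>2" for v
    by (metis (no_types) minus_add_distrib mult_minus_left)
  then have "exp (- a * (norm (v - x))\<^sup>2) * exp (- b * (norm (v - u))\<^sup>2)
      = exp (- (a + b) * (norm (v - p))\<^sup>2) * exp (- (a * b / (a + b)) * (norm (x - u))\<^sup>2)" for v
    unfolding exp_add[symmetric] by (simp only:)
  moreover have "has_bochner_integral lborel
      (\<lambda>v. exp (- (a + b) * (norm (v - p))\<^sup>2) * exp (- (a * b / (a + b)) * (norm (x - u))\<^sup>2))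
      (sqrt (pi / (a + b)) ^ CARD('d) * exp (- (a * b / (a + b)) * (norm (x - u))\<^sup>2))"
    using assms has_integral_gauss[of "a + b" p] by (intro has_bochner_integral_mult_left) auto
  ultimately show ?thesis by simp
qed

text \<open>Image of the combination under the feature map into square-integrable functions; for a =
  2 / \<sigma> ^ 2 its inner products are kernel inner products up to a constant factor.\<close>

definition gauss_comb :: "real \<Rightarrow> (real \<times> (real^'d)) list \<Rightarrow> real^'d \<Rightarrow> real" where
  "gauss_comb a L v = kcomb_pair (\<lambda>t. exp (- a * (norm (v - t))\<^sup>2)) L"

lemma has_integral_gauss_comb:
  assumes "\<And>t. has_bochner_integral lborel (\<lambda>v. exp (- a * (norm (v - t))\<^sup>2) * h v) (F t)"
  shows "has_bochner_integral lborel (\<lambda>v. gauss_comb a L v * h v) (kcomb_pair F L)"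
proof (induction L)
  case (Cons p L)
  have "has_bochner_integral lborel
      (\<lambda>v. fst p * (exp (- a * (norm (v - snd p))\<^sup>2) * h v) + gauss_comb a L v * h v) (kcomb_pair F (p # L))"
    using assms Cons by (auto intro!: has_bochner_integral_add has_bochner_integral_mult_right)
  then show ?case by (simp add: gauss_comb_def algebra_simps)
qed (simp add: gauss_comb_def has_bochner_integral_zero)

text \<open>The expression bounded below in \<open>dual_norm2_le\<close> is the integral of
  \<open>(\<gamma> * h v - gauss_comb a L v)\<^sup>2 / \<gamma>\<close>, where \<gamma> is the
  factor between the integral inner product and the kernel.\<close>

lemma dual_norm2_le_feature:
  fixes h :: "real^'d \<Rightarrow> real"
  assumes "\<sigma> > 0" and h2: "has_bochner_integral lborel (\<lambda>v. (h v)\<^sup>2) H"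
    and hF: "\<And>t. has_bochner_integral lborel (\<lambda>v. exp (- (2 / \<sigma>\<^sup>2) * (norm (v - t))\<^sup>2) * h v) (F t)"
  shows "dual_norm2_le \<sigma> F ((\<sigma> * sqrt (pi / 4)) ^ CARD('d) * H)"
  unfolding dual_norm2_le_def
proof
  fix L
  define a where "a = 2 / \<sigma>\<^sup>2"
  define \<gamma> where "\<gamma> = (\<sigma> * sqrt (pi / 4)) ^ CARD('d)"
  have "a > 0" "\<gamma> > 0" using assms by (auto simp: a_def \<gamma>_def)
  have "pi / (a + a) = \<sigma>\<^sup>2 * (pi / 4)" using assms by (simp add: a_def)
  then have "sqrt (pi / (a + a)) = \<sigma> * sqrt (pi / 4)"
    using \<open>\<sigma> > 0\<close> by (simp only: real_sqrt_mult real_sqrt_abs abs_of_pos)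
  then have \<gamma>: "sqrt (pi / (a + a)) ^ CARD('d) = \<gamma>" by (simp only: \<gamma>_def)
  have c: "a * a / (a + a) = 1 / \<sigma>\<^sup>2" using assms by (simp add: a_def field_simps)
  have gk: "has_bochner_integral lborel (\<lambda>v. exp (- a * (norm (v - t))\<^sup>2) * exp (- a * (norm (v - s))\<^sup>2))
      (\<gamma> * gauss_kernel \<sigma> s t)" for s t :: "real^'d"
    using gauss_semigroup[OF \<open>a > 0\<close> \<open>a > 0\<close>, of t s] unfolding \<gamma> c
    by (simp add: gauss_kernel_def norm_minus_commute)
  have pk: "kcomb_pair (\<lambda>t. \<gamma> * gauss_kernel \<sigma> s t) L = \<gamma> * kcomb_eval \<sigma> L s" for s :: "real^'d"
    by (induction L) (auto simp: algebra_simps)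
  have "has_bochner_integral lborel (\<lambda>v. exp (- a * (norm (v - s))\<^sup>2) * gauss_comb a L v) (\<gamma> * kcomb_eval \<sigma> L s)" for s :: "real^'d"
    using has_integral_gauss_comb[of a "\<lambda>v. exp (- a * (norm (v - s))\<^sup>2)", OF gk, of L]
    by (simp add: mult.commute pk)
  from has_integral_gauss_comb[OF this, of L]
  have ss: "has_bochner_integral lborel (\<lambda>v. gauss_comb a L v * gauss_comb a L v) (\<gamma> * kcomb_norm2 \<sigma> L)"
    by (simp add: kcomb_pair_mult) (simp add: kcomb_pair_def kcomb_norm2_inner kcomb_inner_def)
  have sh: "has_bochner_integral lborel (\<lambda>v. gauss_comb a L v * h v) (kcomb_pair F L)"
    by (rule has_integral_gauss_comb) (use hF in \<open>simp add: a_def\<close>)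
  have int: "has_bochner_integral lborel
      (\<lambda>v. \<gamma> * (h v)\<^sup>2 - 2 * (gauss_comb a L v * h v) + 1 / \<gamma> * (gauss_comb a L v * gauss_comb a L v))
      (\<gamma> * H - 2 * kcomb_pair F L + 1 / \<gamma> * (\<gamma> * kcomb_norm2 \<sigma> L))"
    by (intro has_bochner_integral_add has_bochner_integral_diff has_bochner_integral_mult_right h2 sh ss)
  have nonneg: "0 \<le> \<gamma> * (h v)\<^sup>2 - 2 * (gauss_comb a L v * h v) + 1 / \<gamma> * (gauss_comb a L v * gauss_comb a L v)" for v
  proof -
    have "\<gamma> * (h v)\<^sup>2 - 2 * (gauss_comb a L v * h v) + 1 / \<gamma> * (gauss_comb a L v * gauss_comb a L v)
        = (\<gamma> * h v - gauss_comb a L v)\<^sup>2 / \<gamma>"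
      using \<open>\<gamma> > 0\<close> by (simp add: field_simps power2_eq_square)
    then show ?thesis using \<open>\<gamma> > 0\<close> by simp
  qed
  have "0 \<le> \<gamma> * H - 2 * kcomb_pair F L + 1 / \<gamma> * (\<gamma> * kcomb_norm2 \<sigma> L)"
    by (subst has_bochner_integral_integral_eq[OF int, symmetric], rule Bochner_Integration.integral_nonneg) (rule nonneg)
  then show "0 \<le> (\<sigma> * sqrt (pi / 4)) ^ CARD('d) * H - 2 * kcomb_pair F L + kcomb_norm2 \<sigma> L"
    using \<open>\<sigma> > 0\<close> by (simp add: \<gamma>_def)
qed

text \<open>The rates a = 2 / \<sigma> ^ 2 and b combine to c, so the average of g at rate c is, up
  to the factor Gab, the inner product of the features with h, the average of g at rate b. The
  condition c < a makes b positive. Square integrability of h follows from a sup bound proportional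
  to M and an integral bound proportional to the integral of the absolute value of g.\<close>

lemma dual_norm2_le_gauss_conv:
  fixes g :: "real^'d \<Rightarrow> real"
  assumes "\<sigma> > 0" and g [measurable]: "g \<in> borel_measurable borel" and M: "\<And>u. \<bar>g u\<bar> \<le> M"
    and int: "integrable lborel g" and c: "0 < c" "c < 2 / \<sigma>\<^sup>2"
  defines "b \<equiv> 2 / \<sigma>\<^sup>2 * c / (2 / \<sigma>\<^sup>2 - c)"
  shows "dual_norm2_le \<sigma> (\<lambda>x. \<integral>u. exp (- c * (norm (u - x))\<^sup>2) * g u \<partial>lborel)
    ((1 / sqrt (pi / (2 / \<sigma>\<^sup>2 + b)) ^ CARD('d))\<^sup>2 * ((\<sigma> * sqrt (pi / 4)) ^ CARD('d) *
       (M * sqrt (pi / b) ^ CARD('d) * (sqrt (pi / b) ^ CARD('d) * (\<integral>u. \<bar>g u\<bar> \<partial>lborel)))))"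
proof -
  define a where "a = 2 / \<sigma>\<^sup>2"
  have "a > 0" "a - c > 0" using assms by (auto simp: a_def)
  have b: "b = a * c / (a - c)" by (simp add: b_def a_def)
  have "b > 0" unfolding b using \<open>a > 0\<close> \<open>a - c > 0\<close> c by simp
  have abc: "a * b / (a + b) = c"
  proof -
    have "a + b = a * a / (a - c)" using \<open>a - c > 0\<close> by (simp add: b field_simps)
    then show ?thesis using \<open>a > 0\<close> \<open>a - c > 0\<close> by (simp add: b)
  qed
  define Gb Gab I where "Gb = sqrt (pi / b) ^ CARD('d)" and "Gab = sqrt (pi / (a + b)) ^ CARD('d)"
    and "I = (\<integral>u. \<bar>g u\<bar> \<partial>lborel)"
  have pos: "Gb > 0" "Gab > 0" "I \<ge> 0"
    using \<open>a > 0\<close> \<open>b > 0\<close> by (auto simp: Gb_def Gab_def I_def)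
  have "M \<ge> 0" using M[of 0] by linarith
  have gi: "integrable lborel (\<lambda>u. exp (- b * (norm (v - u))\<^sup>2))" "(\<integral>u. exp (- b * (norm (v - u))\<^sup>2) \<partial>lborel) = Gb" for v :: "real^'d"
    using has_integral_gauss[OF \<open>b > 0\<close>, of v]
    by (simp_all add: has_bochner_integral_iff norm_minus_commute Gb_def)
  define h where "h v = (\<integral>u. exp (- b * (norm (v - u))\<^sup>2) * g u \<partial>lborel)" for v
  have [measurable]: "h \<in> borel_measurable lborel"
    unfolding h_def by (intro lborel.borel_measurable_lebesgue_integral) simp
  have inti: "integrable lborel (\<lambda>u. exp (- b * (norm (v - u))\<^sup>2) * g u)" for v
    using int by (rule Bochner_Integration.integrable_bound)
      (use \<open>b > 0\<close> in \<open>auto intro!: mult_left_le_one_le simp: abs_mult\<close>)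
  then have inti': "integrable lborel (\<lambda>u. exp (- b * (norm (v - u))\<^sup>2) * \<bar>g u\<bar>)" for v
    by (subst (asm) integrable_abs_iff[symmetric]) (auto simp: abs_mult)
  have absh: "\<bar>h v\<bar> \<le> (\<integral>u. exp (- b * (norm (v - u))\<^sup>2) * \<bar>g u\<bar> \<partial>lborel)" for v
    unfolding h_def using integral_abs_bound[of lborel "\<lambda>u. exp (- b * (norm (v - u))\<^sup>2) * g u"]
    by (simp add: abs_mult)
  have inner_le: "(\<integral>u. exp (- b * (norm (v - u))\<^sup>2) * \<bar>g u\<bar> \<partial>lborel) \<le> M * Gb" for v
  proof -
    have "(\<integral>u. exp (- b * (norm (v - u))\<^sup>2) * \<bar>g u\<bar> \<partial>lborel) \<le> (\<integral>u. exp (- b * (norm (v - u))\<^sup>2) * M \<partial>lborel)"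
      by (intro integral_mono inti' integrable_mult_left gi) (auto intro!: mult_left_mono M)
    then show ?thesis by (simp add: gi(2)[simplified] mult.commute)
  qed
  have hM: "\<bar>h v\<bar> \<le> M * Gb" for v using absh inner_le order.trans by blast
  have "(\<integral>\<^sup>+v. ennreal \<bar>h v\<bar> \<partial>lborel)
      \<le> (\<integral>\<^sup>+v. \<integral>\<^sup>+u. ennreal (exp (- b * (norm (v - u))\<^sup>2)) * ennreal \<bar>g u\<bar> \<partial>lborel \<partial>lborel)"
  proof (rule nn_integral_mono)
    fix v
    have "ennreal \<bar>h v\<bar> \<le> ennreal (\<integral>u. exp (- b * (norm (v - u))\<^sup>2) * \<bar>g u\<bar> \<partial>lborel)"
      using absh by (rule ennreal_leI)
    also have "\<dots> = (\<integral>\<^sup>+u. ennreal (exp (- b * (norm (v - u))\<^sup>2) * \<bar>g u\<bar>) \<partial>lborel)"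
      by (rule nn_integral_eq_integral[symmetric, OF inti']) auto
    finally show "ennreal \<bar>h v\<bar> \<le> (\<integral>\<^sup>+u. ennreal (exp (- b * (norm (v - u))\<^sup>2)) * ennreal \<bar>g u\<bar> \<partial>lborel)"
      by (simp add: ennreal_mult)
  qed
  also have "\<dots> = (\<integral>\<^sup>+u. \<integral>\<^sup>+v. ennreal (exp (- b * (norm (v - u))\<^sup>2)) * ennreal \<bar>g u\<bar> \<partial>lborel \<partial>lborel)"
    by (rule lborel_pair.Fubini') simp
  also have "\<dots> = (\<integral>\<^sup>+u. ennreal Gb * ennreal \<bar>g u\<bar> \<partial>lborel)"
    by (simp add: nn_integral_multc nn_integral_gauss[OF \<open>b > 0\<close>, simplified] Gb_def)
  also have "\<dots> = ennreal (Gb * I)"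
    using int pos by (simp add: nn_integral_cmult nn_integral_eq_integral ennreal_mult I_def)
  finally have nnh: "(\<integral>\<^sup>+v. ennreal \<bar>h v\<bar> \<partial>lborel) \<le> ennreal (Gb * I)" .
  have h_int: "integrable lborel h"
    by (rule integrableI_bounded) (use nnh le_less_trans in fastforce)+
  have h_I: "(\<integral>v. \<bar>h v\<bar> \<partial>lborel) \<le> Gb * I"
    using nnh pos h_int by (simp add: nn_integral_eq_integral)
  have h2_le: "(h v)\<^sup>2 \<le> M * Gb * \<bar>h v\<bar>" for v
  proof -
    have "\<bar>h v\<bar> * \<bar>h v\<bar> \<le> M * Gb * \<bar>h v\<bar>" by (intro mult_right_mono hM) simp
    then show ?thesis by (simp add: power2_eq_square)
  qed
  have h2_int: "integrable lborel (\<lambda>v. (h v)\<^sup>2)"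
    by (rule Bochner_Integration.integrable_bound[of _ "\<lambda>v. M * Gb * \<bar>h v\<bar>"])
      (use h_int h2_le in \<open>auto intro: order.trans[OF _ abs_ge_self]\<close>)
  have h2_I: "(\<integral>v. (h v)\<^sup>2 \<partial>lborel) \<le> M * Gb * (Gb * I)"
  proof -
    have "(\<integral>v. (h v)\<^sup>2 \<partial>lborel) \<le> (\<integral>v. M * Gb * \<bar>h v\<bar> \<partial>lborel)"
      using h_int h2_int by (intro integral_mono h2_le) auto
    also have "\<dots> = M * Gb * (\<integral>v. \<bar>h v\<bar> \<partial>lborel)" by simp
    also have "\<dots> \<le> M * Gb * (Gb * I)"
      using h_I \<open>M \<ge> 0\<close> pos by (intro mult_left_mono) auto
    finally show ?thesis .
  qed
  define F where "F t = (\<integral>u. exp (- c * (norm (u - t))\<^sup>2) * g u \<partial>lborel)" for t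
  have conv: "has_bochner_integral lborel (\<lambda>v. exp (- a * (norm (v - t))\<^sup>2) * h v) (Gab * F t)" for t
  proof -
    define f where "f v u = exp (- a * (norm (v - t))\<^sup>2) * (exp (- b * (norm (v - u))\<^sup>2) * g u)" for v u
    have [measurable]: "(\<lambda>(v, u). f v u) \<in> borel_measurable (lborel \<Otimes>\<^sub>M lborel)"
      unfolding f_def by simp
    have ga: "integrable lborel (\<lambda>v. exp (- a * (norm (v - t))\<^sup>2))"
      using has_integral_gauss[OF \<open>a > 0\<close>, of t] by (simp add: has_bochner_integral_iff)
    have fint: "integrable (lborel \<Otimes>\<^sub>M lborel) (\<lambda>(v, u). f v u)"
    proof (rule lborel_pair.Fubini_integrable)
      have eq: "(\<integral>u. norm (case (v, u) of (v, u) \<Rightarrow> f v u) \<partial>lborel)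
          = exp (- a * (norm (v - t))\<^sup>2) * (\<integral>u. exp (- b * (norm (v - u))\<^sup>2) * \<bar>g u\<bar> \<partial>lborel)" for v
        by (simp add: f_def abs_mult)
      have [measurable]: "(\<lambda>v. \<integral>u. exp (- b * (norm (v - u))\<^sup>2) * \<bar>g u\<bar> \<partial>lborel) \<in> borel_measurable lborel"
        by (intro lborel.borel_measurable_lebesgue_integral) simp
      show "integrable lborel (\<lambda>v. \<integral>u. norm (case (v, u) of (v, u) \<Rightarrow> f v u) \<partial>lborel)"
        unfolding eq
      proof (rule Bochner_Integration.integrable_bound[of _ "\<lambda>v. exp (- a * (norm (v - t))\<^sup>2) * (M * Gb)"])
        show "integrable lborel (\<lambda>v. exp (- a * (norm (v - t))\<^sup>2) * (M * Gb))"
          using ga by (rule integrable_mult_left)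
        have "0 \<le> (\<integral>u. exp (- b * (norm (v - u))\<^sup>2) * \<bar>g u\<bar> \<partial>lborel)" for v by simp
        then show "AE v in lborel. norm (exp (- a * (norm (v - t))\<^sup>2) * (\<integral>u. exp (- b * (norm (v - u))\<^sup>2) * \<bar>g u\<bar> \<partial>lborel))
            \<le> norm (exp (- a * (norm (v - t))\<^sup>2) * (M * Gb))"
          using inner_le \<open>M \<ge> 0\<close> pos by (intro AE_I2) (simp add: abs_mult del: mult_minus_left minus_mult_left)
      qed simp
      show "AE v in lborel. integrable lborel (\<lambda>u. case (v, u) of (v, u) \<Rightarrow> f v u)"
        by (intro AE_I2) (simp add: f_def inti[simplified])
    qed simp
    have 1: "(\<integral>u. f v u \<partial>lborel) = exp (- a * (norm (v - t))\<^sup>2) * h v" for v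
      by (simp add: f_def h_def)
    have 2: "(\<integral>v. f v u \<partial>lborel) = Gab * (exp (- c * (norm (u - t))\<^sup>2) * g u)" for u
    proof -
      have "has_bochner_integral lborel (\<lambda>v. exp (- a * (norm (v - t))\<^sup>2) * exp (- b * (norm (v - u))\<^sup>2) * g u)
          (Gab * exp (- c * (norm (t - u))\<^sup>2) * g u)"
        using gauss_semigroup[OF \<open>a > 0\<close> \<open>b > 0\<close>, of t u] unfolding abc Gab_def[symmetric]
        by (rule has_bochner_integral_mult_left)
      then show ?thesis
        by (simp add: has_bochner_integral_iff f_def mult.assoc norm_minus_commute)
    qed
    have "integrable lborel (\<lambda>v. \<integral>u. f v u \<partial>lborel)"
      using lborel_pair.integrable_fst'[OF fint] by simp
    moreover have "(\<integral>v. \<integral>u. f v u \<partial>lborel \<partial>lborel) = Gab * F t"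
      using lborel_pair.Fubini_integral[OF fint] unfolding 2 by (simp add: F_def)
    ultimately show ?thesis unfolding 1 by (simp add: has_bochner_integral_iff)
  qed
  have "has_bochner_integral lborel (\<lambda>v. (h v)\<^sup>2) (\<integral>v. (h v)\<^sup>2 \<partial>lborel)"
    using h2_int by (rule has_bochner_integral_integrable)
  from dual_norm2_le_feature[OF \<open>\<sigma> > 0\<close> this conv[unfolded a_def]]
  have "dual_norm2_le \<sigma> (\<lambda>t. 1 / Gab * (Gab * F t)) ((1 / Gab)\<^sup>2 * ((\<sigma> * sqrt (pi / 4)) ^ CARD('d) * (\<integral>v. (h v)\<^sup>2 \<partial>lborel)))"
    by (rule dual_norm2_le_mult)
  then have "dual_norm2_le \<sigma> (\<lambda>t. 1 / Gab * (Gab * F t)) ((1 / Gab)\<^sup>2 * ((\<sigma> * sqrt (pi / 4)) ^ CARD('d) * (M * Gb * (Gb * I))))"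
    by (rule dual_norm2_le_mono) (use h2_I \<open>\<sigma> > 0\<close> in \<open>intro mult_left_mono, auto\<close>)
  moreover have "(\<lambda>t. 1 / Gab * (Gab * F t)) = F" using pos by (auto simp: fun_eq_iff)
  ultimately show ?thesis unfolding F_def Gb_def Gab_def I_def a_def by simp
qed

section \<open>Averages against dilated Gaussians\<close>

lemma lborel_integral_affine:
  fixes f :: "real^'d \<Rightarrow> real"
  assumes "s > 0" and [measurable]: "f \<in> borel_measurable borel"
  shows "(\<integral>u. f u \<partial>lborel) = s ^ CARD('d) * (\<integral>y. f (x + s *\<^sub>R y) \<partial>lborel)"
proof -
  have "(\<integral>u. f u \<partial>lborel) = (\<integral>u. f u \<partial>density (distr lborel borel (\<lambda>y. x + s *\<^sub>R y)) (\<lambda>_. ennreal (\<bar>s\<bar> ^ CARD('d))))"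
    using lborel_affine[of s x] assms by simp
  also have "\<dots> = (\<integral>u. s ^ CARD('d) * f u \<partial>distr lborel borel (\<lambda>y. x + s *\<^sub>R y))"
    using assms by (subst integral_density) auto
  also have "\<dots> = (\<integral>y. s ^ CARD('d) * f (x + s *\<^sub>R y) \<partial>lborel)"
    by (subst integral_distr) auto
  finally show ?thesis by simp
qed

text \<open>In the variable u = x + j \<sigma> y the Gaussian has rate 1 / (j \<sigma>) ^ 2, below 2
  / \<sigma> ^ 2 because j >= 1. Every rate involved is a constant over \<sigma> ^ 2, so only powers
  of \<sigma> have to be counted: in dimension d the two squared normalisations contribute \<sigma>
  ^ (-4d), the three remaining factors \<sigma> ^ (3d).\<close>

lemma dual_norm2_le_gauss_mean:
  fixes g :: "real^'d \<Rightarrow> real"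
  assumes g [measurable]: "g \<in> borel_measurable borel" and M: "\<And>u. \<bar>g u\<bar> \<le> M"
    and int: "integrable lborel g" and "j \<ge> 1"
  shows "\<exists>K\<ge>0. \<forall>\<sigma>>0. dual_norm2_le \<sigma>
    (\<lambda>x. \<integral>y. exp (- (norm y)\<^sup>2) * g (x + (real j * \<sigma>) *\<^sub>R y) \<partial>lborel) (K / \<sigma> ^ CARD('d))"
proof -
  \<comment> \<open>The rate b of \<open>dual_norm2_le_gauss_conv\<close> for \<sigma> = 1.\<close>
  define \<beta> where "\<beta> = 2 / (2 * (real j)\<^sup>2 - 1)"
  have "(real j)\<^sup>2 \<ge> 1" using \<open>j \<ge> 1\<close> by simp
  then have "2 * (real j)\<^sup>2 - 1 > 0" by linarith
  then have "\<beta> > 0" by (simp add: \<beta>_def)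
  define s1 s2 s3 I where "s1 = sqrt (pi / (2 + \<beta>))" and "s2 = sqrt (pi / 4)" and "s3 = sqrt (pi / \<beta>)"
    and "I = (\<integral>u. \<bar>g u\<bar> \<partial>lborel)"
  have pos: "s1 > 0" "s2 > 0" "s3 > 0" "I \<ge> 0"
    using \<open>\<beta> > 0\<close> by (auto simp: s1_def s2_def s3_def I_def)
  have "M \<ge> 0" using M[of 0] by linarith
  define K where "K = (1 / real j ^ CARD('d))\<^sup>2 * ((1 / s1 ^ CARD('d))\<^sup>2 * (s2 ^ CARD('d) * (M * s3 ^ CARD('d) * (s3 ^ CARD('d) * I))))"
  have "K \<ge> 0" using pos \<open>M \<ge> 0\<close> by (simp add: K_def)
  moreover have "dual_norm2_le \<sigma>
    (\<lambda>x. \<integral>y. exp (- (norm y)\<^sup>2) * g (x + (real j * \<sigma>) *\<^sub>R y) \<partial>lborel) (K / \<sigma> ^ CARD('d))" if "\<sigma> > 0" for \<sigma>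
  proof -
    define c where "c = 1 / (real j * \<sigma>)\<^sup>2"
    have c: "c > 0" "c < 2 / \<sigma>\<^sup>2"
      using \<open>\<sigma> > 0\<close> \<open>j \<ge> 1\<close> \<open>2 * (real j)\<^sup>2 - 1 > 0\<close> by (auto simp: c_def power_mult_distrib field_simps)
    have b: "2 / \<sigma>\<^sup>2 * c / (2 / \<sigma>\<^sup>2 - c) = \<beta> / \<sigma>\<^sup>2"
    proof -
      have "2 / \<sigma>\<^sup>2 - c = (2 * (real j)\<^sup>2 - 1) / ((real j)\<^sup>2 * \<sigma>\<^sup>2)"
        using \<open>\<sigma> > 0\<close> \<open>j \<ge> 1\<close> by (simp add: c_def power_mult_distrib field_simps)
      then show ?thesis using \<open>\<sigma> > 0\<close> \<open>j \<ge> 1\<close> by (simp add: \<beta>_def c_def power_mult_distrib)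
    qed
    have root: "sqrt (pi / (t / \<sigma>\<^sup>2)) = \<sigma> * sqrt (pi / t)" for t
    proof -
      have "pi / (t / \<sigma>\<^sup>2) = \<sigma>\<^sup>2 * (pi / t)" by simp
      then show ?thesis using \<open>\<sigma> > 0\<close> by (simp only: real_sqrt_mult real_sqrt_abs abs_of_pos)
    qed
    have "2 / \<sigma>\<^sup>2 + \<beta> / \<sigma>\<^sup>2 = (2 + \<beta>) / \<sigma>\<^sup>2" by (simp add: add_divide_distrib)
    then have "dual_norm2_le \<sigma> (\<lambda>x. \<integral>u. exp (- c * (norm (u - x))\<^sup>2) * g u \<partial>lborel)
        ((1 / (\<sigma> * s1) ^ CARD('d))\<^sup>2 * ((\<sigma> * s2) ^ CARD('d) * (M * (\<sigma> * s3) ^ CARD('d) * ((\<sigma> * s3) ^ CARD('d) * I))))"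
      using dual_norm2_le_gauss_conv[OF \<open>\<sigma> > 0\<close> g M int c]
      unfolding b by (simp only: root s1_def s2_def s3_def I_def)
    from dual_norm2_le_mult[OF this, of "1 / (real j * \<sigma>) ^ CARD('d)"]
    have "dual_norm2_le \<sigma> (\<lambda>x. 1 / (real j * \<sigma>) ^ CARD('d) * (\<integral>u. exp (- c * (norm (u - x))\<^sup>2) * g u \<partial>lborel))
        ((1 / (real j * \<sigma>) ^ CARD('d))\<^sup>2 * ((1 / (\<sigma> * s1) ^ CARD('d))\<^sup>2 * ((\<sigma> * s2) ^ CARD('d) * (M * (\<sigma> * s3) ^ CARD('d) * ((\<sigma> * s3) ^ CARD('d) * I)))))" .
    moreover have "1 / (real j * \<sigma>) ^ CARD('d) * (\<integral>u. exp (- c * (norm (u - x))\<^sup>2) * g u \<partial>lborel)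
        = (\<integral>y. exp (- (norm y)\<^sup>2) * g (x + (real j * \<sigma>) *\<^sub>R y) \<partial>lborel)" for x
    proof -
      have "c * (norm (x + (real j * \<sigma>) *\<^sub>R y - x))\<^sup>2 = (norm y)\<^sup>2" for y
        using \<open>\<sigma> > 0\<close> \<open>j \<ge> 1\<close> by (simp add: c_def power_mult_distrib)
      then have e: "exp (- c * (norm (x + (real j * \<sigma>) *\<^sub>R y - x))\<^sup>2) = exp (- (norm y)\<^sup>2)" for y
        by (simp only: mult_minus_left)
      have "real j * \<sigma> > 0" using \<open>\<sigma> > 0\<close> \<open>j \<ge> 1\<close> by simp
      moreover have "(\<lambda>u. exp (- c * (norm (u - x))\<^sup>2) * g u) \<in> borel_measurable borel" by simp
      ultimately have "(\<integral>u. exp (- c * (norm (u - x))\<^sup>2) * g u \<partial>lborel)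
          = (real j * \<sigma>) ^ CARD('d) * (\<integral>y. exp (- (norm y)\<^sup>2) * g (x + (real j * \<sigma>) *\<^sub>R y) \<partial>lborel)"
        unfolding e[symmetric] by (rule lborel_integral_affine)
      then show ?thesis using \<open>\<sigma> > 0\<close> \<open>j \<ge> 1\<close> by simp
    qed
    moreover have "(1 / (real j * \<sigma>) ^ CARD('d))\<^sup>2 * ((1 / (\<sigma> * s1) ^ CARD('d))\<^sup>2 * ((\<sigma> * s2) ^ CARD('d) * (M * (\<sigma> * s3) ^ CARD('d) * ((\<sigma> * s3) ^ CARD('d) * I))))
        = K / \<sigma> ^ CARD('d)"
    proof -
      define S where "S = \<sigma> ^ CARD('d)"
      have "S > 0" using \<open>\<sigma> > 0\<close> by (simp add: S_def)
      then show ?thesis unfolding K_def power_mult_distrib S_def[symmetric]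
        by (simp add: field_simps power2_eq_square)
    qed
    ultimately show ?thesis by simp
  qed
  ultimately show ?thesis by blast
qed

lemma powr_le_gauss:
  fixes r :: real
  assumes "r \<ge> 0"
  obtains C where "C > 0" "\<And>t. t \<ge> 0 \<Longrightarrow> t powr r \<le> C * exp (t\<^sup>2 / 2)"
proof -
  define n where "n = nat \<lceil>r\<rceil>"
  have n: "r \<le> real n" unfolding n_def by linarith
  define C :: real where "C = 2 ^ n * fact n + 1"
  have "t powr r \<le> C * exp (t\<^sup>2 / 2)" if "t \<ge> 0" for t :: real
  proof (cases "t \<le> 1")
    case True
    have "t powr r \<le> 1 * 1"
      using powr_mono2[of r t 1] True that \<open>r \<ge> 0\<close> by simp
    also have "\<dots> \<le> C * exp (t\<^sup>2 / 2)" by (intro mult_mono) (auto simp: C_def)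
    finally show ?thesis .
  next
    case False
    have "t powr r \<le> t powr (2 * real n)" using False n by (intro powr_mono) auto
    also have "\<dots> = t powr (real (2 * n))" by simp
    also have "\<dots> = t ^ (2 * n)" using False by (subst powr_realpow) auto
    also have "\<dots> = 2 ^ n * fact n * ((t\<^sup>2 / 2) ^ n / fact n)"
      by (simp add: power_divide power_mult)
    also have "\<dots> \<le> 2 ^ n * fact n * exp (t\<^sup>2 / 2)"
    proof (intro mult_left_mono)
      have "(t\<^sup>2 / 2) ^ n /\<^sub>R fact n \<le> (\<Sum>k. (t\<^sup>2 / 2) ^ k /\<^sub>R fact k)"
        using sum_le_suminf[OF summable_exp_generic[of "t\<^sup>2 / 2"], of "{n}"]
        by (simp del: real_scaleR_def add: scaleR_nonneg_nonneg)
      moreover have "(t\<^sup>2 / 2) ^ n /\<^sub>R fact n = (t\<^sup>2 / 2) ^ n / fact n"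
        by (simp add: field_simps)
      ultimately show "(t\<^sup>2 / 2) ^ n / fact n \<le> exp (t\<^sup>2 / 2)"
        by (simp only: exp_def)
    qed simp
    also have "\<dots> \<le> C * exp (t\<^sup>2 / 2)" by (intro mult_right_mono) (auto simp: C_def)
    finally show ?thesis .
  qed
  moreover have "C > 0" unfolding C_def by (intro add_nonneg_pos) auto
  ultimately show ?thesis using that by blast
qed

lemma integrable_gauss_powr:
  assumes "r \<ge> 0"
  shows "integrable lborel (\<lambda>y :: real^'d. exp (- (norm y)\<^sup>2) * norm y powr r)"
proof -
  obtain C where C: "C > 0" "\<And>t. t \<ge> 0 \<Longrightarrow> t powr r \<le> C * exp (t\<^sup>2 / 2)"
    using powr_le_gauss[OF assms] by blast
  have "integrable lborel (\<lambda>y :: real^'d. C * exp (- (1 / 2) * (norm (y - 0))\<^sup>2))"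
    using has_integral_gauss[of "1 / 2" "0 :: real^'d"] by (intro integrable_mult_right) (simp add: has_bochner_integral_iff)
  then show ?thesis
  proof (rule Bochner_Integration.integrable_bound)
    show "AE y in lborel. norm (exp (- (norm y)\<^sup>2) * norm y powr r)
        \<le> norm (C * exp (- (1 / 2) * (norm (y - 0 :: real^'d))\<^sup>2))"
    proof (intro AE_I2)
      fix y :: "real^'d"
      have "exp (- (norm y)\<^sup>2) * norm y powr r \<le> exp (- (norm y)\<^sup>2) * (C * exp ((norm y)\<^sup>2 / 2))"
        by (intro mult_left_mono C) auto
      also have "\<dots> = C * exp (- (1 / 2) * (norm (y - 0))\<^sup>2)"
        by (simp add: exp_add[symmetric])
      finally show "norm (exp (- (norm y)\<^sup>2) * norm y powr r) \<le> norm (C * exp (- (1 / 2) * (norm (y - 0))\<^sup>2))"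
        using C by (simp add: abs_mult)
    qed
  qed simp
qed

text \<open>Integrating the bound at \<sigma> y against the normalised Gaussian turns it into a
  multiple of \<open>\<sigma> powr r\<close>, since Gaussian moments are finite. The combined
  averages are then replaced by a finite combination through \<open>dual_norm2_le_approx\<close>,
  with the same accuracy.\<close>

lemma rkhs_approx_of_difference_bound:
  fixes f g :: "real^'d \<Rightarrow> real" and c :: "nat \<Rightarrow> real"
  assumes g [measurable]: "g \<in> borel_measurable borel" and M: "\<And>u. \<bar>g u\<bar> \<le> M"
    and int: "integrable lborel g" and "s \<ge> 1" "r > 0" "C \<ge> 0"
    and diff: "\<And>x y. x \<in> unit_cube \<Longrightarrow> \<bar>(\<Sum>j=1..s. c j * g (x + real j *\<^sub>R y)) - f x\<bar> \<le> C * norm y powr r"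
  shows "\<exists>K>0. \<forall>\<sigma>. 0 < \<sigma> \<and> \<sigma> \<le> 1 \<longrightarrow> (\<exists>L. (\<forall>p\<in>set L. snd p \<in> unit_cube) \<and>
    kcomb_norm2 \<sigma> L \<le> K / \<sigma> ^ CARD('d) \<and> (\<forall>x\<in>unit_cube. \<bar>kcomb_eval \<sigma> L x - f x\<bar> \<le> K * \<sigma> powr r))"
proof -
  define \<gamma> where "\<gamma> = sqrt pi ^ CARD('d)"
  have "\<gamma> > 0" by (simp add: \<gamma>_def)
  have gau: "integrable lborel (\<lambda>y :: real^'d. exp (- (norm y)\<^sup>2))" "(\<integral>y. exp (- (norm (y :: real^'d))\<^sup>2) \<partial>lborel) = \<gamma>"
    using has_integral_gauss[of 1 "0 :: real^'d"] by (auto simp: has_bochner_integral_iff \<gamma>_def)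
  define F where "F \<sigma> j x = (\<integral>y. exp (- (norm y)\<^sup>2) * g (x + (real j * \<sigma>) *\<^sub>R y) \<partial>lborel)" for \<sigma> j x
  have "\<exists>k\<ge>0. \<forall>\<sigma>>0. dual_norm2_le \<sigma> (F \<sigma> j) (k / \<sigma> ^ CARD('d))" if "j \<in> {1..s}" for j
    unfolding F_def using that by (intro dual_norm2_le_gauss_mean[OF g M int]) auto
  then obtain k where k: "\<And>j. j \<in> {1..s} \<Longrightarrow> k j \<ge> 0"
    "\<And>j \<sigma>. j \<in> {1..s} \<Longrightarrow> \<sigma> > 0 \<Longrightarrow> dual_norm2_le \<sigma> (F \<sigma> j) (k j / \<sigma> ^ CARD('d))" by metis
  define B where "B = (\<Sum>j=1..s. real s * (c j / \<gamma>)\<^sup>2 * k j)"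
  have "B \<ge> 0" unfolding B_def using k by (intro sum_nonneg) auto
  define m where "m = (\<integral>y. exp (- (norm (y :: real^'d))\<^sup>2) * norm y powr r \<partial>lborel)"
  have "m \<ge> 0" by (simp add: m_def)
  \<comment> \<open>One constant for both claims: 4 * B + 2 comes from
    \<open>dual_norm2_le_approx\<close> with accuracy at most 1, and C * m / \<gamma> + 1 from the
    two parts of the uniform error.\<close>
  define K where "K = 4 * B + C * m / \<gamma> + 2"
  have "K > 0" using \<open>B \<ge> 0\<close> \<open>C \<ge> 0\<close> \<open>m \<ge> 0\<close> \<open>\<gamma> > 0\<close> by (simp add: K_def add_nonneg_pos)
  moreover have "\<exists>L. (\<forall>p\<in>set L. snd p \<in> unit_cube) \<and>
    kcomb_norm2 \<sigma> L \<le> K / \<sigma> ^ CARD('d) \<and> (\<forall>x\<in>unit_cube. \<bar>kcomb_eval \<sigma> L x - f x\<bar> \<le> K * \<sigma> powr r)"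
    if \<sigma>: "0 < \<sigma>" "\<sigma> \<le> 1" for \<sigma>
  proof -
    define G where "G x = (\<Sum>j=1..s. c j / \<gamma> * F \<sigma> j x)" for x
    have "dual_norm2_le \<sigma> G (\<Sum>j=1..s. real (card {1..s}) * (c j / \<gamma>)\<^sup>2 * (k j / \<sigma> ^ CARD('d)))"
      unfolding G_def using \<open>s \<ge> 1\<close> k \<sigma> by (intro dual_norm2_le_sum) auto
    then have dual: "dual_norm2_le \<sigma> G (B / \<sigma> ^ CARD('d))"
      by (simp add: B_def sum_divide_distrib)
    have "\<sigma> powr r > 0" using \<sigma> by simp
    from dual_norm2_le_approx[OF dual this] obtain L where L: "\<forall>p\<in>set L. snd p \<in> unit_cube"
      "kcomb_norm2 \<sigma> L \<le> 4 * (B / \<sigma> ^ CARD('d)) + 2 * (\<sigma> powr r)\<^sup>2"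
      "\<forall>x\<in>unit_cube. \<bar>kcomb_eval \<sigma> L x - G x\<bar> \<le> \<sigma> powr r" by blast
    have "\<sigma> powr r \<le> 1" using \<sigma> \<open>r > 0\<close> powr_mono2[of r \<sigma> 1] by simp
    then have "(\<sigma> powr r)\<^sup>2 \<le> 1" by (simp add: power_le_one)
    moreover have "1 \<le> 1 / \<sigma> ^ CARD('d)" using \<sigma> by (simp add: power_le_one)
    moreover have "C * m / \<gamma> / \<sigma> ^ CARD('d) \<ge> 0" using \<open>C \<ge> 0\<close> \<open>m \<ge> 0\<close> \<open>\<gamma> > 0\<close> \<sigma> by simp
    ultimately have n: "kcomb_norm2 \<sigma> L \<le> K / \<sigma> ^ CARD('d)"
      using L(2) by (simp add: K_def add_divide_distrib)
    have "\<bar>kcomb_eval \<sigma> L x - f x\<bar> \<le> K * \<sigma> powr r" if x: "x \<in> unit_cube" for x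
    proof -
      define E where "E y = (\<Sum>j=1..s. c j * g (x + real j *\<^sub>R (\<sigma> *\<^sub>R y))) - f x" for y
      have Fint: "integrable lborel (\<lambda>y. exp (- (norm y)\<^sup>2) * g (x + (real j * \<sigma>) *\<^sub>R y))" for j
      proof (rule Bochner_Integration.integrable_bound)
        show "integrable lborel (\<lambda>y :: real^'d. M * exp (- (norm y)\<^sup>2))" using gau(1) by (rule integrable_mult_right)
        show "AE y in lborel. norm (exp (- (norm y)\<^sup>2) * g (x + (real j * \<sigma>) *\<^sub>R y)) \<le> norm (M * exp (- (norm y)\<^sup>2))"
          using M by (intro AE_I2) (auto simp: abs_mult mult.commute intro!: mult_right_mono intro: order.trans[OF _ abs_ge_self])
      qed simp
      have "\<gamma> * (G x - f x) = (\<integral>y. exp (- (norm y)\<^sup>2) * E y \<partial>lborel)"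
      proof -
        have "(\<integral>y. exp (- (norm y)\<^sup>2) * E y \<partial>lborel)
          = (\<integral>y. (\<Sum>j=1..s. c j * (exp (- (norm y)\<^sup>2) * g (x + (real j * \<sigma>) *\<^sub>R y))) - exp (- (norm y)\<^sup>2) * f x \<partial>lborel)"
          by (simp add: E_def right_diff_distrib sum_distrib_left mult_ac)
        also have "\<dots> = (\<Sum>j=1..s. c j * F \<sigma> j x) - \<gamma> * f x"
          using gau Fint by (simp add: Bochner_Integration.integral_diff Bochner_Integration.integral_sum F_def)
        also have "\<dots> = \<gamma> * (G x - f x)"
          using \<open>\<gamma> > 0\<close> by (simp add: G_def right_diff_distrib sum_distrib_left)
        finally show ?thesis ..
      qed
      then have "\<gamma> * \<bar>G x - f x\<bar> = \<bar>\<integral>y. exp (- (norm y)\<^sup>2) * E y \<partial>lborel\<bar>"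
        using \<open>\<gamma> > 0\<close> by (metis abs_mult abs_of_pos)
      also have "\<dots> \<le> (\<integral>y. C * \<sigma> powr r * (exp (- (norm (y :: real^'d))\<^sup>2) * norm y powr r) \<partial>lborel)"
      proof (rule order.trans[OF integral_abs_bound[of lborel "\<lambda>y. exp (- (norm y)\<^sup>2) * E y"] integral_mono_AE'])
        show "integrable lborel (\<lambda>y :: real^'d. C * \<sigma> powr r * (exp (- (norm y)\<^sup>2) * norm y powr r))"
          using \<open>r > 0\<close> by (intro integrable_mult_right integrable_gauss_powr) simp
        show "AE y in lborel. \<bar>exp (- (norm y)\<^sup>2) * E y\<bar> \<le> C * \<sigma> powr r * (exp (- (norm y)\<^sup>2) * norm y powr r)"
        proof (intro AE_I2)
          fix y
          have "\<bar>E y\<bar> \<le> C * norm (\<sigma> *\<^sub>R y) powr r" unfolding E_def by (rule diff[OF x])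
          also have "\<dots> = C * \<sigma> powr r * norm y powr r" using \<sigma> by (simp add: powr_mult)
          finally have "exp (- (norm y)\<^sup>2) * \<bar>E y\<bar> \<le> exp (- (norm y)\<^sup>2) * (C * \<sigma> powr r * norm y powr r)"
            by (intro mult_left_mono) auto
          then show "\<bar>exp (- (norm y)\<^sup>2) * E y\<bar> \<le> C * \<sigma> powr r * (exp (- (norm y)\<^sup>2) * norm y powr r)"
            by (simp add: abs_mult mult_ac)
        qed
      qed (use \<open>C \<ge> 0\<close> in auto)
      also have "\<dots> = C * \<sigma> powr r * m" by (simp add: m_def)
      finally have "\<bar>G x - f x\<bar> \<le> C * m / \<gamma> * \<sigma> powr r"
        using \<open>\<gamma> > 0\<close> by (simp add: field_simps)
      moreover have "\<bar>kcomb_eval \<sigma> L x - G x\<bar> \<le> \<sigma> powr r" using L(3) x by blast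
      ultimately have "\<bar>kcomb_eval \<sigma> L x - f x\<bar> \<le> (C * m / \<gamma> + 1) * \<sigma> powr r"
        by (simp add: distrib_right)
      also have "\<dots> \<le> K * \<sigma> powr r"
        using \<open>B \<ge> 0\<close> by (intro mult_right_mono) (auto simp: K_def)
      finally show ?thesis .
    qed
    with L(1) n show ?thesis by blast
  qed
  ultimately show ?thesis by blast
qed

section \<open>Taylor expansion and extension from the cube\<close>

lemma unit_cube_eq_cbox: "(unit_cube :: (real^'d) set) = cbox 0 (\<chi> i. 1)"
  by (auto simp: unit_cube_def mem_box_cart)

lemma compact_unit_cube: "compact (unit_cube :: (real^'d) set)"
  and convex_unit_cube: "convex (unit_cube :: (real^'d) set)"
  by (simp_all add: unit_cube_eq_cbox)

lemma unit_cube_borel [measurable]: "(unit_cube :: (real^'d) set) \<in> sets borel"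
  by (simp add: unit_cube_eq_cbox)

lemma abs_coord_prod_le: "\<bar>coord_prod l h\<bar> \<le> norm h ^ length l"
  by (induction l) (auto simp: abs_mult intro!: mult_mono component_le_norm_cart)

text \<open>\<open>lip_class\<close> states partial derivatives only at parameter 0 of a line
  through the point. Translating the parameter turns this into differentiability along a whole
  segment.\<close>

lemma axis_path_derivative:
  fixes G :: "real^'d \<Rightarrow> real"
  assumes part: "\<And>x. x \<in> unit_cube \<Longrightarrow> ((\<lambda>t. G (x + t *\<^sub>R axis i 1)) has_real_derivative G' x)
      (at 0 within {t. x + t *\<^sub>R axis i 1 \<in> unit_cube})"
    and S: "\<And>t. t \<in> S \<Longrightarrow> w + t *\<^sub>R axis i 1 \<in> unit_cube" and t: "t \<in> S"
  shows "((\<lambda>t. G (w + t *\<^sub>R axis i 1)) has_real_derivative G' (w + t *\<^sub>R axis i 1)) (at t within S)"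
proof -
  define w' where "w' = w + t *\<^sub>R axis i 1"
  have w': "w + s *\<^sub>R axis i 1 = w' + (s - t) *\<^sub>R axis i 1" for s
    by (simp add: w'_def algebra_simps)
  have "w' \<in> unit_cube" using S[OF t] by (simp add: w'_def)
  have "((\<lambda>s. G (w' + s *\<^sub>R axis i 1)) has_real_derivative G' w') (at ((\<lambda>s. s - t) t) within (\<lambda>s. s - t) ` S)"
    unfolding diff_self
    by (rule has_field_derivative_subset[OF part]) (use S w' \<open>w' \<in> unit_cube\<close> in auto)
  then have "((\<lambda>s. G (w' + s *\<^sub>R axis i 1)) \<circ> (\<lambda>s. s - t) has_real_derivative G' w' * 1) (at t within S)"
    by (rule DERIV_image_chain) (auto intro!: derivative_eq_intros)
  then show ?thesis unfolding w' by (simp add: o_def)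
qed

text \<open>The coordinates of x are changed to those of y one at a time, with a mean value estimate
  on each edge. Every vertex of this path mixes coordinates of x and y, so the path stays in the
  cube and within norm (y - x) of x, which makes the argument work up to the boundary.\<close>

lemma has_derivative_of_continuous_partials:
  fixes G :: "real^'d \<Rightarrow> real" and G' :: "'d \<Rightarrow> real^'d \<Rightarrow> real"
  assumes part: "\<And>i x. x \<in> unit_cube \<Longrightarrow> ((\<lambda>t. G (x + t *\<^sub>R axis i 1)) has_real_derivative G' i x)
      (at 0 within {t. x + t *\<^sub>R axis i 1 \<in> unit_cube})"
    and cont: "\<And>i. continuous_on unit_cube (G' i)" and x: "x \<in> unit_cube"
  shows "(G has_derivative (\<lambda>h. \<Sum>i\<in>UNIV. G' i x * h $ i)) (at x within unit_cube)"
  unfolding has_derivative_within_alt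
proof (intro conjI allI impI)
  show "bounded_linear (\<lambda>h :: real^'d. \<Sum>i\<in>UNIV. G' i x * h $ i)"
    by (intro bounded_linear_sum bounded_linear_const_mult bounded_linear_vec_nth)
  fix e :: real assume "e > 0"
  define e' where "e' = e / real CARD('d)"
  have "e' > 0" using \<open>e > 0\<close> by (simp add: e'_def)
  have "\<exists>\<delta>>0. \<forall>y\<in>unit_cube. dist y x < \<delta> \<longrightarrow> dist (G' i y) (G' i x) < e'" for i
    using cont[of i] x \<open>e' > 0\<close> unfolding continuous_on_iff by blast
  then obtain \<delta> where \<delta>: "\<And>i. \<delta> i > 0"
    "\<And>i y. y \<in> unit_cube \<Longrightarrow> dist y x < \<delta> i \<Longrightarrow> dist (G' i y) (G' i x) < e'" by metis
  define d where "d = Min (range \<delta>)"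
  have "d > 0" using \<delta> by (simp add: d_def)
  have d_le: "d \<le> \<delta> i" for i unfolding d_def by simp
  have "norm (G y - G x - (\<Sum>i\<in>UNIV. G' i x * (y - x) $ i)) \<le> e * norm (y - x)"
    if y: "y \<in> unit_cube" "norm (y - x) < d" for y
  proof -
    define w where "w S = (\<chi> i. if i \<in> S then y $ i else x $ i)" for S
    have "\<bar>G (w S) - G x - (\<Sum>i\<in>S. G' i x * (y - x) $ i)\<bar> \<le> (\<Sum>i\<in>S. e' * \<bar>(y - x) $ i\<bar>)" if "finite S" for S
      using that
    proof (induction S)
      case empty
      have "w {} = x" by (simp add: w_def vec_eq_iff)
      then show ?case by simp
    next
      case (insert i S)
      define \<tau> where "\<tau> = (y - x) $ i"
      define T where "T = closed_segment 0 \<tau>"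
      have wi: "w (insert i S) = w S + \<tau> *\<^sub>R axis i 1"
        using insert.hyps by (auto simp: w_def vec_eq_iff axis_def \<tau>_def)
      have mem: "w S + t *\<^sub>R axis i 1 \<in> unit_cube" "norm (w S + t *\<^sub>R axis i 1 - x) < d" if "t \<in> T" for t
      proof -
        have bnd: "(0 \<le> t \<and> t \<le> \<tau>) \<or> (\<tau> \<le> t \<and> t \<le> 0)"
          using that by (auto simp: T_def closed_segment_eq_real_ivl split: if_splits)
        have comp: "(w S + t *\<^sub>R axis i 1) $ j = (if j = i then x $ i + t else if j \<in> S then y $ j else x $ j)" for j
          using insert.hyps by (auto simp: w_def axis_def)
        have "0 \<le> (w S + t *\<^sub>R axis i 1) $ j \<and> (w S + t *\<^sub>R axis i 1) $ j \<le> 1" for j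
        proof -
          have "0 \<le> x $ j" "x $ j \<le> 1" "0 \<le> y $ j" "y $ j \<le> 1" "0 \<le> x $ i" "x $ i \<le> 1" "0 \<le> y $ i" "y $ i \<le> 1"
            using x y by (auto simp: unit_cube_def)
          then show ?thesis unfolding comp using bnd by (auto simp: \<tau>_def)
        qed
        then show "w S + t *\<^sub>R axis i 1 \<in> unit_cube" by (simp add: unit_cube_def)
        have "norm (w S + t *\<^sub>R axis i 1 - x) \<le> norm (y - x)"
        proof (rule norm_le_componentwise_cart)
          fix j
          show "norm ((w S + t *\<^sub>R axis i 1 - x) $ j) \<le> norm ((y - x) $ j)"
            unfolding vector_minus_component[of _ x] comp using bnd by (auto simp: \<tau>_def)
        qed
        then show "norm (w S + t *\<^sub>R axis i 1 - x) < d" using y by simp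
      qed
      define p where "p t = G (w S + t *\<^sub>R axis i 1) - G' i x * t" for t
      have "norm (p \<tau> - p 0) \<le> e' * norm (\<tau> - 0)"
      proof (rule field_differentiable_bound[of T])
        show "convex T" by (simp add: T_def)
        show "(p has_field_derivative G' i (w S + t *\<^sub>R axis i 1) - G' i x) (at t within T)" if "t \<in> T" for t
          unfolding p_def
          by (rule derivative_eq_intros axis_path_derivative[OF part] mem that refl | simp)+
        show "norm (G' i (w S + t *\<^sub>R axis i 1) - G' i x) \<le> e'" if "t \<in> T" for t
          using \<delta>(2)[OF mem(1)[OF that], of i] mem(2)[OF that] d_le[of i]
          by (simp add: dist_norm less_imp_le)
      qed (auto simp: T_def)
      then have "\<bar>G (w (insert i S)) - G (w S) - G' i x * (y - x) $ i\<bar> \<le> e' * \<bar>(y - x) $ i\<bar>"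
        by (simp add: p_def wi \<tau>_def algebra_simps)
      then show ?case using insert by simp
    qed
    from this[of UNIV] have "\<bar>G (w UNIV) - G x - (\<Sum>i\<in>UNIV. G' i x * (y - x) $ i)\<bar> \<le> (\<Sum>i\<in>UNIV. e' * \<bar>(y - x) $ i\<bar>)" by simp
    also have "w UNIV = y" by (simp add: w_def vec_eq_iff)
    also have "(\<Sum>i\<in>UNIV. e' * \<bar>(y - x) $ i\<bar>) \<le> (\<Sum>i\<in>(UNIV :: 'd set). e' * norm (y - x))"
      using \<open>e' > 0\<close> component_le_norm_cart[of "y - x"] by (intro sum_mono mult_left_mono) auto
    also have "\<dots> = e * norm (y - x)" by (simp add: e'_def)
    finally show ?thesis by simp
  qed
  then show "\<exists>d>0. \<forall>y\<in>unit_cube. norm (y - x) < d \<longrightarrow>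
      norm (G y - G x - (\<Sum>i\<in>UNIV. G' i x * (y - x) $ i)) \<le> e * norm (y - x)"
    using \<open>d > 0\<close> by blast
qed

lemma holder_imp_continuous_on:
  fixes G :: "real^'d \<Rightarrow> real"
  assumes "\<And>x y. x \<in> S \<Longrightarrow> y \<in> S \<Longrightarrow> \<bar>G x - G y\<bar> \<le> c * norm (x - y) powr v" "v > 0"
  shows "continuous_on S G"
  unfolding continuous_on_def
proof
  fix x assume x: "x \<in> S"
  have "((\<lambda>y. norm (y - x)) \<longlongrightarrow> 0) (at x within S)"
    by (rule tendsto_norm_zero[OF LIM_zero[OF tendsto_ident_at]])
  then have "((\<lambda>y. norm (y - x) powr v) \<longlongrightarrow> 0) (at x within S)"
    by (rule tendsto_zero_powrI) (use \<open>v > 0\<close> in auto)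
  then have "((\<lambda>y. c * norm (y - x) powr v) \<longlongrightarrow> 0) (at x within S)"
    by (rule tendsto_mult_right_zero)
  then have "((\<lambda>y. G y - G x) \<longlongrightarrow> 0) (at x within S)"
    by (rule Lim_null_comparison[rotated]) (use assms(1) x in \<open>auto simp: eventually_at_filter\<close>)
  then show "(G \<longlongrightarrow> G x) (at x within S)" by (rule LIM_zero_cancel)
qed

text \<open>Taylor's formula along the segment from z to x, with the Hoelder bound on the
  derivatives of order u as remainder. Hoelder continuity is given at the top order only, so
  continuity of the lower orders is deduced from it downwards.\<close>

lemma lip_class_taylor:
  fixes f :: "real^'d \<Rightarrow> real"
  assumes "lip_class r c0 f" "r > 0" "c0 > 0"
  obtains u B C where "real u < r" "B \<ge> 0" "C \<ge> 0" "continuous_on unit_cube f"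
    "\<And>z. z \<in> unit_cube \<Longrightarrow> \<exists>a :: 'd list \<Rightarrow> real. (\<forall>l. length l \<le> u \<longrightarrow> \<bar>a l\<bar> \<le> B) \<and> a [] = f z \<and>
       (\<forall>x\<in>unit_cube. \<bar>f x - (\<Sum>l | length l < Suc u. a l * coord_prod l (x - z))\<bar> \<le> C * norm (x - z) powr r)"
proof -
  \<comment> \<open>Rounding up and subtracting 1 puts the Hoelder exponent v into (0, 1], also for
    integer r.\<close>
  define u where "u = nat (\<lceil>r\<rceil> - 1)"
  define v where "v = r - real u"
  have "\<lceil>r\<rceil> \<ge> 1" using \<open>r > 0\<close> by simp
  then have "real u < r" unfolding u_def by (simp add: of_nat_nat) linarith
  then have "v > 0" by (simp add: v_def)
  obtain F :: "'d list \<Rightarrow> real^'d \<Rightarrow> real" where F0: "\<And>x. x \<in> unit_cube \<Longrightarrow> F [] x = f x"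
    and F1: "\<And>ds i x. length ds < u \<Longrightarrow> x \<in> unit_cube \<Longrightarrow>
           ((\<lambda>t. F ds (x + t *\<^sub>R axis i 1)) has_real_derivative F (i # ds) x)
             (at 0 within {t. x + t *\<^sub>R axis i 1 \<in> unit_cube})"
    and F2: "\<And>ds x x'. length ds = u \<Longrightarrow> x \<in> unit_cube \<Longrightarrow> x' \<in> unit_cube \<Longrightarrow>
           \<bar>F ds x - F ds x'\<bar> \<le> c0 * norm (x - x') powr v"
    using assms(1) unfolding lip_class_def Let_def u_def[symmetric] v_def[symmetric] by blast
  have cont: "continuous_on unit_cube (F ds)" if "length ds + k = u" for k ds
    using that
  proof (induction k arbitrary: ds)
    case 0
    then show ?case by (intro holder_imp_continuous_on[OF F2 \<open>v > 0\<close>]) auto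
  next
    case (Suc k)
    have "(F ds has_derivative (\<lambda>h. \<Sum>i\<in>UNIV. F (i # ds) x * h $ i)) (at x within unit_cube)" if "x \<in> unit_cube" for x
      using Suc by (intro has_derivative_of_continuous_partials F1 that) auto
    then show ?case by (rule has_derivative_continuous_on)
  qed
  then have cont: "continuous_on unit_cube (F ds)" if "length ds \<le> u" for ds
    using that le_Suc_ex by blast
  have "\<exists>b\<ge>0. \<forall>x\<in>unit_cube. \<bar>F ds x\<bar> \<le> b" if "length ds \<le> u" for ds
  proof -
    have "bounded (F ds ` unit_cube)"
      using cont[OF that] compact_unit_cube by (intro compact_imp_bounded compact_continuous_image)
    then show ?thesis unfolding bounded_iff
      by (metis (no_types, lifting) abs_ge_zero image_eqI max.absorb_iff2 max.bounded_iff max.cobounded1 order.trans real_norm_def)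
  qed
  then obtain b where b: "\<And>ds. length ds \<le> u \<Longrightarrow> b ds \<ge> 0"
    "\<And>ds x. length ds \<le> u \<Longrightarrow> x \<in> unit_cube \<Longrightarrow> \<bar>F ds x\<bar> \<le> b ds" by metis
  define B where "B = (\<Sum>ds | length ds < Suc u. b ds)"
  have b_le: "b ds \<le> B" if "length ds \<le> u" for ds
    unfolding B_def using b that by (intro member_le_sum) auto
  have "B \<ge> 0" unfolding B_def using b by (intro sum_nonneg) auto
  define N where "N = card {l :: 'd list. length l = u}"
  define C where "C = real N * c0"
  have main: "\<bar>f x - (\<Sum>l | length l < Suc u. F l z / fact (length l) * coord_prod l (x - z))\<bar> \<le> C * norm (x - z) powr r"
    if z: "z \<in> unit_cube" and x: "x \<in> unit_cube" for x z
  proof -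
    define h where "h = x - z"
    \<comment> \<open>The k-th derivative of f along the segment. Summing over words counts every
      mixed partial once per ordering, so the Taylor coefficient of a word is divided by
      \<open>fact (length l)\<close>, not by a multi-index factorial.\<close>
    define \<phi> where "\<phi> k t = (\<Sum>l | length l = k. F l (z + t *\<^sub>R h) * coord_prod l h)" for k t
    have line: "z + t *\<^sub>R h \<in> unit_cube" if "t \<in> {0..1}" for t
    proof -
      have "z + t *\<^sub>R h = (1 - t) *\<^sub>R z + t *\<^sub>R x" by (simp add: h_def algebra_simps)
      then show ?thesis using convexD_alt[OF convex_unit_cube z x, of t] that by simp
    qed
    have d\<phi>: "(\<phi> k has_real_derivative \<phi> (Suc k) t) (at t within {0..1})" if "k < u" "t \<in> {0..1}" for k t
    proof -
      have "((\<lambda>t. F l (z + t *\<^sub>R h)) has_real_derivative (\<Sum>i\<in>UNIV. F (i # l) (z + t *\<^sub>R h) * h $ i)) (at t within {0..1})"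
        if l: "length l = k" for l
      proof -
        have "(F l has_derivative (\<lambda>h. \<Sum>i\<in>UNIV. F (i # l) (z + t *\<^sub>R h') * h $ i)) (at (z + t *\<^sub>R h') within unit_cube)"
          if "z + t *\<^sub>R h' \<in> unit_cube" for h'
          using l \<open>k < u\<close> that by (intro has_derivative_of_continuous_partials F1 cont) auto
        then have 1: "(F l has_derivative (\<lambda>y. \<Sum>i\<in>UNIV. F (i # l) (z + t *\<^sub>R h) * y $ i)) (at (z + t *\<^sub>R h) within (\<lambda>t. z + t *\<^sub>R h) ` {0..1})"
          using line \<open>t \<in> {0..1}\<close> by (blast intro: has_derivative_subset)
        have 2: "((\<lambda>t. z + t *\<^sub>R h) has_derivative (\<lambda>s. s *\<^sub>R h)) (at t within {0..1})"
          by (auto intro!: derivative_eq_intros)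
        have "((\<lambda>t. F l (z + t *\<^sub>R h)) has_derivative (\<lambda>s. \<Sum>i\<in>UNIV. F (i # l) (z + t *\<^sub>R h) * (s *\<^sub>R h) $ i)) (at t within {0..1})"
          using diff_chain_within[OF 2 1] by (simp add: o_def)
        then show ?thesis
          unfolding has_field_derivative_def
          by (rule has_derivative_eq_rhs) (auto simp: fun_eq_iff sum_distrib_left mult_ac)
      qed
      then have "(\<phi> k has_real_derivative (\<Sum>l | length l = k. (\<Sum>i\<in>UNIV. F (i # l) (z + t *\<^sub>R h) * h $ i) * coord_prod l h)) (at t within {0..1})"
        unfolding \<phi>_def by (intro DERIV_sum DERIV_cmult_right) auto
      moreover have "(\<Sum>l | length l = k. (\<Sum>i\<in>UNIV. F (i # l) (z + t *\<^sub>R h) * h $ i) * coord_prod l h) = \<phi> (Suc k) t"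
        unfolding \<phi>_def sum_lists_length_Suc sum_distrib_right
        by (subst sum.swap) (simp add: mult_ac)
      ultimately show ?thesis by simp
    qed
    have top: "\<bar>\<phi> u t - \<phi> u 0\<bar> \<le> C * norm h powr r" if t: "t \<in> {0..1}" for t
    proof -
      have "\<bar>\<phi> u t - \<phi> u 0\<bar> = \<bar>\<Sum>l | length l = u. (F l (z + t *\<^sub>R h) - F l z) * coord_prod l h\<bar>"
        by (simp add: \<phi>_def sum_subtractf left_diff_distrib)
      also have "\<dots> \<le> (\<Sum>l | length l = u. \<bar>(F l (z + t *\<^sub>R h) - F l z) * coord_prod l h\<bar>)" by (rule sum_abs)
      also have "\<dots> \<le> (\<Sum>l :: 'd list | length l = u. c0 * norm h powr v * norm h ^ u)"
      proof (rule sum_mono)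
        fix l :: "'d list" assume "l \<in> {l. length l = u}"
        then have l: "length l = u" by simp
        have "\<bar>F l (z + t *\<^sub>R h) - F l z\<bar> \<le> c0 * norm (z + t *\<^sub>R h - z) powr v"
          by (rule F2[OF l line[OF t] z])
        also have "\<dots> \<le> c0 * norm h powr v"
          using t \<open>c0 > 0\<close> \<open>v > 0\<close> by (intro mult_left_mono powr_mono2) (auto intro!: mult_left_le_one_le)
        finally show "\<bar>(F l (z + t *\<^sub>R h) - F l z) * coord_prod l h\<bar> \<le> c0 * norm h powr v * norm h ^ u"
          unfolding abs_mult using abs_coord_prod_le[of l h] \<open>c0 > 0\<close> l by (intro mult_mono) auto
      qed
      also have "\<dots> = C * (norm h powr v * norm h ^ u)" by (simp add: C_def N_def)
      also have "norm h powr v * norm h ^ u = norm h powr r"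
      proof (cases "h = 0")
        case False
        then have "norm h powr v * norm h ^ u = norm h powr (v + real u)"
          by (simp add: powr_add powr_realpow)
        then show ?thesis by (simp add: v_def)
      qed (use \<open>v > 0\<close> in simp)
      finally show ?thesis .
    qed
    have "\<bar>\<phi> 0 1 - (\<Sum>k<Suc u. \<phi> k 0 / fact k)\<bar> \<le> C * norm h powr r"
    proof (cases u)
      case 0
      then show ?thesis using top[of 1] by simp
    next
      case (Suc n)
      \<comment> \<open>Subtracting the top Taylor term leaves a function whose last derivative is the oscillation
        bounded by \<open>top\<close>.\<close>
      define p where "p k t = \<phi> k t - \<phi> u 0 * t ^ (u - k) / fact (u - k)" for k t
      have "norm (p 0 1 - (\<Sum>k\<le>n. p k 0 * (1 - 0) ^ k / fact k)) \<le> C * norm h powr r * norm (1 - 0 :: real) ^ Suc n / fact n"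
      proof (rule field_Taylor[of "{0..1}"])
        show "(p k has_field_derivative p (Suc k) t) (at t within {0..1})" if "t \<in> {0..1}" "k \<le> n" for k t
        proof -
          have eq: "u - k = Suc (u - Suc k)" using Suc that by simp
          define q where "q = u - Suc k"
          have "((\<lambda>t. t ^ Suc q) has_real_derivative real (Suc q) * t ^ q) (at t within {0..1})"
            by (auto intro!: derivative_eq_intros simp del: power_Suc)
          from DERIV_cmult[OF this, of "\<phi> u 0 / fact (Suc q)"]
          have "((\<lambda>t. \<phi> u 0 * t ^ (u - k) / fact (u - k)) has_real_derivative \<phi> u 0 * t ^ (u - Suc k) / fact (u - Suc k)) (at t within {0..1})"
            unfolding eq q_def[symmetric] by (simp del: power_Suc of_nat_Suc)
          then show ?thesis unfolding p_def
            using d\<phi>[of k t] that Suc by (intro DERIV_diff) auto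
        qed
        show "norm (p (Suc n) t) \<le> C * norm h powr r" if "t \<in> {0..1}" for t
          using top[OF that] Suc by (simp add: p_def)
      qed auto
      also have "\<dots> \<le> C * norm h powr r"
      proof -
        have "C * norm h powr r \<ge> 0" using \<open>c0 > 0\<close> by (simp add: C_def)
        then have "C * norm h powr r / fact n \<le> C * norm h powr r / 1"
          by (intro divide_left_mono) (auto simp: fact_ge_1)
        then show ?thesis by simp
      qed
      also have "(\<Sum>k\<le>n. p k 0 * (1 - 0) ^ k / fact k) = (\<Sum>k<u. \<phi> k 0 / fact k)"
        unfolding Suc lessThan_Suc_atMost by (intro sum.cong) (auto simp: p_def Suc)
      finally show ?thesis by (simp add: p_def algebra_simps)
    qed
    moreover have "\<phi> 0 1 = f x" using F0[OF x] by (simp add: \<phi>_def h_def)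
    moreover have "(\<Sum>k<Suc u. \<phi> k 0 / fact k) = (\<Sum>l | length l < Suc u. F l z / fact (length l) * coord_prod l (x - z))"
      unfolding sum_lists_length_less by (intro sum.cong) (auto simp: \<phi>_def h_def sum_divide_distrib)
    ultimately show ?thesis by (simp add: h_def)
  qed
  have "continuous_on unit_cube f" using cont[of "[]"] F0 continuous_on_cong[of unit_cube unit_cube "F []" f] by auto
  moreover have "\<exists>a :: 'd list \<Rightarrow> real. (\<forall>l. length l \<le> u \<longrightarrow> \<bar>a l\<bar> \<le> B) \<and> a [] = f z \<and>
       (\<forall>x\<in>unit_cube. \<bar>f x - (\<Sum>l | length l < Suc u. a l * coord_prod l (x - z))\<bar> \<le> C * norm (x - z) powr r)"
    if z: "z \<in> unit_cube" for z
  proof (intro exI[of _ "\<lambda>l. F l z / fact (length l)"] conjI allI impI ballI main z)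
    fix l :: "'d list" assume l: "length l \<le> u"
    have "\<bar>F l z / fact (length l)\<bar> \<le> \<bar>F l z\<bar> / 1"
      unfolding abs_divide by (intro divide_left_mono) (auto simp: fact_ge_1)
    then show "\<bar>F l z / fact (length l)\<bar> \<le> B" using b(2)[OF l z] b_le[OF l] by linarith
  qed (use F0 z in auto)
  moreover have "C \<ge> 0" using \<open>c0 > 0\<close> by (simp add: C_def)
  ultimately show ?thesis using that[of u B C] \<open>real u < r\<close> \<open>B \<ge> 0\<close> by blast
qed

section \<open>Finite differences and extrapolation beyond the cube\<close>

lemma alternating_binomial_sum_poly:
  fixes p :: "real poly"
  assumes "degree p < s"
  shows "(\<Sum>k\<le>s. (- 1) ^ k * real (s choose k) * poly p (real k)) = 0"
  using assms
proof (induction s arbitrary: p)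
  case (Suc s)
  \<comment> \<open>By Pascal's rule the alternating sum of order s + 1 for p is the one of order s
    for q, and passing to q cancels the leading coefficient.\<close>
  define q where "q = p - pcompose p [:1, 1:]"
  have "(\<Sum>k\<le>Suc s. (- 1) ^ k * real (Suc s choose k) * poly p (real k))
      = (\<Sum>k\<le>s. (- 1) ^ k * real (s choose k) * poly q (real k))"
  proof -
    define P where "P k = poly p (real k)" for k
    have "(\<Sum>k\<le>Suc s. (- 1) ^ k * real (Suc s choose k) * P k)
        = P 0 + (\<Sum>k\<le>s. (- 1) ^ Suc k * real (Suc s choose Suc k) * P (Suc k))"
      by (subst sum.atMost_Suc_shift) simp
    also have "(\<Sum>k\<le>s. (- 1) ^ Suc k * real (Suc s choose Suc k) * P (Suc k))
        = (\<Sum>k\<le>s. - ((- 1) ^ k * real (s choose k) * P (Suc k))) + (\<Sum>k\<le>s. (- 1) ^ Suc k * real (s choose Suc k) * P (Suc k))"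
      by (simp add: sum.distrib[symmetric] algebra_simps)
    also have "P 0 + \<dots> = (P 0 + (\<Sum>k\<le>s. (- 1) ^ Suc k * real (s choose Suc k) * P (Suc k))) - (\<Sum>k\<le>s. (- 1) ^ k * real (s choose k) * P (Suc k))"
      by (simp add: sum_negf)
    also have "P 0 + (\<Sum>k\<le>s. (- 1) ^ Suc k * real (s choose Suc k) * P (Suc k)) = (\<Sum>k\<le>Suc s. (- 1) ^ k * real (s choose k) * P k)"
      by (subst sum.atMost_Suc_shift) simp
    also have "\<dots> = (\<Sum>k\<le>s. (- 1) ^ k * real (s choose k) * P k)" by simp
    finally show ?thesis
      by (simp add: P_def q_def sum_subtractf[symmetric] poly_pcompose right_diff_distrib add.commute)
  qed
  also have "\<dots> = 0"
  proof (cases "q = 0")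
    case False
    have "degree q \<le> degree p"
      unfolding q_def by (rule degree_diff_le) (auto simp: degree_pcompose)
    moreover have "degree q \<noteq> degree p"
    proof
      assume eq: "degree q = degree p"
      have "lead_coeff (pcompose p [:1, 1:]) = lead_coeff p"
        using lead_coeff_comp[of "[:1, 1:]" p] by simp
      then have "coeff q (degree p) = 0" by (simp add: q_def degree_pcompose)
      then show False using eq False by (metis leading_coeff_0_iff)
    qed
    ultimately show ?thesis using Suc by (intro Suc.IH) auto
  qed simp
  finally show ?case .
qed simp

lemma coord_prod_line_poly:
  fixes w h :: "real^'d"
  obtains p where "degree p \<le> length l" "\<And>t. poly p t = coord_prod l (w + t *\<^sub>R h)"
proof (induction l arbitrary: thesis)
  case Nil
  show ?case by (rule Nil[of 1]) auto
next
  case (Cons i l)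
  obtain p where p: "degree p \<le> length l" "\<And>t. poly p t = coord_prod l (w + t *\<^sub>R h)" using Cons.IH by blast
  show ?case
  proof (rule Cons.prems[of "[:w $ i, h $ i:] * p"])
    have "degree ([:w $ i, h $ i:] * p) \<le> degree [:w $ i, h $ i:] + degree p" by (rule degree_mult_le)
    also have "degree [:w $ i, h $ i:] \<le> 1" by simp
    finally show "degree ([:w $ i, h $ i:] * p) \<le> length (i # l)" using p by simp
  qed (simp add: p algebra_simps)
qed

text \<open>The vanishing alternating binomial sum solved for its term k = 0: weights that recover
  the value of a polynomial of degree below s at a point from the s following equidistant
  points.\<close>

definition fd_weight :: "nat \<Rightarrow> nat \<Rightarrow> real" where
  "fd_weight s k = (- 1) ^ Suc k * real (s choose k)"

text \<open>Serves two purposes: with h pointing towards the cube it justifies extrapolating f, and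
  with h = y it shows that the combination of dilated Gaussians preserves Taylor
  polynomials.\<close>

lemma fd_reproduces_poly:
  fixes s :: nat and w h z :: "real^'d" and a :: "'d list \<Rightarrow> real"
  defines "P \<equiv> \<lambda>x. \<Sum>l | length l < s. a l * coord_prod l (x - z)"
  shows "(\<Sum>k=1..s. fd_weight s k * P (w + real k *\<^sub>R h)) = P w"
proof -
  have mono: "(\<Sum>k=1..s. fd_weight s k * coord_prod l (w + real k *\<^sub>R h - z)) = coord_prod l (w - z)" if "length l < s" for l
  proof -
    obtain p where p: "degree p \<le> length l" "\<And>t. poly p t = coord_prod l ((w - z) + t *\<^sub>R h)"
      using coord_prod_line_poly[of l "w - z" h] by blast
    have "0 = (\<Sum>k\<le>s. (- 1) ^ k * real (s choose k) * poly p (real k))"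
      using p that by (intro alternating_binomial_sum_poly[symmetric]) simp
    also have "\<dots> = poly p 0 - (\<Sum>k=1..s. fd_weight s k * poly p (real k))"
      unfolding atMost_atLeast0 by (subst sum.atLeast_Suc_atMost) (auto simp: fd_weight_def sum_negf)
    finally show ?thesis using p(2)[of 0] by (simp add: p(2) algebra_simps)
  qed
  have "(\<Sum>k=1..s. fd_weight s k * P (w + real k *\<^sub>R h))
      = (\<Sum>l | length l < s. a l * (\<Sum>k=1..s. fd_weight s k * coord_prod l (w + real k *\<^sub>R h - z)))"
    unfolding P_def sum_distrib_left by (subst sum.swap) (simp add: mult_ac)
  also have "\<dots> = P w" unfolding P_def by (intro sum.cong) (auto simp: mono simp del: One_nat_def)
  finally show ?thesis .
qed

definition cube_proj :: "real^'d \<Rightarrow> real^'d" where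
  "cube_proj w = (\<chi> i. max 0 (min 1 (w $ i)))"

lemma norm_cube_proj_diff_le:
  assumes "x \<in> unit_cube"
  shows "norm (cube_proj w - w) \<le> norm (w - x)"
proof (rule norm_le_componentwise_cart)
  fix i
  have "0 \<le> x $ i" "x $ i \<le> 1" using assms by (auto simp: unit_cube_def)
  then show "norm ((cube_proj w - w) $ i) \<le> norm ((w - x) $ i)" by (auto simp: cube_proj_def)
qed

lemma cube_proj_borel [measurable]: "(cube_proj :: real^'d \<Rightarrow> real^'d) \<in> borel_measurable borel"
  unfolding cube_proj_def by (intro borel_measurable_continuous_onI continuous_intros)

text \<open>The extension extrapolates \<open>f\<close> along the ray from \<open>w\<close> through its projection to the cube. This
  reproduces polynomials, so it inherits the local polynomial approximation of \<open>f\<close>.\<close>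

definition cube_ext :: "nat \<Rightarrow> (real^'d \<Rightarrow> real) \<Rightarrow> real^'d \<Rightarrow> real" where
  "cube_ext s f w = (if \<forall>i. - 1 / real s \<le> w $ i \<and> w $ i \<le> 1 + 1 / real s
     then \<Sum>k=1..s. fd_weight s k * f (w + real k *\<^sub>R (cube_proj w - w)) else 0)"

text \<open>A coordinate outside the unit interval by t is moved to depth (k - 1) * t behind the
  nearest face. With t <= 1 / s and k <= s this is at most 1, so the opposite face is not
  passed.\<close>

lemma cube_ext_node:
  assumes near: "\<forall>i. - 1 / real s \<le> w $ i \<and> w $ i \<le> 1 + 1 / real s" and k: "k \<in> {1..s}"
  shows "w + real k *\<^sub>R (cube_proj w - w) \<in> unit_cube"
proof -
  have "s > 0" "real k \<ge> 1" "real k \<le> real s" using k by auto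
  have "0 \<le> w $ i + real k * (max 0 (min 1 (w $ i)) - w $ i) \<and> w $ i + real k * (max 0 (min 1 (w $ i)) - w $ i) \<le> 1" for i
  proof -
    have edge: "0 \<le> (real k - 1) * t \<and> (real k - 1) * t \<le> 1" if "0 \<le> t" "t \<le> 1 / real s" for t
    proof -
      have "(real k - 1) * t \<le> real s * (1 / real s)"
        using that \<open>real k \<ge> 1\<close> \<open>real k \<le> real s\<close> by (intro mult_mono) auto
      then show ?thesis using that \<open>real k \<ge> 1\<close> \<open>s > 0\<close> by simp
    qed
    consider "w $ i < 0" | "0 \<le> w $ i" "w $ i \<le> 1" | "w $ i > 1" by linarith
    then show ?thesis
    proof cases
      case 1
      have "w $ i + real k * (max 0 (min 1 (w $ i)) - w $ i) = (real k - 1) * (- w $ i)"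
        using 1 by (simp add: algebra_simps)
      then show ?thesis using edge[of "- w $ i"] near[rule_format, of i] 1 by simp
    next
      case 3
      have "w $ i + real k * (max 0 (min 1 (w $ i)) - w $ i) = 1 - (real k - 1) * (w $ i - 1)"
        using 3 by (simp add: algebra_simps)
      then show ?thesis using edge[of "w $ i - 1"] near[rule_format, of i] 3 by simp
    qed simp
  qed
  then show ?thesis by (simp add: unit_cube_def cube_proj_def)
qed

lemma cube_ext_regular:
  fixes f :: "real^'d \<Rightarrow> real"
  assumes cont: "continuous_on unit_cube f"
  shows "cube_ext s f \<in> borel_measurable borel" "\<exists>M. \<forall>w. \<bar>cube_ext s f w\<bar> \<le> M" "integrable lborel (cube_ext s f)"
proof -
  define Q where "Q = cbox (\<chi> i. - 1 / real s) (\<chi> i. 1 + 1 / real s :: real^'d)"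
  have Q: "w \<in> Q \<longleftrightarrow> (\<forall>i. - 1 / real s \<le> w $ i \<and> w $ i \<le> 1 + 1 / real s)" for w
    by (simp add: Q_def mem_box_cart)
  \<comment> \<open>Nothing is known about f outside the cube. Cutting it off gives a measurable
    function that agrees with f at all nodes of the extrapolation.\<close>
  define f' where "f' x = indicator unit_cube x *\<^sub>R f x" for x
  have [measurable]: "f' \<in> borel_measurable borel"
    unfolding f'_def using cont by (intro borel_measurable_continuous_on_indicator) auto
  have [measurable]: "Q \<in> sets borel" by (simp add: Q_def)
  have eq: "cube_ext s f w = indicator Q w * (\<Sum>k=1..s. fd_weight s k * f' (w + real k *\<^sub>R (cube_proj w - w)))" for w
  proof (cases "w \<in> Q")
    case True
    then have near: "\<forall>i. - 1 / real s \<le> w $ i \<and> w $ i \<le> 1 + 1 / real s" by (simp add: Q)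
    then have "cube_ext s f w = (\<Sum>k=1..s. fd_weight s k * f (w + real k *\<^sub>R (cube_proj w - w)))"
      unfolding cube_ext_def by (rule if_P)
    also have "\<dots> = (\<Sum>k=1..s. fd_weight s k * f' (w + real k *\<^sub>R (cube_proj w - w)))"
      by (intro sum.cong) (auto simp: f'_def cube_ext_node[OF near])
    finally show ?thesis using True by simp
  next
    case False
    then show ?thesis unfolding cube_ext_def Q[symmetric] by simp
  qed
  show meas: "cube_ext s f \<in> borel_measurable borel" unfolding eq[abs_def] by measurable
  have "bounded (f ` unit_cube)"
    using cont compact_unit_cube by (intro compact_imp_bounded compact_continuous_image)
  then obtain b where b: "\<And>x. x \<in> unit_cube \<Longrightarrow> \<bar>f x\<bar> \<le> b" unfolding bounded_iff by auto
  then have f'b: "\<bar>f' x\<bar> \<le> \<bar>b\<bar>" for x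
    by (cases "x \<in> unit_cube") (auto simp: f'_def intro: order.trans[OF _ abs_ge_self])
  define M where "M = (\<Sum>k=1..s. \<bar>fd_weight s k\<bar> * \<bar>b\<bar>)"
  have bound: "\<bar>cube_ext s f w\<bar> \<le> indicator Q w * M" for w
  proof -
    have "\<bar>\<Sum>k=1..s. fd_weight s k * f' (w + real k *\<^sub>R (cube_proj w - w))\<bar>
        \<le> (\<Sum>k=1..s. \<bar>fd_weight s k * f' (w + real k *\<^sub>R (cube_proj w - w))\<bar>)" by (rule sum_abs)
    also have "\<dots> \<le> M" unfolding M_def abs_mult by (intro sum_mono mult_left_mono f'b) auto
    finally show ?thesis unfolding eq by (auto simp: indicator_def)
  qed
  have "M \<ge> 0" by (simp add: M_def sum_nonneg)
  show "\<exists>M. \<forall>w. \<bar>cube_ext s f w\<bar> \<le> M"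
  proof (intro exI allI)
    show "\<bar>cube_ext s f w\<bar> \<le> M" for w
      using bound[of w] \<open>M \<ge> 0\<close> by (cases "w \<in> Q") auto
  qed
  have "integrable lborel (\<lambda>w. indicator Q w * M)"
    by (intro integrable_mult_left integrable_real_indicator) (use emeasure_lborel_cbox_finite in \<open>auto simp: Q_def less_top[symmetric]\<close>)
  then show "integrable lborel (cube_ext s f)"
    by (rule Bochner_Integration.integrable_bound)
      (use meas bound in \<open>auto intro: order.trans[OF _ abs_ge_self]\<close>)
qed

text \<open>The Taylor polynomial P of f at x approximates the extension to order r everywhere: near
  the cube because extrapolation reproduces P, and far from it because there the extension is 0, the
  distance to x is at least 1 / s, and P has degree at most u < r. The outer sum over j reproduces P
  once more and leaves only this error. The order s = u + 1 is the smallest that reproduces degree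
  u.\<close>

lemma cube_ext_difference_bound:
  fixes f :: "real^'d \<Rightarrow> real"
  assumes "real u < r" "r > 0" "B \<ge> 0" "C \<ge> 0"
    and taylor: "\<And>z. z \<in> unit_cube \<Longrightarrow> \<exists>a :: 'd list \<Rightarrow> real. (\<forall>l. length l \<le> u \<longrightarrow> \<bar>a l\<bar> \<le> B) \<and> a [] = f z \<and>
       (\<forall>x\<in>unit_cube. \<bar>f x - (\<Sum>l | length l < Suc u. a l * coord_prod l (x - z))\<bar> \<le> C * norm (x - z) powr r)"
  defines "s \<equiv> Suc u"
  shows "\<exists>K\<ge>0. \<forall>x\<in>unit_cube. \<forall>y. \<bar>(\<Sum>j=1..s. fd_weight s j * cube_ext s f (x + real j *\<^sub>R y)) - f x\<bar> \<le> K * norm y powr r"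
proof -
  define W where "W = (\<Sum>k=1..s. \<bar>fd_weight s k\<bar>)"
  define N where "N = card {l :: 'd list. length l < s}"
  have "W \<ge> 0" by (simp add: W_def sum_nonneg)
  define K1 where "K1 = W * (C * (1 + real s) powr r) + real N * B * real s powr r"
  have "K1 \<ge> 0" using \<open>W \<ge> 0\<close> \<open>C \<ge> 0\<close> \<open>B \<ge> 0\<close> by (simp add: K1_def)
  define K where "K = W * (K1 * real s powr r)"
  have "K \<ge> 0" using \<open>W \<ge> 0\<close> \<open>K1 \<ge> 0\<close> by (simp add: K_def)
  moreover have "\<bar>(\<Sum>j=1..s. fd_weight s j * cube_ext s f (x + real j *\<^sub>R y)) - f x\<bar> \<le> K * norm y powr r"
    if x: "x \<in> unit_cube" for x y
  proof -
    obtain a :: "'d list \<Rightarrow> real" where a: "\<And>l. length l \<le> u \<Longrightarrow> \<bar>a l\<bar> \<le> B" "a [] = f x"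
      "\<And>w. w \<in> unit_cube \<Longrightarrow> \<bar>f w - (\<Sum>l | length l < s. a l * coord_prod l (w - x))\<bar> \<le> C * norm (w - x) powr r"
      using taylor[OF x] unfolding s_def by blast
    define P where "P w = (\<Sum>l | length l < s. a l * coord_prod l (w - x))" for w
    have Px: "P x = f x"
    proof -
      have "P x = (\<Sum>l :: 'd list | length l < s. if l = [] then a [] else 0)"
        unfolding P_def
      proof (intro sum.cong refl)
        fix l :: "'d list" show "a l * coord_prod l (x - x) = (if l = [] then a [] else 0)" by (cases l) auto
      qed
      then show ?thesis by (simp add: s_def a(2))
    qed
    have ext: "\<bar>cube_ext s f w - P w\<bar> \<le> K1 * norm (w - x) powr r" for w
    proof (cases "\<forall>i. - 1 / real s \<le> w $ i \<and> w $ i \<le> 1 + 1 / real s")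
      case True
      define n where "n k = w + real k *\<^sub>R (cube_proj w - w)" for k
      have "cube_ext s f w = (\<Sum>k=1..s. fd_weight s k * f (n k))"
        unfolding cube_ext_def n_def using True by (rule if_P)
      moreover have "P w = (\<Sum>k=1..s. fd_weight s k * P (n k))"
        unfolding n_def P_def by (rule fd_reproduces_poly[symmetric])
      ultimately have "\<bar>cube_ext s f w - P w\<bar> = \<bar>\<Sum>k=1..s. fd_weight s k * (f (n k) - P (n k))\<bar>"
        by (simp add: sum_subtractf right_diff_distrib)
      also have "\<dots> \<le> (\<Sum>k=1..s. \<bar>fd_weight s k * (f (n k) - P (n k))\<bar>)" by (rule sum_abs)
      also have "\<dots> \<le> (\<Sum>k=1..s. \<bar>fd_weight s k\<bar> * (C * ((1 + real s) * norm (w - x)) powr r))"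
      proof (intro sum_mono)
        fix k assume k: "k \<in> {1..s}"
        have "n k - x = (w - x) + real k *\<^sub>R (cube_proj w - w)" by (simp add: n_def)
        then have "norm (n k - x) \<le> norm (w - x) + real k * norm (cube_proj w - w)"
          by (metis abs_of_nat norm_scaleR norm_triangle_ineq)
        also have "\<dots> \<le> norm (w - x) + real s * norm (w - x)"
          using k norm_cube_proj_diff_le[OF x, of w] by (intro add_left_mono mult_mono) auto
        finally have "norm (n k - x) \<le> (1 + real s) * norm (w - x)" by (simp add: distrib_right)
        then have "norm (n k - x) powr r \<le> ((1 + real s) * norm (w - x)) powr r"
          using \<open>r > 0\<close> by (intro powr_mono2) auto
        moreover have "\<bar>f (n k) - P (n k)\<bar> \<le> C * norm (n k - x) powr r"
          unfolding P_def n_def by (rule a(3)[OF cube_ext_node[OF True k]])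
        ultimately have "\<bar>f (n k) - P (n k)\<bar> \<le> C * ((1 + real s) * norm (w - x)) powr r"
          using \<open>C \<ge> 0\<close> by (meson mult_left_mono order.trans)
        then show "\<bar>fd_weight s k * (f (n k) - P (n k))\<bar> \<le> \<bar>fd_weight s k\<bar> * (C * ((1 + real s) * norm (w - x)) powr r)"
          unfolding abs_mult by (intro mult_left_mono) auto
      qed
      also have "\<dots> = W * (C * (1 + real s) powr r) * norm (w - x) powr r"
        by (simp add: W_def sum_distrib_left powr_mult mult_ac)
      also have "\<dots> \<le> K1 * norm (w - x) powr r"
        using \<open>B \<ge> 0\<close> by (intro mult_right_mono) (auto simp: K1_def)
      finally show ?thesis .
    next
      case False
      then obtain i where i: "w $ i < - 1 / real s \<or> w $ i > 1 + 1 / real s" by (meson not_le)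
      have "0 \<le> x $ i" "x $ i \<le> 1" using x by (auto simp: unit_cube_def)
      then have "1 / real s \<le> \<bar>(w - x) $ i\<bar>" using i by auto
      also have "\<dots> \<le> norm (w - x)" by (rule component_le_norm_cart)
      finally have far: "1 \<le> real s * norm (w - x)" by (simp add: s_def field_simps)
      have "cube_ext s f w = 0" unfolding cube_ext_def using False by (rule if_not_P)
      then have "\<bar>cube_ext s f w - P w\<bar> = \<bar>P w\<bar>" by simp
      also have "\<dots> \<le> (\<Sum>l | length l < s. \<bar>a l * coord_prod l (w - x)\<bar>)" unfolding P_def by (rule sum_abs)
      also have "\<dots> \<le> (\<Sum>l :: 'd list | length l < s. B * (real s * norm (w - x)) powr r)"
      proof (rule sum_mono)
        fix l :: "'d list" assume "l \<in> {l. length l < s}"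
        then have l: "length l \<le> u" by (simp add: s_def)
        have "\<bar>coord_prod l (w - x)\<bar> \<le> norm (w - x) ^ length l" by (rule abs_coord_prod_le)
        also have "\<dots> \<le> (real s * norm (w - x)) ^ length l"
          by (intro power_mono) (auto simp: s_def mult_le_cancel_right1)
        also have "\<dots> = (real s * norm (w - x)) powr real (length l)"
          using far by (subst powr_realpow) auto
        also have "\<dots> \<le> (real s * norm (w - x)) powr r"
          using far l \<open>real u < r\<close> by (intro powr_mono) auto
        finally show "\<bar>a l * coord_prod l (w - x)\<bar> \<le> B * (real s * norm (w - x)) powr r"
          unfolding abs_mult using a(1)[OF l] \<open>B \<ge> 0\<close> by (intro mult_mono) auto
      qed
      also have "\<dots> = real N * B * real s powr r * norm (w - x) powr r"
        by (simp add: N_def powr_mult)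
      also have "\<dots> \<le> K1 * norm (w - x) powr r"
        using \<open>W \<ge> 0\<close> \<open>C \<ge> 0\<close> by (intro mult_right_mono) (auto simp: K1_def)
      finally show ?thesis .
    qed
    have "f x = (\<Sum>j=1..s. fd_weight s j * P (x + real j *\<^sub>R y))"
      unfolding Px[symmetric] P_def by (rule fd_reproduces_poly[symmetric])
    then have "\<bar>(\<Sum>j=1..s. fd_weight s j * cube_ext s f (x + real j *\<^sub>R y)) - f x\<bar>
        = \<bar>\<Sum>j=1..s. fd_weight s j * (cube_ext s f (x + real j *\<^sub>R y) - P (x + real j *\<^sub>R y))\<bar>"
      by (simp add: sum_subtractf right_diff_distrib)
    also have "\<dots> \<le> (\<Sum>j=1..s. \<bar>fd_weight s j * (cube_ext s f (x + real j *\<^sub>R y) - P (x + real j *\<^sub>R y))\<bar>)"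
      by (rule sum_abs)
    also have "\<dots> \<le> (\<Sum>j=1..s. \<bar>fd_weight s j\<bar> * (K1 * (real s powr r * norm y powr r)))"
    proof (intro sum_mono)
      fix j assume j: "j \<in> {1..s}"
      have "norm (x + real j *\<^sub>R y - x) powr r \<le> (real s * norm y) powr r"
        using j \<open>r > 0\<close> by (intro powr_mono2) (auto intro!: mult_right_mono)
      then have "K1 * norm (x + real j *\<^sub>R y - x) powr r \<le> K1 * (real s powr r * norm y powr r)"
        using \<open>K1 \<ge> 0\<close> by (intro mult_left_mono) (auto simp: powr_mult)
      then show "\<bar>fd_weight s j * (cube_ext s f (x + real j *\<^sub>R y) - P (x + real j *\<^sub>R y))\<bar>
          \<le> \<bar>fd_weight s j\<bar> * (K1 * (real s powr r * norm y powr r))"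
        unfolding abs_mult using ext[of "x + real j *\<^sub>R y"] by (intro mult_left_mono) auto
    qed
    also have "\<dots> = K * norm y powr r" by (simp add: K_def W_def sum_distrib_left mult_ac)
    finally show ?thesis .
  qed
  ultimately show ?thesis by blast
qed

lemma lip_class_rkhs_approx:
  fixes f :: "real^'d \<Rightarrow> real"
  assumes "lip_class r c0 f" "r > 0" "c0 > 0"
  shows "continuous_on unit_cube f"
    and "\<exists>K>0. \<forall>\<sigma>. 0 < \<sigma> \<and> \<sigma> \<le> 1 \<longrightarrow> (\<exists>L. (\<forall>p\<in>set L. snd p \<in> unit_cube) \<and>
    kcomb_norm2 \<sigma> L \<le> K / \<sigma> ^ CARD('d) \<and> (\<forall>x\<in>unit_cube. \<bar>kcomb_eval \<sigma> L x - f x\<bar> \<le> K * \<sigma> powr r))"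
proof -
  obtain u B C where T: "real u < r" "B \<ge> 0" "C \<ge> 0" "continuous_on unit_cube f"
    "\<And>z. z \<in> unit_cube \<Longrightarrow> \<exists>a :: 'd list \<Rightarrow> real. (\<forall>l. length l \<le> u \<longrightarrow> \<bar>a l\<bar> \<le> B) \<and> a [] = f z \<and>
       (\<forall>x\<in>unit_cube. \<bar>f x - (\<Sum>l | length l < Suc u. a l * coord_prod l (x - z))\<bar> \<le> C * norm (x - z) powr r)"
    using lip_class_taylor[OF assms] by blast
  show "continuous_on unit_cube f" by fact
  obtain K where K: "K \<ge> 0" "\<And>x y. x \<in> unit_cube \<Longrightarrow>
      \<bar>(\<Sum>j=1..Suc u. fd_weight (Suc u) j * cube_ext (Suc u) f (x + real j *\<^sub>R y)) - f x\<bar> \<le> K * norm y powr r"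
    using cube_ext_difference_bound[OF T(1) \<open>r > 0\<close> T(2,3,5)] by blast
  obtain M where M: "\<And>w. \<bar>cube_ext (Suc u) f w\<bar> \<le> M" using cube_ext_regular(2)[OF T(4)] by blast
  show "\<exists>K>0. \<forall>\<sigma>. 0 < \<sigma> \<and> \<sigma> \<le> 1 \<longrightarrow> (\<exists>L. (\<forall>p\<in>set L. snd p \<in> unit_cube) \<and>
    kcomb_norm2 \<sigma> L \<le> K / \<sigma> ^ CARD('d) \<and> (\<forall>x\<in>unit_cube. \<bar>kcomb_eval \<sigma> L x - f x\<bar> \<le> K * \<sigma> powr r))"
    by (rule rkhs_approx_of_difference_bound[OF cube_ext_regular(1)[OF T(4)] M cube_ext_regular(3)[OF T(4)] _ \<open>r > 0\<close> K]) auto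
qed

section \<open>Loss functions\<close>

text \<open>The hinge loss satisfies this with \<open>p = 1\<close>, where the variance bound is void, and the twice smooth
  losses with \<open>p = 2\<close>.\<close>

definition loss_bounds :: "(real \<Rightarrow> real) \<Rightarrow> nat \<Rightarrow> real \<Rightarrow> real \<Rightarrow> real \<Rightarrow> real \<Rightarrow> bool" where
  "loss_bounds \<phi> p M \<Lambda> U V \<longleftrightarrow>
     (\<forall>u v. \<bar>u\<bar> \<le> M \<longrightarrow> \<bar>v\<bar> \<le> M \<longrightarrow> \<bar>\<phi> u - \<phi> v\<bar> \<le> \<Lambda> * \<bar>u - v\<bar>) \<and>
     (\<forall>e ts. 0 \<le> e \<longrightarrow> e \<le> 1 \<longrightarrow> \<bar>ts\<bar> \<le> M \<longrightarrow> (\<forall>t. cond_phi_risk \<phi> e ts \<le> cond_phi_risk \<phi> e t) \<longrightarrow>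
        (\<forall>t. \<bar>t\<bar> \<le> M \<longrightarrow> cond_phi_risk \<phi> e t - cond_phi_risk \<phi> e ts \<le> U * \<bar>t - ts\<bar> ^ p) \<and>
        (\<forall>t. \<bar>t\<bar> \<le> M \<longrightarrow> e * (\<phi> t - \<phi> ts)\<^sup>2 + (1 - e) * (\<phi> (- t) - \<phi> (- ts))\<^sup>2
            \<le> V * (cond_phi_risk \<phi> e t - cond_phi_risk \<phi> e ts) ^ (p - 1)) \<and>
        (\<forall>t. \<bar>t\<bar> \<le> 1 \<longrightarrow> (0 \<le> t \<and> e < 1 / 2 \<or> t < 0 \<and> 1 / 2 \<le> e) \<longrightarrow>
            \<bar>2 * e - 1\<bar> ^ p \<le> U * (cond_phi_risk \<phi> e t - cond_phi_risk \<phi> e ts)))"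

section \<open>The hinge loss\<close>

lemma hinge_loss_lipschitz: "\<bar>hinge_loss u - hinge_loss v\<bar> \<le> \<bar>u - v\<bar>"
  by (simp add: hinge_loss_def)

text \<open>For the last clause: on [-1, 1] the conditional risk is 1 - (2 * e - 1) * t, hence at
  least 1 at a wrong sign, while comparing ts with the points -1 and 1 bounds the minimal risk by 2
  * min e (1 - e), which is 1 minus the absolute value of 2 * e - 1.\<close>

lemma hinge_loss_bounds:
  assumes "M \<ge> 1"
  shows "loss_bounds hinge_loss 1 M 1 1 ((2 * M)\<^sup>2)"
  unfolding loss_bounds_def
proof (intro conjI allI impI)
  fix u v :: real show "\<bar>hinge_loss u - hinge_loss v\<bar> \<le> 1 * \<bar>u - v\<bar>" using hinge_loss_lipschitz by simp
next
  fix e ts t :: real assume e: "0 \<le> e" "e \<le> 1" and ts: "\<bar>ts\<bar> \<le> M" and t: "\<bar>t\<bar> \<le> M"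
  have "cond_phi_risk hinge_loss e t - cond_phi_risk hinge_loss e ts
      = e * (hinge_loss t - hinge_loss ts) + (1 - e) * (hinge_loss (- t) - hinge_loss (- ts))"
    by (simp add: cond_phi_risk_def algebra_simps)
  also have "\<dots> \<le> e * \<bar>t - ts\<bar> + (1 - e) * \<bar>t - ts\<bar>"
    using e hinge_loss_lipschitz[of t ts] hinge_loss_lipschitz[of "- t" "- ts"]
    by (intro add_mono mult_left_mono) auto
  finally show "cond_phi_risk hinge_loss e t - cond_phi_risk hinge_loss e ts \<le> 1 * \<bar>t - ts\<bar> ^ 1"
    by (simp add: algebra_simps)
  have sq: "(hinge_loss u - hinge_loss v)\<^sup>2 \<le> (2 * M)\<^sup>2" if "\<bar>u - v\<bar> \<le> 2 * M" for u v
  proof -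
    have "\<bar>hinge_loss u - hinge_loss v\<bar>\<^sup>2 \<le> (2 * M)\<^sup>2"
      using hinge_loss_lipschitz[of u v] that by (intro power_mono) auto
    then show ?thesis by simp
  qed
  have "e * (hinge_loss t - hinge_loss ts)\<^sup>2 + (1 - e) * (hinge_loss (- t) - hinge_loss (- ts))\<^sup>2
      \<le> e * (2 * M)\<^sup>2 + (1 - e) * (2 * M)\<^sup>2"
    using e t ts by (intro add_mono mult_left_mono sq) auto
  then show "e * (hinge_loss t - hinge_loss ts)\<^sup>2 + (1 - e) * (hinge_loss (- t) - hinge_loss (- ts))\<^sup>2
      \<le> (2 * M)\<^sup>2 * (cond_phi_risk hinge_loss e t - cond_phi_risk hinge_loss e ts) ^ (1 - 1)"
    by (simp add: algebra_simps)
next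
  fix e ts t :: real
  assume e: "0 \<le> e" "e \<le> 1" and min: "\<forall>t. cond_phi_risk hinge_loss e ts \<le> cond_phi_risk hinge_loss e t"
    and t: "\<bar>t\<bar> \<le> 1" and wrong: "0 \<le> t \<and> e < 1 / 2 \<or> t < 0 \<and> 1 / 2 \<le> e"
  have "cond_phi_risk hinge_loss e t = 1 - (2 * e - 1) * t"
    using t by (simp add: cond_phi_risk_def hinge_loss_def algebra_simps)
  moreover have "(2 * e - 1) * t \<le> 0" using wrong by (auto intro: mult_nonpos_nonneg mult_nonneg_nonpos)
  moreover have "cond_phi_risk hinge_loss e ts \<le> 2 * e" "cond_phi_risk hinge_loss e ts \<le> 2 * (1 - e)"
    using min[rule_format, of "- 1"] min[rule_format, of 1] by (simp_all add: cond_phi_risk_def hinge_loss_def)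
  ultimately show "\<bar>2 * e - 1\<bar> ^ 1 \<le> 1 * (cond_phi_risk hinge_loss e t - cond_phi_risk hinge_loss e ts)"
    by (simp add: abs_if)
qed

section \<open>Twice smooth losses\<close>

lemma lipschitz_derivative_bound:
  fixes \<phi> \<phi>' :: "real \<Rightarrow> real"
  assumes d: "\<And>u. (\<phi> has_real_derivative \<phi>' u) (at u)" and L: "\<And>u v. \<bar>\<phi>' u - \<phi>' v\<bar> \<le> L * \<bar>u - v\<bar>"
  shows "\<bar>\<phi> t - \<phi> s - \<phi>' s * (t - s)\<bar> \<le> L * (t - s)\<^sup>2"
proof -
  define p where "p u = \<phi> u - \<phi>' s * u" for u
  have "0 \<le> L" using L[of 1 0] by (simp add: order.trans[OF abs_ge_zero])
  have "norm (p t - p s) \<le> (L * \<bar>t - s\<bar>) * norm (t - s)"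
  proof (rule field_differentiable_bound[of "closed_segment s t"])
    fix u assume u: "u \<in> closed_segment s t"
    show "(p has_field_derivative \<phi>' u - \<phi>' s) (at u within closed_segment s t)"
      unfolding p_def by (auto intro!: derivative_eq_intros has_field_derivative_at_within[OF d])
    have "\<bar>u - s\<bar> \<le> \<bar>t - s\<bar>" using u by (auto simp: closed_segment_eq_real_ivl split: if_splits)
    then show "norm (\<phi>' u - \<phi>' s) \<le> L * \<bar>t - s\<bar>"
      using L[of u s] mult_left_mono[of "\<bar>u - s\<bar>" "\<bar>t - s\<bar>" L] \<open>0 \<le> L\<close> by simp
  qed auto
  also have "\<dots> = L * (t - s)\<^sup>2" by (simp add: power2_eq_square abs_mult_self_eq mult.assoc)
  finally show ?thesis by (simp add: p_def algebra_simps)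
qed

text \<open>Midpoint convexity bounds the set below by 0, so its real-valued infimum is a genuine
  lower bound.\<close>

lemma modulus_of_convexity_le:
  assumes "convex_on UNIV \<phi>"
  shows "modulus_of_convexity \<phi> \<bar>u - v\<bar> \<le> (\<phi> u + \<phi> v) / 2 - \<phi> ((u + v) / 2)"
  unfolding modulus_of_convexity_def
proof (rule cInf_lower)
  show "bdd_below {(\<phi> u' + \<phi> v') / 2 - \<phi> ((u' + v') / 2) |u' v'. \<bar>u - v\<bar> \<le> \<bar>u' - v'\<bar>}"
  proof (rule bdd_belowI[of _ 0])
    fix c assume "c \<in> {(\<phi> u' + \<phi> v') / 2 - \<phi> ((u' + v') / 2) |u' v'. \<bar>u - v\<bar> \<le> \<bar>u' - v'\<bar>}"
    then obtain u' v' where c: "c = (\<phi> u' + \<phi> v') / 2 - \<phi> ((u' + v') / 2)" by blast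
    have "\<phi> ((1 - 1 / 2) *\<^sub>R u' + (1 / 2) *\<^sub>R v') \<le> (1 - 1 / 2) * \<phi> u' + 1 / 2 * \<phi> v'"
      by (rule convex_onD[OF assms]) auto
    then show "0 \<le> c" unfolding c by (simp add: add_divide_distrib)
  qed
qed blast

text \<open>The derivative of the conditional risk vanishes at ts, which leaves a quadratic upper
  bound. The modulus of convexity at the midpoint of t and ts gives a quadratic lower bound on the
  excess; with the Lipschitz bound on the loss this controls the second moment by the excess
  itself.\<close>

lemma smooth_loss_bounds:
  assumes "twice_smooth_classifying_loss \<phi>" "M \<ge> 1"
  obtains \<Lambda> U V where "\<Lambda> > 0" "U > 0" "V > 0" "loss_bounds \<phi> 2 M \<Lambda> U V"
proof -
  have conv: "convex_on UNIV \<phi>" and d0: "deriv \<phi> 0 < 0"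
    using assms by (auto simp: twice_smooth_classifying_loss_def classifying_loss_def)
  obtain \<phi>' L where d: "\<And>u. (\<phi> has_real_derivative \<phi>' u) (at u)" and "L > 0"
    and L: "\<And>u v. \<bar>\<phi>' u - \<phi>' v\<bar> \<le> L * \<bar>u - v\<bar>"
    using assms unfolding twice_smooth_classifying_loss_def by blast
  obtain \<mu> where "\<mu> > 0" and \<mu>: "\<And>\<epsilon>. \<epsilon> > 0 \<Longrightarrow> modulus_of_convexity \<phi> \<epsilon> \<ge> \<mu> * \<epsilon>\<^sup>2"
    using assms unfolding twice_smooth_classifying_loss_def by blast
  have d0: "\<phi>' 0 < 0" using d0 DERIV_imp_deriv[OF d[of 0]] by simp
  define \<Lambda> where "\<Lambda> = \<bar>\<phi>' 0\<bar> + L * M"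
  have "\<Lambda> > 0" using \<open>L > 0\<close> \<open>M \<ge> 1\<close> by (simp add: \<Lambda>_def add_nonneg_pos)
  \<comment> \<open>One constant for two clauses: L for the quadratic upper bound, the other summand
    for the calibration.\<close>
  define U where "U = L + 4 * L / (\<phi>' 0)\<^sup>2"
  have "U > 0" using \<open>L > 0\<close> by (simp add: U_def add_pos_nonneg)
  define V where "V = \<Lambda>\<^sup>2 / (2 * \<mu>)"
  have "V > 0" using \<open>\<Lambda> > 0\<close> \<open>\<mu> > 0\<close> by (simp add: V_def)
  have lip: "\<bar>\<phi> u - \<phi> v\<bar> \<le> \<Lambda> * \<bar>u - v\<bar>" if uv: "\<bar>u\<bar> \<le> M" "\<bar>v\<bar> \<le> M" for u v
  proof -
    have "norm (\<phi> u - \<phi> v) \<le> \<Lambda> * norm (u - v)"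
    proof (rule field_differentiable_bound[of "{- M..M}"])
      fix w assume w: "w \<in> {- M..M}"
      show "(\<phi> has_field_derivative \<phi>' w) (at w within {- M..M})" by (rule has_field_derivative_at_within[OF d])
      have "L * \<bar>w - 0\<bar> \<le> L * M" using w \<open>L > 0\<close> by (intro mult_left_mono) auto
      then show "norm (\<phi>' w) \<le> \<Lambda>" using L[of w 0] by (simp add: \<Lambda>_def)
    qed (use uv in auto)
    then show ?thesis by simp
  qed
  have strong: "\<mu> * (u - v)\<^sup>2 \<le> (\<phi> u + \<phi> v) / 2 - \<phi> ((u + v) / 2)" for u v
  proof (cases "u = v")
    case False
    then have "\<mu> * \<bar>u - v\<bar>\<^sup>2 \<le> modulus_of_convexity \<phi> \<bar>u - v\<bar>" by (intro \<mu>) auto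
    then show ?thesis using modulus_of_convexity_le[OF conv, of u v] by simp
  qed simp
  have tangent: "\<phi> t \<ge> \<phi> 0 + \<phi>' 0 * t" for t
    using convex_on_imp_above_tangent[OF conv, of 0 t "\<phi>' 0"] d[of 0] by (simp add: algebra_simps)
  have "loss_bounds \<phi> 2 M \<Lambda> U V"
    unfolding loss_bounds_def
  proof (intro conjI allI impI lip)
    fix e ts t :: real
    assume e: "0 \<le> e" "e \<le> 1" and ts: "\<bar>ts\<bar> \<le> M" and t: "\<bar>t\<bar> \<le> M"
      and min: "\<forall>t. cond_phi_risk \<phi> e ts \<le> cond_phi_risk \<phi> e t"
    define R where "R t = cond_phi_risk \<phi> e t" for t
    have "((\<lambda>t. \<phi> (- t)) has_real_derivative \<phi>' (- ts) * (- 1)) (at ts)"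
      by (rule DERIV_chain2[where g="\<lambda>t. - t"]) (auto intro!: derivative_eq_intros d)
    then have "((\<lambda>t. \<phi> (- t)) has_real_derivative - \<phi>' (- ts)) (at ts)" by simp
    then have "(R has_real_derivative e * \<phi>' ts + (1 - e) * (- \<phi>' (- ts))) (at ts)"
      unfolding R_def cond_phi_risk_def by (intro DERIV_add DERIV_cmult d)
    then have zero: "e * \<phi>' ts + (1 - e) * (- \<phi>' (- ts)) = 0"
      by (rule DERIV_local_min[of _ _ _ 1]) (use min in \<open>auto simp: R_def\<close>)
    have 1: "\<phi> t - \<phi> ts - \<phi>' ts * (t - ts) \<le> L * (t - ts)\<^sup>2"
      using lipschitz_derivative_bound[OF d L, of t ts] by linarith
    have "\<phi> (- t) - \<phi> (- ts) - \<phi>' (- ts) * (- t - - ts) \<le> L * (- t - - ts)\<^sup>2"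
      using lipschitz_derivative_bound[OF d L, of "- t" "- ts"] by linarith
    also have "(- t - - ts)\<^sup>2 = (t - ts)\<^sup>2" by (simp add: power2_eq_square algebra_simps)
    finally have 2: "\<phi> (- t) - \<phi> (- ts) - \<phi>' (- ts) * (- t - - ts) \<le> L * (t - ts)\<^sup>2" .
    have "R t - R ts = e * (\<phi> t - \<phi> ts - \<phi>' ts * (t - ts)) + (1 - e) * (\<phi> (- t) - \<phi> (- ts) - \<phi>' (- ts) * (- t - - ts))
        + (e * \<phi>' ts + (1 - e) * (- \<phi>' (- ts))) * (t - ts)"
      by (simp add: R_def cond_phi_risk_def algebra_simps)
    also have "\<dots> \<le> e * (L * (t - ts)\<^sup>2) + (1 - e) * (L * (t - ts)\<^sup>2)"
      unfolding zero using e 1 2 by (simp add: add_mono mult_left_mono)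
    also have "\<dots> = L * \<bar>t - ts\<bar> ^ 2" by (simp add: algebra_simps)
    also have "\<dots> \<le> U * \<bar>t - ts\<bar> ^ 2"
      using \<open>L > 0\<close> by (intro mult_right_mono) (auto simp: U_def)
    finally show "cond_phi_risk \<phi> e t - cond_phi_risk \<phi> e ts \<le> U * \<bar>t - ts\<bar> ^ 2" by (simp add: R_def)
    have "2 * \<mu> * (t - ts)\<^sup>2 \<le> R t - R ts"
    proof -
      have "R ts \<le> R ((t + ts) / 2)" using min by (simp add: R_def)
      also have "\<dots> = e * \<phi> ((t + ts) / 2) + (1 - e) * \<phi> ((- t + - ts) / 2)"
      proof -
        have "- ((t + ts) / 2) = (- t + - ts) / 2" by (simp add: field_simps)
        then show ?thesis by (simp only: R_def cond_phi_risk_def)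
      qed
      also have "\<dots> \<le> e * ((\<phi> t + \<phi> ts) / 2 - \<mu> * (t - ts)\<^sup>2) + (1 - e) * ((\<phi> (- t) + \<phi> (- ts)) / 2 - \<mu> * (- t - - ts)\<^sup>2)"
        using strong[of t ts] strong[of "- t" "- ts"] e by (intro add_mono mult_left_mono) auto
      also have "\<dots> = (R t + R ts) / 2 - \<mu> * (t - ts)\<^sup>2"
        by (simp add: R_def cond_phi_risk_def field_simps power2_eq_square)
      finally show ?thesis by (simp add: field_simps)
    qed
    then have sc: "(t - ts)\<^sup>2 \<le> (R t - R ts) / (2 * \<mu>)" using \<open>\<mu> > 0\<close> by (simp add: field_simps)
    have sq: "(\<phi> u - \<phi> v)\<^sup>2 \<le> \<Lambda>\<^sup>2 * (u - v)\<^sup>2" if "\<bar>u\<bar> \<le> M" "\<bar>v\<bar> \<le> M" for u v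
    proof -
      have "\<bar>\<phi> u - \<phi> v\<bar>\<^sup>2 \<le> (\<Lambda> * \<bar>u - v\<bar>)\<^sup>2" by (intro power_mono lip that) auto
      then show ?thesis by (simp add: power_mult_distrib)
    qed
    have "e * (\<phi> t - \<phi> ts)\<^sup>2 + (1 - e) * (\<phi> (- t) - \<phi> (- ts))\<^sup>2
        \<le> e * (\<Lambda>\<^sup>2 * (t - ts)\<^sup>2) + (1 - e) * (\<Lambda>\<^sup>2 * (- t - - ts)\<^sup>2)"
      using e t ts by (intro add_mono mult_left_mono sq) auto
    also have "\<dots> = \<Lambda>\<^sup>2 * (t - ts)\<^sup>2" by (simp add: algebra_simps power2_eq_square)
    also have "\<dots> \<le> \<Lambda>\<^sup>2 * ((R t - R ts) / (2 * \<mu>))" using sc by (intro mult_left_mono) auto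
    also have "\<dots> = V * (R t - R ts)" by (simp add: V_def)
    finally show "e * (\<phi> t - \<phi> ts)\<^sup>2 + (1 - e) * (\<phi> (- t) - \<phi> (- ts))\<^sup>2
        \<le> V * (cond_phi_risk \<phi> e t - cond_phi_risk \<phi> e ts) ^ (2 - 1)" by (simp add: R_def)
  next
    fix e ts t :: real
    assume e: "0 \<le> e" "e \<le> 1" and min: "\<forall>t. cond_phi_risk \<phi> e ts \<le> cond_phi_risk \<phi> e t"
      and wrong: "0 \<le> t \<and> e < 1 / 2 \<or> t < 0 \<and> 1 / 2 \<le> e"
    \<comment> \<open>At a wrong sign the tangent of \<phi> at 0 already shows that the conditional
      risk is at least \<phi> 0.\<close>
    have "(2 * e - 1) * t \<le> 0" using wrong by (auto intro: mult_nonpos_nonneg mult_nonneg_nonpos)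
    then have "0 \<le> \<phi>' 0 * ((2 * e - 1) * t)" using d0 by (intro mult_nonpos_nonpos) auto
    also have "\<phi>' 0 * ((2 * e - 1) * t) + \<phi> 0 = e * (\<phi> 0 + \<phi>' 0 * t) + (1 - e) * (\<phi> 0 + \<phi>' 0 * (- t))"
      by (simp add: algebra_simps)
    finally have "\<phi> 0 \<le> e * (\<phi> 0 + \<phi>' 0 * t) + (1 - e) * (\<phi> 0 + \<phi>' 0 * (- t))" by simp
    also have "\<dots> \<le> cond_phi_risk \<phi> e t"
      unfolding cond_phi_risk_def using e tangent[of t] tangent[of "- t"] by (intro add_mono mult_left_mono) auto
    finally have lower: "\<phi> 0 \<le> cond_phi_risk \<phi> e t" .
    \<comment> \<open>g is the derivative of the conditional risk at 0, and t0 minimises the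
      quadratic majorant \<open>\<phi> 0 + g * t + L * t\<^sup>2\<close>; the minimal risk therefore
      lies below \<phi> 0 by at least \<open>g\<^sup>2 / (4 * L)\<close>.\<close>
    define g where "g = (2 * e - 1) * \<phi>' 0"
    define t0 where "t0 = - g / (2 * L)"
    have "cond_phi_risk \<phi> e ts \<le> cond_phi_risk \<phi> e t0" using min by blast
    also have "\<dots> \<le> e * (\<phi> 0 + \<phi>' 0 * t0 + L * t0\<^sup>2) + (1 - e) * (\<phi> 0 - \<phi>' 0 * t0 + L * t0\<^sup>2)"
      unfolding cond_phi_risk_def
      using e lipschitz_derivative_bound[OF d L, of t0 0] lipschitz_derivative_bound[OF d L, of "- t0" 0]
      by (intro add_mono mult_left_mono) auto
    also have "\<dots> = \<phi> 0 + g * t0 + L * t0\<^sup>2" by (simp add: g_def algebra_simps)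
    also have "\<dots> = \<phi> 0 - g\<^sup>2 / (4 * L)"
      using \<open>L > 0\<close> by (simp add: t0_def field_simps power2_eq_square)
    finally have gap: "g\<^sup>2 / (4 * L) \<le> cond_phi_risk \<phi> e t - cond_phi_risk \<phi> e ts" using lower by simp
    have "\<bar>2 * e - 1\<bar> ^ 2 = 4 * L / (\<phi>' 0)\<^sup>2 * (g\<^sup>2 / (4 * L))"
      using \<open>L > 0\<close> d0 by (simp add: g_def power_mult_distrib)
    also have "\<dots> \<le> 4 * L / (\<phi>' 0)\<^sup>2 * (cond_phi_risk \<phi> e t - cond_phi_risk \<phi> e ts)"
      using gap \<open>L > 0\<close> by (intro mult_left_mono) auto
    also have "\<dots> \<le> U * (cond_phi_risk \<phi> e t - cond_phi_risk \<phi> e ts)"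
      using \<open>L > 0\<close> min by (intro mult_right_mono) (auto simp: U_def)
    finally show "\<bar>2 * e - 1\<bar> ^ 2 \<le> U * (cond_phi_risk \<phi> e t - cond_phi_risk \<phi> e ts)" .
  qed
  then show ?thesis using that \<open>\<Lambda> > 0\<close> \<open>U > 0\<close> \<open>V > 0\<close> by blast
qed

section \<open>Properties shared by both losses\<close>

lemma loss_bounds_exist:
  assumes "\<phi> = hinge_loss \<or> twice_smooth_classifying_loss \<phi>"
  obtains p where "p = 1 \<or> p = 2"
    "\<And>M. M \<ge> 1 \<Longrightarrow> \<exists>\<Lambda>>0. \<exists>U>0. \<exists>V>0. loss_bounds \<phi> p M \<Lambda> U V"
  using assms
proof
  assume "\<phi> = hinge_loss"
  then have "\<exists>\<Lambda>>0. \<exists>U>0. \<exists>V>0. loss_bounds \<phi> 1 M \<Lambda> U V" if "M \<ge> 1" for M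
    using hinge_loss_bounds[OF that] that by (intro exI[of _ 1] conjI exI[of _ "(2 * M)\<^sup>2"]) auto
  then show ?thesis using that by blast
next
  assume "twice_smooth_classifying_loss \<phi>"
  then have "\<exists>\<Lambda>>0. \<exists>U>0. \<exists>V>0. loss_bounds \<phi> 2 M \<Lambda> U V" if "M \<ge> 1" for M
    using smooth_loss_bounds[OF _ that] by metis
  then show ?thesis using that by blast
qed

text \<open>For the clipping claim: above 1 the argument moves to the zero of \<phi>, and for u < -1
  the point -1 is a convex combination of 1 and u, so its loss is at most a fraction of the loss at
  u.\<close>

lemma loss_basic:
  assumes "\<phi> = hinge_loss \<or> twice_smooth_classifying_loss \<phi>"
  shows "0 \<le> \<phi> u" "continuous_on UNIV \<phi>" "\<phi> (clip u) \<le> \<phi> u"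
proof -
  show nonneg: "0 \<le> \<phi> u" for u
    using assms by (auto simp: hinge_loss_def twice_smooth_classifying_loss_def classifying_loss_def)
  have "continuous_on UNIV hinge_loss" unfolding hinge_loss_def by (intro continuous_intros)
  moreover have "continuous_on UNIV \<phi>" if "twice_smooth_classifying_loss \<phi>"
    using that unfolding twice_smooth_classifying_loss_def
    by (meson DERIV_isCont continuous_at_imp_continuous_on)
  ultimately show "continuous_on UNIV \<phi>" using assms by blast
  have conv: "convex_on UNIV \<phi>" and one: "\<phi> 1 = 0"
  proof -
    have "convex_on UNIV hinge_loss"
    proof (rule convex_onI)
      fix t x y :: real assume t: "0 < t" "t < 1"
      have "(1 - t) * (1 - x) \<le> (1 - t) * hinge_loss x" "t * (1 - y) \<le> t * hinge_loss y"
        "0 \<le> (1 - t) * hinge_loss x" "0 \<le> t * hinge_loss y"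
        using t by (auto simp: hinge_loss_def intro!: mult_left_mono mult_nonneg_nonneg)
      then show "hinge_loss ((1 - t) *\<^sub>R x + t *\<^sub>R y) \<le> (1 - t) * hinge_loss x + t * hinge_loss y"
        unfolding hinge_loss_def[of "(1 - t) *\<^sub>R x + t *\<^sub>R y"] by (auto simp: algebra_simps)
    qed simp
    moreover have "hinge_loss 1 = 0" by (simp add: hinge_loss_def)
    ultimately show "convex_on UNIV \<phi>" "\<phi> 1 = 0"
      using assms unfolding twice_smooth_classifying_loss_def classifying_loss_def by blast+
  qed
  consider "u < - 1" | "- 1 \<le> u" "u \<le> 1" | "u > 1" by linarith
  then show "\<phi> (clip u) \<le> \<phi> u"
  proof cases
    case 1
    define l where "l = 2 / (1 - u)"
    have l: "0 \<le> l" "l \<le> 1" using 1 by (auto simp: l_def)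
    have "l * (1 - u) = 2" using 1 by (simp add: l_def divide_eq_eq)
    then have eq: "(1 - l) *\<^sub>R 1 + l *\<^sub>R u = - 1" by (simp add: algebra_simps)
    have "\<phi> (- 1) \<le> (1 - l) * \<phi> 1 + l * \<phi> u"
      using convex_onD[OF conv l, of 1 u] unfolding eq by simp
    also have "\<dots> \<le> \<phi> u" using one nonneg[of u] l by (simp add: mult_left_le_one_le)
    finally show ?thesis using 1 by (simp add: clip_def)
  next
    case 2
    then show ?thesis by (simp add: clip_def)
  next
    case 3
    then show ?thesis using one nonneg[of u] by (simp add: clip_def)
  qed
qed

section \<open>Concentration and conditional labels\<close>

lemma exp_le_quadratic:
  fixes x :: real
  assumes "\<bar>x\<bar> \<le> 1"
  shows "exp x \<le> 1 + x + x\<^sup>2"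
proof (cases "x \<ge> 0")
  case True
  then show ?thesis using exp_bound[of x] assms by simp
next
  case False
  define y where "y = - x"
  have y: "0 < y" "y \<le> 1" using False assms by (auto simp: y_def)
  have "1 \<le> 1 + y ^ 3" using y by simp
  also have "\<dots> = (1 - y + y\<^sup>2) * (1 + y)" by (simp add: algebra_simps power2_eq_square power3_eq_cube)
  also have "\<dots> \<le> (1 - y + y\<^sup>2) * exp y"
    using y exp_ge_add_one_self[of y] by (intro mult_left_mono) auto
  finally have "exp (- y) \<le> 1 - y + y\<^sup>2" by (simp add: exp_minus field_simps)
  then show ?thesis by (simp add: y_def)
qed

lemma (in prob_space) expectation_exp_le:
  fixes G :: "'a \<Rightarrow> real"
  assumes [measurable]: "G \<in> borel_measurable M" and b: "\<And>z. \<bar>s * G z\<bar> \<le> 1" and "s > 0"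
  shows "integrable M (\<lambda>z. exp (- s * G z))"
    "expectation (\<lambda>z. exp (- s * G z)) \<le> exp (- s * expectation G + s\<^sup>2 * expectation (\<lambda>z. (G z)\<^sup>2))"
proof -
  have G: "\<bar>G z\<bar> \<le> 1 / s" for z using b[of z] \<open>s > 0\<close> by (simp add: abs_mult field_simps)
  have iG: "integrable M G" by (rule integrable_const_bound[of _ "1 / s"]) (use G in auto)
  have iG2: "integrable M (\<lambda>z. (G z)\<^sup>2)"
  proof (rule integrable_const_bound[of _ "(1 / s)\<^sup>2"])
    show "AE z in M. norm ((G z)\<^sup>2) \<le> (1 / s)\<^sup>2"
      using power_mono[OF G abs_ge_zero, of _ 2] by (intro AE_I2) simp
  qed simp
  show ie: "integrable M (\<lambda>z. exp (- s * G z))"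
  proof (rule integrable_const_bound[of _ "exp 1"])
    show "AE z in M. norm (exp (- s * G z)) \<le> exp 1"
    proof (intro AE_I2)
      fix z have "- s * G z \<le> 1" using b[of z] by (simp add: abs_le_iff)
      then show "norm (exp (- s * G z)) \<le> exp 1" by simp
    qed
  qed simp
  have "expectation (\<lambda>z. exp (- s * G z)) \<le> expectation (\<lambda>z. 1 + (- s * G z + s\<^sup>2 * (G z)\<^sup>2))"
  proof (rule integral_mono[OF ie])
    show "integrable M (\<lambda>z. 1 + (- s * G z + s\<^sup>2 * (G z)\<^sup>2))"
      using iG iG2 by (intro Bochner_Integration.integrable_add integrable_mult_right) auto
    show "exp (- s * G z) \<le> 1 + (- s * G z + s\<^sup>2 * (G z)\<^sup>2)" for z
      using exp_le_quadratic[of "- s * G z"] b[of z] by (simp add: power_mult_distrib)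
  qed
  also have "\<dots> = 1 + (- s * expectation G + s\<^sup>2 * expectation (\<lambda>z. (G z)\<^sup>2))"
  proof -
    have "expectation (\<lambda>z. 1 + (- s * G z + s\<^sup>2 * (G z)\<^sup>2))
        = expectation (\<lambda>z. 1) + (expectation (\<lambda>z. - s * G z) + expectation (\<lambda>z. s\<^sup>2 * (G z)\<^sup>2))"
      using iG iG2 by (subst Bochner_Integration.integral_add; (intro Bochner_Integration.integrable_add integrable_mult_right)?; simp)
    then show ?thesis by (simp add: prob_space)
  qed
  also have "\<dots> \<le> exp (- s * expectation G + s\<^sup>2 * expectation (\<lambda>z. (G z)\<^sup>2))"
    using exp_ge_add_one_self by blast
  finally show "expectation (\<lambda>z. exp (- s * G z)) \<le> exp (- s * expectation G + s\<^sup>2 * expectation (\<lambda>z. (G z)\<^sup>2))" .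
qed

text \<open>A Chernoff bound with s left free. The second moment enters as a separate term with
  factor s, so that a bound of it by the expectation of G can later absorb it.\<close>

lemma (in prob_space) iid_lower_deviation:
  fixes m :: nat and G :: "'a \<Rightarrow> real"
  assumes G [measurable]: "G \<in> borel_measurable M" and b: "\<And>z. \<bar>s * G z\<bar> \<le> 1" and "s > 0" "m \<ge> 1"
  defines "P \<equiv> PiM {..<m} (\<lambda>_. M)"
  shows "measure P {D \<in> space P. \<not> expectation G - 1 / real m * (\<Sum>i<m. G (D i))
      \<le> T / (s * real m) + s * expectation (\<lambda>z. (G z)\<^sup>2)} \<le> exp (- T)"
proof -
  interpret product_sigma_finite "\<lambda>_ :: nat. M" by unfold_locales
  interpret P: prob_space P unfolding P_def by (intro prob_space_PiM) unfold_locales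
  define E V where "E = expectation G" and "V = expectation (\<lambda>z. (G z)\<^sup>2)"
  \<comment> \<open>Normalised to have expectation at most 1; then so has the product over the
    sample, whatever m is, and Markov's inequality gives the tail.\<close>
  define h where "h z = exp (- s * G z) * exp (s * E - s\<^sup>2 * V)" for z
  have h: "integrable M h" "expectation h \<le> 1"
  proof -
    show "integrable M h" unfolding h_def using expectation_exp_le(1)[OF G b \<open>s > 0\<close>] by (rule integrable_mult_left)
    have "expectation h = expectation (\<lambda>z. exp (- s * G z)) * exp (s * E - s\<^sup>2 * V)"
      unfolding h_def by (rule integral_mult_left_zero)
    also have "\<dots> \<le> exp (- s * E + s\<^sup>2 * V) * exp (s * E - s\<^sup>2 * V)"
      using expectation_exp_le(2)[OF G b \<open>s > 0\<close>] by (intro mult_right_mono) (auto simp: E_def V_def)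
    also have "\<dots> = 1" by (simp add: exp_add[symmetric])
    finally show "expectation h \<le> 1" .
  qed
  have h0: "expectation h \<ge> 0" by (simp add: h_def)
  have Pint: "integrable P (\<lambda>D. \<Prod>i<m. h (D i))"
    unfolding P_def by (rule product_integrable_prod) (auto simp: h)
  have "(\<integral>D. (\<Prod>i<m. h (D i)) \<partial>P) = (\<Prod>i<m. expectation h)"
    unfolding P_def by (rule product_integral_prod) (auto simp: h)
  also have "\<dots> \<le> 1" using h h0 by (simp add: power_le_one)
  finally have Pone: "(\<integral>D. (\<Prod>i<m. h (D i)) \<partial>P) \<le> 1" .
  have "measure P {D \<in> space P. \<not> E - 1 / real m * (\<Sum>i<m. G (D i)) \<le> T / (s * real m) + s * V}
      \<le> measure P {D \<in> space P. exp T \<le> (\<Prod>i<m. h (D i))}"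
  proof (rule P.finite_measure_mono)
    have [measurable]: "h \<in> borel_measurable M" unfolding h_def by simp
    show "{D \<in> space P. exp T \<le> (\<Prod>i<m. h (D i))} \<in> sets P"
      unfolding P_def by measurable
    show "{D \<in> space P. \<not> E - 1 / real m * (\<Sum>i<m. G (D i)) \<le> T / (s * real m) + s * V}
        \<subseteq> {D \<in> space P. exp T \<le> (\<Prod>i<m. h (D i))}"
    proof clarify
      fix D assume "\<not> E - 1 / real m * (\<Sum>i<m. G (D i)) \<le> T / (s * real m) + s * V"
      then have "T / (s * real m) + s * V < E - 1 / real m * (\<Sum>i<m. G (D i))" by simp
      then have "(T / (s * real m) + s * V) * (s * real m) < (E - 1 / real m * (\<Sum>i<m. G (D i))) * (s * real m)"
        using \<open>s > 0\<close> \<open>m \<ge> 1\<close> by (intro mult_strict_right_mono) auto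
      moreover have "(T / (s * real m) + s * V) * (s * real m) = T + real m * (s\<^sup>2 * V)"
        using \<open>s > 0\<close> \<open>m \<ge> 1\<close> by (simp add: field_simps power2_eq_square)
      moreover have "(E - 1 / real m * (\<Sum>i<m. G (D i))) * (s * real m) = real m * (s * E) - s * (\<Sum>i<m. G (D i))"
        using \<open>m \<ge> 1\<close> by (simp add: field_simps)
      ultimately have "T \<le> real m * (s * E) - s * (\<Sum>i<m. G (D i)) - real m * (s\<^sup>2 * V)" by linarith
      also have "\<dots> = (\<Sum>i<m. - s * G (D i) + (s * E - s\<^sup>2 * V))"
        by (simp add: sum.distrib sum_subtractf sum_negf sum_distrib_left right_diff_distrib)
      finally have "exp T \<le> exp (\<Sum>i<m. - s * G (D i) + (s * E - s\<^sup>2 * V))" by simp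
      also have "\<dots> = (\<Prod>i<m. h (D i))" by (simp add: exp_sum h_def exp_add[symmetric])
      finally show "exp T \<le> (\<Prod>i<m. h (D i))" .
    qed
  qed
  also have "\<dots> \<le> 1 / exp T * (\<integral>D. (\<Prod>i<m. h (D i)) \<partial>P)"
    using integral_Markov_inequality_measure[OF Pint sets.empty_sets, of "exp T"]
    by (simp add: h_def prod_nonneg)
  also have "\<dots> \<le> 1 / exp T * 1" using Pone by (intro mult_left_mono) auto
  also have "\<dots> = exp (- T)" by (simp add: exp_minus inverse_eq_divide)
  finally show ?thesis by (simp add: E_def V_def)
qed

text \<open>The default 0 concerns a null set by \<open>supp\<close>. It makes bounds on a and b
  valid for the function everywhere, as the exponential moment bound requires.\<close>

definition label_fun :: "(real^'d \<Rightarrow> real) \<Rightarrow> (real^'d \<Rightarrow> real) \<Rightarrow> (real^'d) \<times> real \<Rightarrow> real" where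
  "label_fun a b z = (if snd z = 1 then a (fst z) else if snd z = - 1 then b (fst z) else 0)"

lemma label_fun_measurable [measurable]:
  assumes [measurable]: "a \<in> borel_measurable borel" "b \<in> borel_measurable borel"
  shows "label_fun a b \<in> borel_measurable (borel :: ((real^'d) \<times> real) measure)"
proof -
  have [measurable]: "fst \<in> borel_measurable (borel :: ((real^'d) \<times> real) measure)"
    "snd \<in> borel_measurable (borel :: ((real^'d) \<times> real) measure)"
    by (auto intro!: borel_measurable_continuous_onI continuous_intros)
  show ?thesis unfolding label_fun_def by measurable
qed

text \<open>\<open>eta_cond\<close> expresses that \<eta> is the conditional probability of label 1
  without constructing conditional distributions.\<close>

locale labelled_sample = prob_space \<rho>
  for \<rho> :: "((real^'d) \<times> real) measure" +
  fixes \<eta> :: "real^'d \<Rightarrow> real"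
  assumes sets_rho [measurable_cong]: "sets \<rho> = sets borel"
    and supp: "AE z in \<rho>. fst z \<in> unit_cube \<and> snd z \<in> {-1, 1}"
    and eta_measurable [measurable]: "\<eta> \<in> borel_measurable borel"
    and eta_bounds: "\<forall>x. 0 \<le> \<eta> x \<and> \<eta> x \<le> 1"
    and eta_cond: "\<forall>A\<in>sets borel. measure \<rho> (A \<times> {1}) = (\<integral>x. indicator A x * \<eta> x \<partial>(distr \<rho> borel fst))"
begin

definition \<rho>X :: "(real^'d) measure" where "\<rho>X = distr \<rho> borel fst"

lemma fst_snd_measurable [measurable]: "fst \<in> \<rho> \<rightarrow>\<^sub>M borel" "snd \<in> \<rho> \<rightarrow>\<^sub>M borel"
  by (auto simp: measurable_cong_sets[OF sets_rho refl] intro!: borel_measurable_continuous_onI continuous_intros)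

lemma space_rho [simp]: "space \<rho> = UNIV"
  using sets_eq_imp_space_eq[OF sets_rho] by simp

lemma sets_rhoX [simp, measurable_cong]: "sets \<rho>X = sets borel"
  by (simp add: \<rho>X_def)

lemma prob_space_rhoX: "prob_space \<rho>X"
  unfolding \<rho>X_def by (rule prob_space_distr) simp

lemma integrable_rhoX_bounded:
  assumes "f \<in> borel_measurable borel" "\<And>x. \<bar>f x\<bar> \<le> B"
  shows "integrable \<rho>X (f :: _ \<Rightarrow> real)"
  by (rule finite_measure.integrable_const_bound[OF prob_space.finite_measure[OF prob_space_rhoX], of _ B])
    (use assms in \<open>auto simp: measurable_cong_sets[OF sets_rhoX refl]\<close>)

text \<open>The image on X of \<rho> restricted to label 1 has density \<eta> with respect to the
  marginal; \<open>eta_cond\<close> is this statement on sets.\<close>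

lemma integral_label_one:
  assumes [measurable]: "a \<in> borel_measurable borel" and a: "\<And>x. \<bar>a x\<bar> \<le> B"
  shows "(\<integral>z. indicator {z. snd z = 1} z * a (fst z) \<partial>\<rho>) = (\<integral>x. \<eta> x * a x \<partial>\<rho>X)"
proof -
  have [measurable]: "{z. snd z = (1::real)} \<in> sets \<rho>"
    using measurable_sets[OF fst_snd_measurable(2), of "{1}"] by (simp add: vimage_def)
  define \<rho>1 where "\<rho>1 = distr (density \<rho> (indicator {z. snd z = 1})) borel fst"
  have "\<rho>1 = density \<rho>X \<eta>"
  proof (rule measure_eqI)
    show "sets \<rho>1 = sets (density \<rho>X \<eta>)" by (simp add: \<rho>1_def)
    fix A assume "A \<in> sets \<rho>1"
    then have A [measurable]: "A \<in> sets borel" by (simp add: \<rho>1_def)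
    have Aset: "fst -` A \<in> sets \<rho>" using measurable_sets[OF fst_snd_measurable(1) A] by simp
    have "emeasure \<rho>1 A = emeasure (density \<rho> (indicator {z. snd z = 1})) (fst -` A)"
      unfolding \<rho>1_def by (subst emeasure_distr) auto
    also have "\<dots> = (\<integral>\<^sup>+z. indicator {z. snd z = 1} z * indicator (fst -` A) z \<partial>\<rho>)"
      using Aset by (intro emeasure_density) auto
    also have "\<dots> = (\<integral>\<^sup>+z. indicator (A \<times> {1}) z \<partial>\<rho>)"
      by (intro nn_integral_cong) (auto simp: indicator_def)
    also have "\<dots> = emeasure \<rho> (A \<times> {1})"
    proof (rule nn_integral_indicator)
      have "A \<times> {1 :: real} = fst -` A \<inter> {z. snd z = 1}" by auto
      then show "A \<times> {1} \<in> sets \<rho>" using Aset by simp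
    qed
    also have "\<dots> = ennreal (\<integral>x. indicator A x * \<eta> x \<partial>\<rho>X)"
      using eta_cond A by (simp add: emeasure_eq_measure \<rho>X_def)
    also have "\<dots> = (\<integral>\<^sup>+x. ennreal (indicator A x * \<eta> x) \<partial>\<rho>X)"
      using eta_bounds
      by (intro nn_integral_eq_integral[symmetric] integrable_rhoX_bounded[of _ 1]) (auto simp: indicator_def)
    also have "\<dots> = emeasure (density \<rho>X \<eta>) A"
      by (subst emeasure_density) (auto intro!: nn_integral_cong simp: indicator_def mult.commute)
    finally show "emeasure \<rho>1 A = emeasure (density \<rho>X \<eta>) A" .
  qed
  have "(\<integral>z. indicator {z. snd z = 1} z * a (fst z) \<partial>\<rho>) = (\<integral>z. a (fst z) \<partial>density \<rho> (indicator {z. snd z = 1}))"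
    using integral_density[of "\<lambda>z. a (fst z)" \<rho> "indicator {z. snd z = 1}"] by (simp add: ennreal_indicator)
  also have "\<dots> = (\<integral>x. a x \<partial>\<rho>1)" unfolding \<rho>1_def by (subst integral_distr) auto
  also have "\<dots> = (\<integral>x. \<eta> x * a x \<partial>\<rho>X)"
    unfolding \<open>\<rho>1 = density \<rho>X \<eta>\<close> using eta_bounds by (subst integral_density) auto
  finally show ?thesis .
qed

text \<open>\<open>eta_cond\<close> concerns label 1 only. The contribution of label -1 is the whole
  integral of b minus its part on label 1, which is correct by \<open>supp\<close>.\<close>

lemma integral_label_fun:
  assumes [measurable]: "a \<in> borel_measurable borel" "b \<in> borel_measurable borel"
    and a: "\<And>x. \<bar>a x\<bar> \<le> B" and b: "\<And>x. \<bar>b x\<bar> \<le> B"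
  shows "(\<integral>z. label_fun a b z \<partial>\<rho>) = (\<integral>x. \<eta> x * a x + (1 - \<eta> x) * b x \<partial>\<rho>X)"
proof -
  have S [measurable]: "{z. snd z = (1::real)} \<in> sets \<rho>"
    using measurable_sets[OF fst_snd_measurable(2), of "{1}"] by (simp add: vimage_def)
  have int: "integrable \<rho> (\<lambda>z. h (fst z))" "integrable \<rho> (\<lambda>z. indicator {z. snd z = 1} z * h (fst z))"
    if [measurable]: "h \<in> borel_measurable borel" and h: "\<And>x. \<bar>h x\<bar> \<le> B" for h :: "real^'d \<Rightarrow> real"
    by (rule integrable_const_bound[of _ B]; use h order.trans[OF abs_ge_zero h] in \<open>auto simp: indicator_def\<close>)+
  have "(\<integral>z. label_fun a b z \<partial>\<rho>)
      = (\<integral>z. indicator {z. snd z = 1} z * a (fst z) + (b (fst z) - indicator {z. snd z = 1} z * b (fst z)) \<partial>\<rho>)"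
  proof (rule integral_cong_AE)
    show "label_fun a b \<in> borel_measurable \<rho>"
      by (subst measurable_cong_sets[OF sets_rho refl]) simp
    show "AE z in \<rho>. label_fun a b z
        = indicator {z. snd z = 1} z * a (fst z) + (b (fst z) - indicator {z. snd z = 1} z * b (fst z))"
      using supp by eventually_elim (auto simp: label_fun_def)
  qed simp
  also have "\<dots> = (\<integral>z. indicator {z. snd z = 1} z * a (fst z) \<partial>\<rho>)
      + ((\<integral>z. b (fst z) \<partial>\<rho>) - (\<integral>z. indicator {z. snd z = 1} z * b (fst z) \<partial>\<rho>))"
    using int a b by (subst Bochner_Integration.integral_add) (auto simp: Bochner_Integration.integral_diff)
  also have "\<dots> = (\<integral>x. \<eta> x * a x \<partial>\<rho>X) + ((\<integral>x. b x \<partial>\<rho>X) - (\<integral>x. \<eta> x * b x \<partial>\<rho>X))"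
    unfolding integral_label_one[OF assms(1) a] integral_label_one[OF assms(2) b]
    by (simp add: \<rho>X_def integral_distr)
  also have "\<dots> = (\<integral>x. \<eta> x * a x + (b x - \<eta> x * b x) \<partial>\<rho>X)"
  proof -
    have e: "integrable \<rho>X (\<lambda>x. \<eta> x * h x)" if [measurable]: "h \<in> borel_measurable borel" and h: "\<And>x. \<bar>h x\<bar> \<le> B" for h
    proof (rule integrable_rhoX_bounded[of _ B])
      fix x have "\<bar>\<eta> x\<bar> * \<bar>h x\<bar> \<le> 1 * B" using eta_bounds h by (intro mult_mono) auto
      then show "\<bar>\<eta> x * h x\<bar> \<le> B" by (simp add: abs_mult)
    qed simp
    show ?thesis using e a b integrable_rhoX_bounded[of b B]
      by (simp add: Bochner_Integration.integral_add Bochner_Integration.integral_diff)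
  qed
  finally show ?thesis by (simp add: algebra_simps)
qed

end

section \<open>Excess risk\<close>

lemma kcomb_eval_measurable [measurable]: "kcomb_eval \<sigma> L \<in> borel_measurable borel"
proof (induction L)
  case (Cons p L)
  have "gauss_kernel \<sigma> (snd p) \<in> borel_measurable borel"
    unfolding gauss_kernel_def by measurable
  then have "(\<lambda>x. gauss_kernel \<sigma> x (snd p)) \<in> borel_measurable borel"
    by (simp add: gauss_kernel_commute[of \<sigma> _ "snd p"])
  with Cons show ?case by simp
qed simp

lemma in_rkhs_measurable:
  assumes "in_rkhs \<sigma> f"
  shows "f \<in> borel_measurable borel"
proof -
  obtain g where g: "rkhs_approx \<sigma> g f" and out: "\<And>x. x \<notin> unit_cube \<Longrightarrow> f x = 0"
    using assms unfolding in_rkhs_def by blast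
  show ?thesis
  proof (rule borel_measurable_LIMSEQ_real)
    show "(\<lambda>k. indicator unit_cube x * kcomb_eval \<sigma> (g k) x) \<longlonglongrightarrow> f x" for x
      using g out[of x] unfolding rkhs_approx_def by (cases "x \<in> unit_cube") auto
    show "(\<lambda>x. indicator unit_cube x * kcomb_eval \<sigma> (g k) x) \<in> borel_measurable borel" for k
      by measurable
  qed
qed

text \<open>ts is a pointwise minimiser on the cube, made measurable and bounded on the whole space.
  M bounds ts as well as the functions compared with it.\<close>

locale excess_risk = labelled_sample \<rho> \<eta>
  for \<rho> :: "((real^'d) \<times> real) measure" and \<eta> +
  fixes \<phi> :: "real \<Rightarrow> real" and ts :: "real^'d \<Rightarrow> real" and p :: nat and M \<Lambda> U V :: real
  assumes loss: "\<phi> = hinge_loss \<or> twice_smooth_classifying_loss \<phi>"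
    and p: "p = 1 \<or> p = 2" and lb: "loss_bounds \<phi> p M \<Lambda> U V"
    and pos: "\<Lambda> > 0" "U > 0" "V > 0" "M \<ge> 1"
    and ts_measurable [measurable]: "ts \<in> borel_measurable borel" and ts_bound: "\<And>x. \<bar>ts x\<bar> \<le> M"
    and ts_min: "\<And>x t. x \<in> unit_cube \<Longrightarrow> cond_phi_risk \<phi> (\<eta> x) (ts x) \<le> cond_phi_risk \<phi> (\<eta> x) t"
begin

lemma phi_measurable [measurable]: "\<phi> \<in> borel_measurable borel"
  using loss_basic(2)[OF loss] by (rule borel_measurable_continuous_onI)

lemma phi_lipschitz: "\<bar>u\<bar> \<le> M \<Longrightarrow> \<bar>v\<bar> \<le> M \<Longrightarrow> \<bar>\<phi> u - \<phi> v\<bar> \<le> \<Lambda> * \<bar>u - v\<bar>"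
  using lb unfolding loss_bounds_def by blast

definition pointwise_excess :: "(real^'d \<Rightarrow> real) \<Rightarrow> real^'d \<Rightarrow> real" where
  "pointwise_excess t x =
     indicator unit_cube x * (cond_phi_risk \<phi> (\<eta> x) (t x) - cond_phi_risk \<phi> (\<eta> x) (ts x))"

definition excess :: "(real^'d \<Rightarrow> real) \<Rightarrow> real" where
  "excess t = (\<integral>x. pointwise_excess t x \<partial>\<rho>X)"

text \<open>Its expectation is the excess \<phi>-risk over ts. The indicators discard points off the
  cube, where ts need not minimise; by \<open>supp\<close> this changes nothing almost
  surely.\<close>

definition loss_gap :: "(real^'d \<Rightarrow> real) \<Rightarrow> (real^'d) \<times> real \<Rightarrow> real" where
  "loss_gap t = label_fun (\<lambda>x. indicator unit_cube x * (\<phi> (t x) - \<phi> (ts x)))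
     (\<lambda>x. indicator unit_cube x * (\<phi> (- t x) - \<phi> (- ts x)))"

lemma loss_gap_eq:
  "fst z \<in> unit_cube \<Longrightarrow> snd z \<in> {- 1, 1} \<Longrightarrow>
    loss_gap t z = \<phi> (snd z * t (fst z)) - \<phi> (snd z * ts (fst z))"
  by (auto simp: loss_gap_def label_fun_def)

lemma pointwise_excess_nonneg: "pointwise_excess t x \<ge> 0"
  using ts_min[of x "t x"] by (cases "x \<in> unit_cube") (auto simp: pointwise_excess_def)

context
  fixes t :: "real^'d \<Rightarrow> real"
  assumes t [measurable]: "t \<in> borel_measurable borel" and tM: "\<And>x. \<bar>t x\<bar> \<le> M"
begin

lemma gap_bounds:
  "\<bar>indicator unit_cube x * (\<phi> (t x) - \<phi> (ts x))\<bar> \<le> 2 * \<Lambda> * M"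
  "\<bar>indicator unit_cube x * (\<phi> (- t x) - \<phi> (- ts x))\<bar> \<le> 2 * \<Lambda> * M"
proof -
  have b: "\<bar>\<phi> u - \<phi> v\<bar> \<le> 2 * \<Lambda> * M" if "\<bar>u\<bar> \<le> M" "\<bar>v\<bar> \<le> M" for u v
  proof -
    have "\<bar>\<phi> u - \<phi> v\<bar> \<le> \<Lambda> * \<bar>u - v\<bar>" by (rule phi_lipschitz[OF that])
    also have "\<dots> \<le> \<Lambda> * (2 * M)" using that pos by (intro mult_left_mono) auto
    finally show ?thesis by simp
  qed
  show "\<bar>indicator unit_cube x * (\<phi> (t x) - \<phi> (ts x))\<bar> \<le> 2 * \<Lambda> * M"
    "\<bar>indicator unit_cube x * (\<phi> (- t x) - \<phi> (- ts x))\<bar> \<le> 2 * \<Lambda> * M"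
    using b[of "t x" "ts x"] b[of "- t x" "- ts x"] tM[of x] ts_bound[of x] pos
    by (cases "x \<in> unit_cube"; simp)+
qed

lemma loss_gap_bound: "\<bar>loss_gap t z\<bar> \<le> 2 * \<Lambda> * M"
  using gap_bounds[of "fst z"] pos by (auto simp: loss_gap_def label_fun_def)

lemma loss_gap_measurable [measurable]: "loss_gap t \<in> borel_measurable \<rho>"
  unfolding measurable_cong_sets[OF sets_rho refl] loss_gap_def by measurable

lemma pointwise_excess_eq:
  "pointwise_excess t x = \<eta> x * (indicator unit_cube x * (\<phi> (t x) - \<phi> (ts x)))
     + (1 - \<eta> x) * (indicator unit_cube x * (\<phi> (- t x) - \<phi> (- ts x)))"
  by (simp add: pointwise_excess_def cond_phi_risk_def algebra_simps)

lemma expectation_loss_gap: "expectation (loss_gap t) = excess t"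
  unfolding excess_def loss_gap_def
  by (subst integral_label_fun[OF _ _ gap_bounds]) (simp_all add: pointwise_excess_eq[symmetric])

lemma pointwise_excess_integrable: "integrable \<rho>X (pointwise_excess t)"
proof (rule integrable_rhoX_bounded[of _ "2 * \<Lambda> * M"])
  show "pointwise_excess t \<in> borel_measurable borel"
    unfolding pointwise_excess_eq[abs_def] by measurable
  fix x
  have "\<bar>pointwise_excess t x\<bar> \<le> \<bar>\<eta> x * (indicator unit_cube x * (\<phi> (t x) - \<phi> (ts x)))\<bar>
      + \<bar>(1 - \<eta> x) * (indicator unit_cube x * (\<phi> (- t x) - \<phi> (- ts x)))\<bar>"
    unfolding pointwise_excess_eq by (rule abs_triangle_ineq)
  also have "\<dots> \<le> \<eta> x * (2 * \<Lambda> * M) + (1 - \<eta> x) * (2 * \<Lambda> * M)"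
    unfolding abs_mult[of "\<eta> x"] abs_mult[of "1 - \<eta> x"]
    using eta_bounds gap_bounds by (intro add_mono mult_mono) auto
  finally show "\<bar>pointwise_excess t x\<bar> \<le> 2 * \<Lambda> * M" by (simp add: algebra_simps)
qed

lemma expectation_loss_gap_square:
  "expectation (\<lambda>z. (loss_gap t z)\<^sup>2) \<le> V * (if p = 1 then 1 else excess t)"
proof -
  define a b where "a x = indicator unit_cube x * (\<phi> (t x) - \<phi> (ts x))"
    and "b x = indicator unit_cube x * (\<phi> (- t x) - \<phi> (- ts x))" for x
  have ab: "\<bar>a x\<bar> \<le> 2 * \<Lambda> * M" "\<bar>b x\<bar> \<le> 2 * \<Lambda> * M" for x
    using gap_bounds[of x] by (simp_all add: a_def b_def)
  have [measurable]: "a \<in> borel_measurable borel" "b \<in> borel_measurable borel"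
    unfolding a_def b_def by measurable
  have a2: "\<bar>(a x)\<^sup>2\<bar> \<le> (2 * \<Lambda> * M)\<^sup>2" and b2: "\<bar>(b x)\<^sup>2\<bar> \<le> (2 * \<Lambda> * M)\<^sup>2" for x
    using power_mono[OF ab(1)[of x], of 2] power_mono[OF ab(2)[of x], of 2] by simp_all
  have "(\<lambda>z. (loss_gap t z)\<^sup>2) = label_fun (\<lambda>x. (a x)\<^sup>2) (\<lambda>x. (b x)\<^sup>2)"
    by (auto simp: loss_gap_def label_fun_def a_def b_def fun_eq_iff)
  then have "expectation (\<lambda>z. (loss_gap t z)\<^sup>2) = (\<integral>x. \<eta> x * (a x)\<^sup>2 + (1 - \<eta> x) * (b x)\<^sup>2 \<partial>\<rho>X)"
    by (simp add: integral_label_fun[OF _ _ a2 b2])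
  also have "\<dots> \<le> (\<integral>x. V * (if p = 1 then 1 else pointwise_excess t x) \<partial>\<rho>X)"
  proof (rule integral_mono')
    show "integrable \<rho>X (\<lambda>x. V * (if p = 1 then 1 else pointwise_excess t x))"
      using pointwise_excess_integrable integrable_rhoX_bounded[of "\<lambda>_. V" "\<bar>V\<bar>"] by (cases "p = 1") auto
    show "0 \<le> V * (if p = 1 then 1 else pointwise_excess t x)" for x
      using pos pointwise_excess_nonneg by simp
    show "\<eta> x * (a x)\<^sup>2 + (1 - \<eta> x) * (b x)\<^sup>2 \<le> V * (if p = 1 then 1 else pointwise_excess t x)" for x
    proof (cases "x \<in> unit_cube")
      case True
      have "\<eta> x * (\<phi> (t x) - \<phi> (ts x))\<^sup>2 + (1 - \<eta> x) * (\<phi> (- t x) - \<phi> (- ts x))\<^sup>2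
          \<le> V * (cond_phi_risk \<phi> (\<eta> x) (t x) - cond_phi_risk \<phi> (\<eta> x) (ts x)) ^ (p - 1)"
        using lb ts_min[OF True] ts_bound[of x] tM[of x] eta_bounds unfolding loss_bounds_def by blast
      then show ?thesis using True p by (auto simp: a_def b_def pointwise_excess_def)
    next
      case False
      then show ?thesis using pos pointwise_excess_nonneg[of t x] by (simp add: a_def b_def)
    qed
  qed
  also have "\<dots> = V * (if p = 1 then 1 else excess t)"
    using prob_space.prob_space[OF prob_space_rhoX] by (simp add: excess_def)
  finally show ?thesis .
qed

lemma excess_nonneg: "excess t \<ge> 0"
  unfolding excess_def using pointwise_excess_nonneg by (simp add: Bochner_Integration.integral_nonneg)

text \<open>For p = 2 the second moment is at most V times the excess, so s * V <= 1 / 2 lets half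
  of the excess absorb it; this is the origin of 1 / 2 and 3 / 2. For p = 1 the second moment is
  only bounded by V, and \<tau> = s * V remains.\<close>

lemma excess_deviation:
  fixes m :: nat and s T :: real
  assumes "m \<ge> 1" "s > 0" "s * (2 * \<Lambda> * M) \<le> 1" "s * V \<le> 1 / 2"
  defines "P \<equiv> PiM {..<m} (\<lambda>_. \<rho>)" and "\<tau> \<equiv> (if p = 1 then s * V else 0)"
  shows "measure P {D \<in> space P. \<not> excess t / 2 - 1 / real m * (\<Sum>i<m. loss_gap t (D i)) \<le> T / (s * real m) + \<tau>} \<le> exp (- T)"
    and "measure P {D \<in> space P. \<not> 1 / real m * (\<Sum>i<m. loss_gap t (D i)) \<le> 3 / 2 * excess t + T / (s * real m) + \<tau>} \<le> exp (- T)"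
proof -
  interpret P: prob_space P unfolding P_def by (intro prob_space_PiM) unfold_locales
  have var: "s * expectation (\<lambda>z. (loss_gap t z)\<^sup>2) \<le> excess t / 2 + \<tau>"
  proof -
    have "s * expectation (\<lambda>z. (loss_gap t z)\<^sup>2) \<le> s * (V * (if p = 1 then 1 else excess t))"
      using expectation_loss_gap_square \<open>s > 0\<close> by (intro mult_left_mono) auto
    also have "\<dots> \<le> excess t / 2 + \<tau>"
      using excess_nonneg mult_right_mono[OF \<open>s * V \<le> 1 / 2\<close> excess_nonneg] by (auto simp: \<tau>_def mult_ac)
    finally show ?thesis .
  qed
  have b: "\<bar>s * loss_gap t z\<bar> \<le> 1" for z
  proof -
    have "\<bar>s * loss_gap t z\<bar> \<le> s * (2 * \<Lambda> * M)"
      unfolding abs_mult using loss_gap_bound[of z] \<open>s > 0\<close> by (intro mult_mono) auto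
    then show ?thesis using assms by linarith
  qed
  have [measurable]: "(\<lambda>D. \<Sum>i<m. loss_gap t (D i)) \<in> borel_measurable P" unfolding P_def by measurable
  have "measure P {D \<in> space P. \<not> excess t / 2 - 1 / real m * (\<Sum>i<m. loss_gap t (D i)) \<le> T / (s * real m) + \<tau>}
      \<le> measure P {D \<in> space P. \<not> expectation (loss_gap t) - 1 / real m * (\<Sum>i<m. loss_gap t (D i))
      \<le> T / (s * real m) + s * expectation (\<lambda>z. (loss_gap t z)\<^sup>2)}"
  proof (rule P.finite_measure_mono)
    show "{D \<in> space P. \<not> expectation (loss_gap t) - 1 / real m * (\<Sum>i<m. loss_gap t (D i))
      \<le> T / (s * real m) + s * expectation (\<lambda>z. (loss_gap t z)\<^sup>2)} \<in> sets P" by measurable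
  qed (use var expectation_loss_gap in auto)
  also have "\<dots> \<le> exp (- T)"
    unfolding P_def by (rule iid_lower_deviation[OF loss_gap_measurable b \<open>s > 0\<close> \<open>m \<ge> 1\<close>])
  finally show "measure P {D \<in> space P. \<not> excess t / 2 - 1 / real m * (\<Sum>i<m. loss_gap t (D i)) \<le> T / (s * real m) + \<tau>} \<le> exp (- T)" .
  have "measure P {D \<in> space P. \<not> 1 / real m * (\<Sum>i<m. loss_gap t (D i)) \<le> 3 / 2 * excess t + T / (s * real m) + \<tau>}
      \<le> measure P {D \<in> space P. \<not> expectation (\<lambda>z. - loss_gap t z) - 1 / real m * (\<Sum>i<m. - loss_gap t (D i))
      \<le> T / (s * real m) + s * expectation (\<lambda>z. (- loss_gap t z)\<^sup>2)}"
  proof (rule P.finite_measure_mono)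
    show "{D \<in> space P. \<not> expectation (\<lambda>z. - loss_gap t z) - 1 / real m * (\<Sum>i<m. - loss_gap t (D i))
      \<le> T / (s * real m) + s * expectation (\<lambda>z. (- loss_gap t z)\<^sup>2)} \<in> sets P"
      unfolding sum_negf by measurable
  qed (use var expectation_loss_gap in \<open>auto simp: sum_negf\<close>)
  also have "\<dots> \<le> exp (- T)"
    unfolding P_def by (rule iid_lower_deviation[OF _ _ \<open>s > 0\<close> \<open>m \<ge> 1\<close>]) (use b in auto)
  finally show "measure P {D \<in> space P. \<not> 1 / real m * (\<Sum>i<m. loss_gap t (D i)) \<le> 3 / 2 * excess t + T / (s * real m) + \<tau>} \<le> exp (- T)" .
qed

lemma excess_le_of_close:
  assumes "\<And>x. x \<in> unit_cube \<Longrightarrow> \<bar>t x - ts x\<bar> \<le> \<epsilon>" "\<epsilon> \<ge> 0"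
  shows "excess t \<le> U * \<epsilon> ^ p"
proof -
  have "excess t \<le> (\<integral>x. U * \<epsilon> ^ p \<partial>\<rho>X)"
    unfolding excess_def
  proof (rule integral_mono')
    show "integrable \<rho>X (\<lambda>x. U * \<epsilon> ^ p)" by (rule integrable_rhoX_bounded[of _ "\<bar>U * \<epsilon> ^ p\<bar>"]) auto
    show "0 \<le> U * \<epsilon> ^ p" using pos \<open>\<epsilon> \<ge> 0\<close> by simp
    show "pointwise_excess t x \<le> U * \<epsilon> ^ p" for x
    proof (cases "x \<in> unit_cube")
      case True
      have "cond_phi_risk \<phi> (\<eta> x) (t x) - cond_phi_risk \<phi> (\<eta> x) (ts x) \<le> U * \<bar>t x - ts x\<bar> ^ p"
        using lb ts_min[OF True] ts_bound[of x] tM[of x] eta_bounds unfolding loss_bounds_def by blast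
      also have "\<dots> \<le> U * \<epsilon> ^ p" using pos assms(1)[OF True] by (intro mult_left_mono power_mono) auto
      finally show ?thesis using True by (simp add: pointwise_excess_def)
    qed (use pos \<open>\<epsilon> \<ge> 0\<close> in \<open>simp add: pointwise_excess_def\<close>)
  qed
  then show ?thesis using prob_space.prob_space[OF prob_space_rhoX] by simp
qed

end

lemma loss_gap_perturb:
  assumes "\<And>x. \<bar>t x\<bar> \<le> M" "\<And>x. \<bar>t' x\<bar> \<le> M" "\<And>x. x \<in> unit_cube \<Longrightarrow> \<bar>t x - t' x\<bar> \<le> \<epsilon>" "\<epsilon> \<ge> 0"
  shows "loss_gap t z \<le> loss_gap t' z + \<Lambda> * \<epsilon>"
proof -
  have "\<phi> u - \<phi> v \<le> \<Lambda> * \<epsilon>" if "\<bar>u\<bar> \<le> M" "\<bar>v\<bar> \<le> M" "\<bar>u - v\<bar> \<le> \<epsilon>" for u v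
    using phi_lipschitz[OF that(1,2)] mult_left_mono[OF that(3), of \<Lambda>] pos by linarith
  then have gap: "\<phi> (t x) - \<phi> (t' x) \<le> \<Lambda> * \<epsilon>" "\<phi> (- t x) - \<phi> (- t' x) \<le> \<Lambda> * \<epsilon>" if "x \<in> unit_cube" for x
    using assms(1,2)[of x] assms(3)[OF that] by (auto simp: abs_minus_commute)
  show ?thesis using gap[of "fst z"] pos \<open>\<epsilon> \<ge> 0\<close>
    by (cases "fst z \<in> unit_cube") (auto simp: loss_gap_def label_fun_def)
qed

lemma excess_perturb:
  assumes [measurable]: "t \<in> borel_measurable borel" "t' \<in> borel_measurable borel"
    and "\<And>x. \<bar>t x\<bar> \<le> M" "\<And>x. \<bar>t' x\<bar> \<le> M" "\<And>x. x \<in> unit_cube \<Longrightarrow> \<bar>t x - t' x\<bar> \<le> \<epsilon>" "\<epsilon> \<ge> 0"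
  shows "excess t \<le> excess t' + \<Lambda> * \<epsilon>"
proof -
  have i: "integrable \<rho> (loss_gap t)" "integrable \<rho> (loss_gap t')"
    by (rule integrable_const_bound[of _ "2 * \<Lambda> * M"]; use loss_gap_bound loss_gap_measurable assms in auto)+
  have "excess t = expectation (loss_gap t)" using assms by (simp add: expectation_loss_gap)
  also have "\<dots> \<le> expectation (\<lambda>z. loss_gap t' z + \<Lambda> * \<epsilon>)"
    using i loss_gap_perturb[OF assms(3-6)] by (intro integral_mono) auto
  also have "\<dots> = expectation (loss_gap t') + \<Lambda> * \<epsilon>" using i by (simp add: prob_space[unfolded space_rho])
  also have "expectation (loss_gap t') = excess t'" using assms by (simp add: expectation_loss_gap)
  finally show ?thesis .
qed

section \<open>Misclassification risk and calibration\<close>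

lemma misclass_risk_eq:
  assumes [measurable]: "C \<in> borel_measurable borel" and C: "\<And>x. C x = 1 \<or> C x = - 1"
  shows "misclass_risk \<rho> C = (\<integral>x. \<eta> x * of_bool (C x \<noteq> 1) + (1 - \<eta> x) * of_bool (C x \<noteq> - 1) \<partial>\<rho>X)"
proof -
  have S: "{z. C (fst z) \<noteq> snd z} \<in> sets \<rho>"
  proof -
    have "{z \<in> space \<rho>. C (fst z) \<noteq> snd z} \<in> sets \<rho>" by measurable
    then show ?thesis by simp
  qed
  have "misclass_risk \<rho> C = expectation (indicator {z. C (fst z) \<noteq> snd z})"
    unfolding misclass_risk_def by simp
  also have "\<dots> = expectation (label_fun (\<lambda>x. of_bool (C x \<noteq> 1)) (\<lambda>x. of_bool (C x \<noteq> - 1)))"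
  proof (rule integral_cong_AE)
    show "indicator {z. C (fst z) \<noteq> snd z} \<in> borel_measurable \<rho>" using S by simp
    show "label_fun (\<lambda>x. of_bool (C x \<noteq> 1)) (\<lambda>x. of_bool (C x \<noteq> - 1)) \<in> borel_measurable \<rho>"
      by (subst measurable_cong_sets[OF sets_rho refl]) measurable
    show "AE z in \<rho>. indicator {z. C (fst z) \<noteq> snd z} z = label_fun (\<lambda>x. of_bool (C x \<noteq> 1)) (\<lambda>x. of_bool (C x \<noteq> - 1)) z"
      using supp by eventually_elim (auto simp: label_fun_def indicator_def)
  qed
  also have "\<dots> = (\<integral>x. \<eta> x * of_bool (C x \<noteq> 1) + (1 - \<eta> x) * of_bool (C x \<noteq> - 1) \<partial>\<rho>X)"
    by (rule integral_label_fun[of _ _ 1]) auto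
  finally show ?thesis .
qed

text \<open>The excess misclassification risk is the integral of
  \<open>\<bar>2 * \<eta> x - 1\<bar>\<close> over the points where the two classifiers differ.
  There the last clause of \<open>loss_bounds\<close> applies, because clipping keeps the sign of f;
  Jensen's inequality moves the power p inside the integral.\<close>

lemma calibration:
  assumes f [measurable]: "f \<in> borel_measurable borel"
  defines "\<Delta> \<equiv> misclass_risk \<rho> (sign_clf f) - misclass_risk \<rho> (bayes_rule \<eta>)"
  shows "\<Delta> ^ p \<le> U * excess (\<lambda>x. clip (f x))"
proof -
  interpret X: prob_space \<rho>X by (rule prob_space_rhoX)
  define r where "r C x = \<eta> x * of_bool (C x \<noteq> (1::real)) + (1 - \<eta> x) * of_bool (C x \<noteq> - 1)" for C x
  define w where "w x = \<bar>2 * \<eta> x - 1\<bar> * of_bool (sign_clf f x \<noteq> bayes_rule \<eta> x)" for x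
  have [measurable]: "sign_clf f \<in> borel_measurable borel" "bayes_rule \<eta> \<in> borel_measurable borel"
    unfolding sign_clf_def bayes_rule_def by measurable
  have rb: "\<bar>r C x\<bar> \<le> 1" for C x
    using eta_bounds[rule_format, of x] by (auto simp: r_def of_bool_def)
  have ri: "integrable \<rho>X (r C)" if [measurable]: "C \<in> borel_measurable borel" for C
    by (rule integrable_rhoX_bounded[OF _ rb]) (simp add: r_def)
  have "\<Delta> = (\<integral>x. r (sign_clf f) x \<partial>\<rho>X) - (\<integral>x. r (bayes_rule \<eta>) x \<partial>\<rho>X)"
    unfolding \<Delta>_def r_def by (subst (1 2) misclass_risk_eq) (auto simp: sign_clf_def bayes_rule_def)
  also have "\<dots> = (\<integral>x. r (sign_clf f) x - r (bayes_rule \<eta>) x \<partial>\<rho>X)"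
    by (rule Bochner_Integration.integral_diff[symmetric]) (auto intro: ri)
  also have "\<dots> = (\<integral>x. w x \<partial>\<rho>X)"
    by (intro Bochner_Integration.integral_cong refl)
      (auto simp: w_def r_def sign_clf_def bayes_rule_def abs_if)
  finally have \<Delta>: "\<Delta> = (\<integral>x. w x \<partial>\<rho>X)" .
  have [measurable]: "w \<in> borel_measurable borel" unfolding w_def by measurable
  have wb: "0 \<le> w x" "w x \<le> 1" for x
    using eta_bounds[rule_format, of x] by (auto simp: w_def of_bool_def abs_if)
  have wi: "integrable \<rho>X (\<lambda>x. w x ^ k)" for k
    using wb by (intro integrable_rhoX_bounded[of _ 1]) (auto simp: power_le_one)
  have "\<Delta> ^ p \<le> (\<integral>x. w x ^ p \<partial>\<rho>X)"
  proof (cases "p = 1")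
    case False
    have "0 \<le> (\<integral>x. (w x - \<Delta>)\<^sup>2 \<partial>\<rho>X)" by simp
    also have "\<dots> = (\<integral>x. (w x)\<^sup>2 - 2 * \<Delta> * w x + \<Delta>\<^sup>2 \<partial>\<rho>X)"
      by (simp add: power2_diff algebra_simps)
    also have "\<dots> = (\<integral>x. (w x)\<^sup>2 \<partial>\<rho>X) - 2 * \<Delta> * \<Delta> + \<Delta>\<^sup>2"
      using wi[of 1] wi[of 2] by (simp add: \<Delta>[symmetric] X.prob_space[simplified])
    finally show ?thesis using False p by (simp add: power2_eq_square)
  qed (simp add: \<Delta>)
  also have "\<dots> \<le> (\<integral>x. U * pointwise_excess (\<lambda>x. clip (f x)) x \<partial>\<rho>X)"
  proof (rule integral_mono_AE[OF wi])
    show "integrable \<rho>X (\<lambda>x. U * pointwise_excess (\<lambda>x. clip (f x)) x)"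
      using pos by (intro integrable_mult_right pointwise_excess_integrable) (auto intro: order.trans[OF abs_clip_le])
    have "AE x in \<rho>X. x \<in> unit_cube"
      unfolding \<rho>X_def using supp by (subst AE_distr_iff) (auto elim: AE_mp)
    then show "AE x in \<rho>X. w x ^ p \<le> U * pointwise_excess (\<lambda>x. clip (f x)) x"
    proof eventually_elim
      fix x :: "real^'d" assume x: "x \<in> unit_cube"
      show "w x ^ p \<le> U * pointwise_excess (\<lambda>x. clip (f x)) x"
      proof (cases "sign_clf f x = bayes_rule \<eta> x")
        case True
        then show ?thesis using p pos pointwise_excess_nonneg by (auto simp: w_def)
      next
        case False
        then have "0 \<le> clip (f x) \<and> \<eta> x < 1 / 2 \<or> clip (f x) < 0 \<and> 1 / 2 \<le> \<eta> x"
          using clip_nonneg_iff[of "f x"] by (auto simp: sign_clf_def bayes_rule_def split: if_splits)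
        then have "\<bar>2 * \<eta> x - 1\<bar> ^ p \<le> U * (cond_phi_risk \<phi> (\<eta> x) (clip (f x)) - cond_phi_risk \<phi> (\<eta> x) (ts x))"
          using lb ts_min[OF x] ts_bound[of x] abs_clip_le[of "f x"] eta_bounds unfolding loss_bounds_def by blast
        then show ?thesis using False x by (simp add: w_def pointwise_excess_def)
      qed
    qed
  qed
  also have "\<dots> = U * excess (\<lambda>x. clip (f x))" by (simp add: excess_def)
  finally show ?thesis .
qed

end

section \<open>The learning rate\<close>

text \<open>There are of order \<open>m powr ((\<kappa> + 1 / b) * d)\<close> cells with a fixed
  number S of coefficients each, and every coefficient costs a logarithm of m, which
  \<open>m powr \<kappa>\<close> absorbs. The exponents add up to \<kappa> * d + \<kappa> + d /
  b.\<close>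

lemma rkhs_net_rate:
  fixes r \<nu> A :: real
  assumes "r > 0" "\<nu> > 0" "A \<ge> 0"
  defines "d \<equiv> real CARD('d::finite)"
  shows "\<exists>c1>0. \<exists>c3>0. \<forall>m::nat. m \<ge> 1 \<longrightarrow> (\<exists>N :: (real^'d \<Rightarrow> real) set. finite N \<and>
     (\<forall>q\<in>N. q \<in> borel_measurable borel \<and> (\<forall>x. \<bar>q x\<bar> \<le> 1)) \<and>
     real (card N) \<le> exp (c3 * real m powr (\<nu> + d / (2 * r + d))) \<and>
     (\<forall>f. in_rkhs (real m powr (- 1 / (2 * r + d))) f \<and> rkhs_norm2 (real m powr (- 1 / (2 * r + d))) f \<le> real m * A \<longrightarrow>
        (\<exists>q\<in>N. \<forall>x\<in>unit_cube. \<bar>clip (f x) - q x\<bar> \<le> c1 / real m)))"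
proof -
  define b where "b = 2 * r + d"
  have "d \<ge> 1" by (simp add: d_def Suc_leI)
  then have "b > 0" using \<open>r > 0\<close> by (simp add: b_def)
  \<comment> \<open>Shares \<nu> between the d directions of the cells and the logarithm.\<close>
  define \<kappa> where "\<kappa> = \<nu> / (d + 1)"
  have "\<kappa> > 0" using \<open>\<nu> > 0\<close> \<open>d \<ge> 1\<close> by (simp add: \<kappa>_def)
  have \<kappa>\<nu>: "\<kappa> * d + \<kappa> = \<nu>"
    using \<open>d \<ge> 1\<close> by (simp add: \<kappa>_def add_divide_distrib[symmetric] field_simps)
  \<comment> \<open>The truncation error is of order
    \<open>sqrt m * m powr (- \<kappa> * n)\<close>; this n brings it down to order 1 / m.\<close>
  define n where "n = nat \<lceil>3 / (2 * \<kappa>)\<rceil>"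
  have "3 / (2 * \<kappa>) \<le> real n" unfolding n_def by linarith
  then have \<kappa>n: "3 / 2 \<le> \<kappa> * real n" using \<open>\<kappa> > 0\<close> by (simp add: field_simps)
  define S where "S = card {l :: 'd list. length l < n}"
  define w where "w = sqrt 2 * sqrt d"
  define B where "B = 2 * sqrt (A + 1) + 3"
  have "B \<ge> 3" using \<open>A \<ge> 0\<close> by (simp add: B_def)
  define c1 where "c1 = 1 + sqrt (A + 1) * w ^ n + real S"
  define c2 where "c2 = ln B + 3 / (2 * \<kappa>)"
  have "ln B \<ge> 0" using \<open>B \<ge> 3\<close> by (intro ln_ge_zero) auto
  then have "c2 > 0" using \<open>\<kappa> > 0\<close> by (simp add: c2_def add_nonneg_pos)
  define c3 where "c3 = 3 ^ CARD('d) * real S * c2 + 1"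
  have "c1 > 0" using \<open>A \<ge> 0\<close> by (simp add: c1_def w_def d_def add_pos_nonneg)
  have "c3 > 0" using \<open>c2 > 0\<close> by (simp add: c3_def add_nonneg_pos)
  have "\<exists>N :: (real^'d \<Rightarrow> real) set. finite N \<and>
     (\<forall>q\<in>N. q \<in> borel_measurable borel \<and> (\<forall>x. \<bar>q x\<bar> \<le> 1)) \<and>
     real (card N) \<le> exp (c3 * real m powr (\<nu> + d / b)) \<and>
     (\<forall>f. in_rkhs (real m powr (- 1 / b)) f \<and> rkhs_norm2 (real m powr (- 1 / b)) f \<le> real m * A \<longrightarrow>
        (\<exists>q\<in>N. \<forall>x\<in>unit_cube. \<bar>clip (f x) - q x\<bar> \<le> c1 / real m))" if m: "m \<ge> 1" for m :: nat
  proof -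
    define x where "x = real m"
    have x: "x \<ge> 1" using m by (simp add: x_def)
    define \<sigma> where "\<sigma> = x powr (- 1 / b)"
    have "\<sigma> > 0" using x by (simp add: \<sigma>_def)
    define n0 where "n0 = nat \<lceil>x powr (\<kappa> + 1 / b)\<rceil>"
    have cell: "x powr \<kappa> / \<sigma> = x powr (\<kappa> + 1 / b)"
      unfolding \<sigma>_def powr_diff[symmetric] by simp
    have "x powr (\<kappa> + 1 / b) \<ge> 1" using x \<open>\<kappa> > 0\<close> \<open>b > 0\<close> by (intro ge_one_powr_ge_zero) auto
    then have n0: "x powr (\<kappa> + 1 / b) \<le> real n0" "real n0 + 1 \<le> 3 * x powr (\<kappa> + 1 / b)" "n0 > 0"
      unfolding n0_def by linarith+
    \<comment> \<open>A + 1 in place of A yields the strict norm bound that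
      \<open>rkhs_ball_net\<close> asks for.\<close>
    define R where "R = sqrt (A + 1) * sqrt x"
    have "R \<ge> 0" using x \<open>A \<ge> 0\<close> by (simp add: R_def)
    have R2: "R\<^sup>2 = (A + 1) * x" using x \<open>A \<ge> 0\<close> by (simp add: R_def power_mult_distrib)
    have "1 / x > 0" using x by simp
    from rkhs_ball_net[OF \<open>\<sigma> > 0\<close> \<open>R \<ge> 0\<close> this \<open>n0 > 0\<close>, of n, where 'd='d]
    obtain N :: "(real^'d \<Rightarrow> real) set" where N: "finite N"
      "\<And>q. q \<in> N \<Longrightarrow> q \<in> borel_measurable borel" "\<And>q x. q \<in> N \<Longrightarrow> \<bar>q x\<bar> \<le> 1"
      "real (card N) \<le> (2 * R / (1 / x) + 3) ^ ((n0 + 1) ^ CARD('d) * S)"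
      "\<And>f. in_rkhs \<sigma> f \<Longrightarrow> rkhs_norm2 \<sigma> f < R\<^sup>2 \<Longrightarrow>
       \<exists>q\<in>N. \<forall>y\<in>unit_cube. \<bar>clip (f y) - q y\<bar>
         \<le> 1 / x + R * (sqrt 2 * (sqrt (real CARD('d)) * (1 / real n0)) / \<sigma>) ^ n + real S * (1 / x)"
      unfolding S_def by metis
    have err: "1 / x + R * (sqrt 2 * (sqrt (real CARD('d)) * (1 / real n0)) / \<sigma>) ^ n + real S * (1 / x) \<le> c1 / x"
    proof -
      have "sqrt 2 * (sqrt (real CARD('d)) * (1 / real n0)) / \<sigma> = w * (1 / (real n0 * \<sigma>))"
        by (simp add: w_def d_def)
      also have "\<dots> \<le> w * x powr (- \<kappa>)"
      proof (rule mult_left_mono)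
        have "x powr \<kappa> \<le> real n0 * \<sigma>" using n0(1) \<open>\<sigma> > 0\<close> unfolding cell[symmetric] by (simp add: field_simps)
        then have "1 / (real n0 * \<sigma>) \<le> 1 / x powr \<kappa>" using x \<open>\<sigma> > 0\<close> n0(3) by (intro divide_left_mono) auto
        then show "1 / (real n0 * \<sigma>) \<le> x powr (- \<kappa>)" by (simp add: powr_minus_divide)
      qed (simp add: w_def d_def)
      finally have "(sqrt 2 * (sqrt (real CARD('d)) * (1 / real n0)) / \<sigma>) ^ n \<le> (w * x powr (- \<kappa>)) ^ n"
        using \<open>\<sigma> > 0\<close> by (intro power_mono) auto
      also have "\<dots> = w ^ n * x powr (- (\<kappa> * real n))"
        using x by (simp add: power_mult_distrib powr_power mult.commute)
      also have "\<dots> \<le> w ^ n * x powr (- 3 / 2)"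
        using x \<kappa>n by (intro mult_left_mono powr_mono) (auto simp: w_def d_def)
      finally have "R * (sqrt 2 * (sqrt (real CARD('d)) * (1 / real n0)) / \<sigma>) ^ n \<le> R * (w ^ n * x powr (- 3 / 2))"
        using \<open>R \<ge> 0\<close> by (rule mult_left_mono)
      also have "\<dots> = sqrt (A + 1) * w ^ n * (x powr (1 / 2) * x powr (- 3 / 2))"
        using x by (simp add: R_def powr_half_sqrt)
      also have "x powr (1 / 2) * x powr (- 3 / 2) = 1 / x"
        unfolding powr_add[symmetric] using x by (simp add: powr_minus_divide)
      finally show ?thesis by (simp add: c1_def add_divide_distrib)
    qed
    have "real (card N) \<le> exp (c3 * x powr (\<nu> + d / b))"
    proof -
      define k where "k = (n0 + 1) ^ CARD('d) * S"
      have "2 * R / (1 / x) + 3 = 2 * sqrt (A + 1) * (x powr (1 / 2) * x powr 1) + 3"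
        using x by (simp add: R_def powr_half_sqrt)
      also have "x powr (1 / 2) * x powr 1 = x powr (3 / 2)" unfolding powr_add[symmetric] by simp
      also have "2 * sqrt (A + 1) * x powr (3 / 2) + 3 \<le> B * x powr (3 / 2)"
        using ge_one_powr_ge_zero[OF x, of "3 / 2"] by (simp add: B_def distrib_right)
      finally have base: "2 * R / (1 / x) + 3 \<le> B * x powr (3 / 2)" .
      have "real (card N) \<le> (2 * R / (1 / x) + 3) ^ k" using N(4) by (simp add: k_def)
      also have "\<dots> \<le> (B * x powr (3 / 2)) ^ k"
        using base \<open>R \<ge> 0\<close> x by (intro power_mono) auto
      also have "\<dots> = exp (real k * ln (B * x powr (3 / 2)))"
        using \<open>B \<ge> 3\<close> x by (simp add: exp_of_nat_mult)
      also have "\<dots> \<le> exp (c3 * x powr (\<nu> + d / b))"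
      proof -
        have "ln (B * x powr (3 / 2)) = ln B + 3 / 2 * ln x"
          using \<open>B \<ge> 3\<close> x by (simp add: ln_mult ln_powr)
        also have "\<dots> \<le> ln B * x powr \<kappa> + 3 / 2 * (x powr \<kappa> / \<kappa>)"
          using ln_powr_bound[OF x \<open>\<kappa> > 0\<close>] ge_one_powr_ge_zero[OF x, of \<kappa>] \<open>\<kappa> > 0\<close> \<open>ln B \<ge> 0\<close>
            mult_left_mono[of 1 "x powr \<kappa>" "ln B"]
          by (intro add_mono mult_left_mono) auto
        also have "\<dots> = c2 * x powr \<kappa>" by (simp add: c2_def distrib_right)
        finally have l: "ln (B * x powr (3 / 2)) \<le> c2 * x powr \<kappa>" .
        have "real k = (real n0 + 1) ^ CARD('d) * real S" by (simp add: k_def add.commute)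
        also have "\<dots> \<le> (3 * x powr (\<kappa> + 1 / b)) ^ CARD('d) * real S"
          using n0 by (intro mult_right_mono power_mono) auto
        also have "\<dots> = 3 ^ CARD('d) * real S * x powr ((\<kappa> + 1 / b) * d)"
          using x by (simp add: power_mult_distrib powr_power d_def mult.commute)
        finally have k: "real k \<le> 3 ^ CARD('d) * real S * x powr ((\<kappa> + 1 / b) * d)" .
        have "real k * ln (B * x powr (3 / 2)) \<le> real k * (c2 * x powr \<kappa>)"
          using l by (rule mult_left_mono) simp
        also have "\<dots> \<le> (3 ^ CARD('d) * real S * x powr ((\<kappa> + 1 / b) * d)) * (c2 * x powr \<kappa>)"
          using k \<open>c2 > 0\<close> by (intro mult_right_mono) auto
        also have "\<dots> = 3 ^ CARD('d) * real S * c2 * (x powr ((\<kappa> + 1 / b) * d) * x powr \<kappa>)" by simp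
        also have "x powr ((\<kappa> + 1 / b) * d) * x powr \<kappa> = x powr (\<nu> + d / b)"
          unfolding powr_add[symmetric] \<kappa>\<nu>[symmetric] by (simp add: algebra_simps)
        also have "3 ^ CARD('d) * real S * c2 * x powr (\<nu> + d / b) \<le> c3 * x powr (\<nu> + d / b)"
          by (intro mult_right_mono) (auto simp: c3_def)
        finally show ?thesis by simp
      qed
      finally show ?thesis .
    qed
    moreover have "\<exists>q\<in>N. \<forall>y\<in>unit_cube. \<bar>clip (f y) - q y\<bar> \<le> c1 / x"
      if "in_rkhs \<sigma> f" "rkhs_norm2 \<sigma> f \<le> x * A" for f
    proof -
      have "rkhs_norm2 \<sigma> f < R\<^sup>2" using that x unfolding R2 by (simp add: algebra_simps)
      from N(5)[OF that(1) this] show ?thesis using err by (meson order.trans)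
    qed
    ultimately show ?thesis
      using N(1-3) unfolding \<sigma>_def x_def by (intro exI[of _ N]) auto
  qed
  then show ?thesis unfolding b_def using \<open>c1 > 0\<close> \<open>c3 > 0\<close> by blast
qed

context excess_risk
begin

text \<open>Two competitors in the minimisation: the combination L gives the first bound, after
  clipping f and subtracting the losses of ts, and the zero function gives the second, which
  confines f to the ball covered by the net.\<close>

lemma minimizer_empirical_gap:
  fixes D :: "nat \<Rightarrow> (real^'d) \<times> real" and f :: "real^'d \<Rightarrow> real" and m :: nat
  assumes min: "is_reg_minimizer \<phi> \<sigma> (1 / real m) m D f" and "m \<ge> 1"
    and D: "\<And>i. i < m \<Longrightarrow> fst (D i) \<in> unit_cube \<and> snd (D i) \<in> {- 1, 1}"
    and L: "\<forall>p\<in>set L. snd p \<in> unit_cube"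
  defines "g \<equiv> \<lambda>x. if x \<in> unit_cube then kcomb_eval \<sigma> L x else 0"
  shows "1 / real m * (\<Sum>i<m. loss_gap (\<lambda>x. clip (f x)) (D i))
      \<le> 1 / real m * (\<Sum>i<m. loss_gap g (D i)) + kcomb_norm2 \<sigma> L / real m"
    and "rkhs_norm2 \<sigma> f \<le> real m * \<phi> 0"
proof -
  have f: "in_rkhs \<sigma> f" and opt: "\<And>h. in_rkhs \<sigma> h \<Longrightarrow> reg_objective \<phi> \<sigma> (1 / real m) m D f \<le> reg_objective \<phi> \<sigma> (1 / real m) m D h"
    using min unfolding is_reg_minimizer_def by auto
  have nf: "rkhs_norm2 \<sigma> f \<ge> 0" by (rule rkhs_norm2_nonneg[OF f])
  note kc = kcomb_in_rkhs[OF L, of \<sigma>, folded g_def]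
  define S where "S h = (\<Sum>i<m. \<phi> (snd (D i) * h (fst (D i))))" for h :: "real^'d \<Rightarrow> real"
  have "1 / real m * S f + 1 / real m * rkhs_norm2 \<sigma> f \<le> 1 / real m * S g + 1 / real m * rkhs_norm2 \<sigma> g"
    using opt[OF kc(1)] by (simp add: reg_objective_def S_def)
  moreover have "1 / real m * rkhs_norm2 \<sigma> g \<le> 1 / real m * kcomb_norm2 \<sigma> L"
    using kc(2) by (intro mult_left_mono) auto
  moreover have "1 / real m * rkhs_norm2 \<sigma> f \<ge> 0" using nf by simp
  ultimately have Sfg: "1 / real m * S f \<le> 1 / real m * S g + kcomb_norm2 \<sigma> L / real m" by simp
  have clip_mult: "y * clip u = clip (y * u)" if "y \<in> {- 1, 1}" for y u
    using that by (auto simp: clip_def)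
  have "(\<Sum>i<m. loss_gap (\<lambda>x. clip (f x)) (D i)) \<le> S f - S ts"
    unfolding S_def sum_subtractf[symmetric]
  proof (rule sum_mono)
    fix i assume "i \<in> {..<m}"
    then have i: "fst (D i) \<in> unit_cube" "snd (D i) \<in> {- 1, 1}" using D[of i] by auto
    show "loss_gap (\<lambda>x. clip (f x)) (D i) \<le> \<phi> (snd (D i) * f (fst (D i))) - \<phi> (snd (D i) * ts (fst (D i)))"
      unfolding loss_gap_eq[OF i] clip_mult[OF i(2)] using loss_basic(3)[OF loss] by simp
  qed
  then have "1 / real m * (\<Sum>i<m. loss_gap (\<lambda>x. clip (f x)) (D i)) \<le> 1 / real m * S f - 1 / real m * S ts"
    unfolding right_diff_distrib[symmetric] by (intro mult_left_mono) auto
  moreover have "(\<Sum>i<m. loss_gap g (D i)) = S g - S ts"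
    unfolding S_def sum_subtractf[symmetric] by (intro sum.cong refl loss_gap_eq) (use D in auto)
  ultimately show "1 / real m * (\<Sum>i<m. loss_gap (\<lambda>x. clip (f x)) (D i))
      \<le> 1 / real m * (\<Sum>i<m. loss_gap g (D i)) + kcomb_norm2 \<sigma> L / real m"
    using Sfg by (simp add: right_diff_distrib diff_divide_distrib)
  define z where "z = (\<lambda>x :: real^'d. 0 :: real)"
  have "(\<lambda>x. if x \<in> unit_cube then kcomb_eval \<sigma> [] x else 0) = z" by (auto simp: z_def fun_eq_iff)
  then have z: "in_rkhs \<sigma> z" "rkhs_norm2 \<sigma> z \<le> 0"
    using kcomb_in_rkhs[of "[] :: (real \<times> (real^'d)) list" \<sigma>] by (simp_all add: kcomb_norm2_def)
  have "1 / real m * S f + 1 / real m * rkhs_norm2 \<sigma> f \<le> 1 / real m * S z + 1 / real m * rkhs_norm2 \<sigma> z"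
    using opt[OF z(1)] by (simp add: reg_objective_def S_def)
  moreover have "1 / real m * rkhs_norm2 \<sigma> z \<le> 0" using z(2) by (simp add: divide_nonpos_nonneg)
  moreover have "1 / real m * S z = \<phi> 0" using \<open>m \<ge> 1\<close> by (simp add: S_def z_def)
  moreover have "1 / real m * S f \<ge> 0"
    unfolding S_def by (intro mult_nonneg_nonneg sum_nonneg loss_basic(1)[OF loss]) auto
  ultimately have "1 / real m * rkhs_norm2 \<sigma> f \<le> \<phi> 0" by linarith
  then show "rkhs_norm2 \<sigma> f \<le> real m * \<phi> 0" using \<open>m \<ge> 1\<close> by (simp add: field_simps)
qed

text \<open>The event involves only the net, g and the sample, so it is measurable however the
  minimiser depends on the sample. One half of \<delta> pays for the union over the net, the other
  for g; sample points off the cube or with other labels have probability 0.\<close>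

lemma good_event:
  fixes N :: "(real^'d \<Rightarrow> real) set" and g :: "real^'d \<Rightarrow> real" and m :: nat and s T \<delta> :: real
  assumes N: "finite N" "\<And>q. q \<in> N \<Longrightarrow> q \<in> borel_measurable borel" "\<And>q x. q \<in> N \<Longrightarrow> \<bar>q x\<bar> \<le> M"
    and g [measurable]: "g \<in> borel_measurable borel" and gM: "\<And>x. \<bar>g x\<bar> \<le> M"
    and m: "m \<ge> 1" and s: "s > 0" "s * (2 * \<Lambda> * M) \<le> 1" "s * V \<le> 1 / 2"
    and T: "real (card N) * exp (- T) \<le> \<delta> / 2" "exp (- T) \<le> \<delta> / 2"
  defines "P \<equiv> PiM {..<m} (\<lambda>_. \<rho>)" and "\<tau> \<equiv> (if p = 1 then s * V else 0)"
  shows "\<exists>A\<in>sets P. measure P A \<ge> 1 - \<delta> \<and> (\<forall>D\<in>A.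
     (\<forall>i<m. fst (D i) \<in> unit_cube \<and> snd (D i) \<in> {- 1, 1}) \<and>
     (\<forall>q\<in>N. excess q / 2 - 1 / real m * (\<Sum>i<m. loss_gap q (D i)) \<le> T / (s * real m) + \<tau>) \<and>
     1 / real m * (\<Sum>i<m. loss_gap g (D i)) \<le> 3 / 2 * excess g + T / (s * real m) + \<tau>)"
proof -
  interpret P: prob_space P unfolding P_def by (intro prob_space_PiM) unfold_locales
  define good where "good D \<longleftrightarrow> (\<forall>i<m. fst (D i) \<in> unit_cube \<and> snd (D i) \<in> {- 1, 1})"
    for D :: "nat \<Rightarrow> (real^'d) \<times> real"
  define low where "low q = {D \<in> space P. \<not> excess q / 2 - 1 / real m * (\<Sum>i<m. loss_gap q (D i)) \<le> T / (s * real m) + \<tau>}" for q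
  define up where "up = {D \<in> space P. \<not> 1 / real m * (\<Sum>i<m. loss_gap g (D i)) \<le> 3 / 2 * excess g + T / (s * real m) + \<tau>}"
  define bad where "bad = {D \<in> space P. \<not> good D}"
  have sumP: "(\<lambda>D. \<Sum>i<m. loss_gap t (D i)) \<in> borel_measurable P"
    if "t \<in> borel_measurable borel" "\<And>x. \<bar>t x\<bar> \<le> M" for t
  proof -
    have [measurable]: "loss_gap t \<in> borel_measurable \<rho>" by (rule loss_gap_measurable) (use that in auto)
    show ?thesis unfolding P_def by measurable
  qed
  have lowS: "low q \<in> sets P" if "q \<in> N" for q
  proof -
    have [measurable]: "(\<lambda>D. \<Sum>i<m. loss_gap q (D i)) \<in> borel_measurable P" by (rule sumP) (use N that in auto)
    show ?thesis unfolding low_def by measurable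
  qed
  have upS: "up \<in> sets P"
  proof -
    have [measurable]: "(\<lambda>D. \<Sum>i<m. loss_gap g (D i)) \<in> borel_measurable P" by (rule sumP) (use gM in auto)
    show ?thesis unfolding up_def by measurable
  qed
  have [measurable]: "Measurable.pred \<rho> (\<lambda>z. fst z \<in> unit_cube \<and> snd z \<in> {- 1, 1})" by measurable
  have "Measurable.pred P good" unfolding good_def P_def by measurable
  then have badS: "bad \<in> sets P" unfolding bad_def by measurable
  have "AE D in P. good D"
    unfolding good_def P_def
  proof (subst AE_all_countable, intro allI)
    fix i
    show "AE D in PiM {..<m} (\<lambda>_. \<rho>). i < m \<longrightarrow> fst (D i) \<in> unit_cube \<and> snd (D i) \<in> {- 1, 1}"
    proof (cases "i < m")
      case True
      have "AE D in PiM {..<m} (\<lambda>_. \<rho>). fst (D i) \<in> unit_cube \<and> snd (D i) \<in> {- 1, 1}"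
        by (rule AE_PiM_component[where P="\<lambda>z. fst z \<in> unit_cube \<and> snd z \<in> {- 1, 1}"])
          (use True supp prob_space_axioms in auto)
      then show ?thesis by (rule AE_mp) simp
    qed simp
  qed
  then have bad0: "measure P bad = 0"
    unfolding bad_def by (intro P.prob_eq_0_AE) (auto elim: AE_mp)
  define B where "B = (\<Union>q\<in>N. low q) \<union> up \<union> bad"
  have lowN: "(\<Union>q\<in>N. low q) \<in> sets P" using N(1) lowS by (intro sets.finite_UN) auto
  have BS: "B \<in> sets P" unfolding B_def by (intro sets.Un lowN upS badS)
  have "measure P B \<le> measure P ((\<Union>q\<in>N. low q) \<union> up) + measure P bad"
    unfolding B_def by (intro measure_Un_le sets.Un lowN upS badS)
  also have "measure P ((\<Union>q\<in>N. low q) \<union> up) \<le> measure P (\<Union>q\<in>N. low q) + measure P up"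
    by (intro measure_Un_le lowN upS)
  also have "measure P (\<Union>q\<in>N. low q) \<le> (\<Sum>q\<in>N. measure P (low q))"
    using N(1) lowS by (intro P.finite_measure_subadditive_finite) auto
  also have "\<dots> \<le> (\<Sum>q\<in>N. exp (- T))"
  proof (rule sum_mono)
    fix q assume "q \<in> N"
    then show "measure P (low q) \<le> exp (- T)"
      unfolding low_def P_def \<tau>_def using N by (intro excess_deviation(1) m s) auto
  qed
  also have "\<dots> = real (card N) * exp (- T)" by simp
  also have "measure P up \<le> exp (- T)"
    unfolding up_def P_def \<tau>_def using gM by (intro excess_deviation(2) m s) auto
  finally have "measure P B \<le> \<delta>" using T bad0 by simp
  then have "measure P (space P - B) \<ge> 1 - \<delta>" using BS by (simp add: P.prob_compl)
  moreover have "space P - B \<in> sets P" using BS by auto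
  moreover have "\<forall>D\<in>space P - B.
     (\<forall>i<m. fst (D i) \<in> unit_cube \<and> snd (D i) \<in> {- 1, 1}) \<and>
     (\<forall>q\<in>N. excess q / 2 - 1 / real m * (\<Sum>i<m. loss_gap q (D i)) \<le> T / (s * real m) + \<tau>) \<and>
     1 / real m * (\<Sum>i<m. loss_gap g (D i)) \<le> 3 / 2 * excess g + T / (s * real m) + \<tau>"
  proof
    fix D assume "D \<in> space P - B"
    then have "D \<in> space P" "D \<notin> bad" "D \<notin> up" "\<And>q. q \<in> N \<Longrightarrow> D \<notin> low q" by (auto simp: B_def)
    then show "(\<forall>i<m. fst (D i) \<in> unit_cube \<and> snd (D i) \<in> {- 1, 1}) \<and>
     (\<forall>q\<in>N. excess q / 2 - 1 / real m * (\<Sum>i<m. loss_gap q (D i)) \<le> T / (s * real m) + \<tau>) \<and>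
     1 / real m * (\<Sum>i<m. loss_gap g (D i)) \<le> 3 / 2 * excess g + T / (s * real m) + \<tau>"
      unfolding bad_def up_def low_def good_def by blast
  qed
  ultimately show ?thesis by blast
qed

end

theorem theorem1:
  fixes \<rho> :: "((real^'d) \<times> real) measure"
    and \<eta> :: "real^'d \<Rightarrow> real"
    and \<phi> :: "real \<Rightarrow> real"
    and f\<rho> :: "real^'d \<Rightarrow> real"
    and r c0 \<nu> :: real
  assumes "prob_space \<rho>"
    and "sets \<rho> = sets borel"
    and "AE z in \<rho>. fst z \<in> unit_cube \<and> snd z \<in> {-1, 1}"
    and "\<eta> \<in> borel_measurable borel"
    and "\<forall>x. 0 \<le> \<eta> x \<and> \<eta> x \<le> 1"
    and "\<forall>A\<in>sets borel. measure \<rho> (A \<times> {1}) = (\<integral>x. indicator A x * \<eta> x \<partial>(distr \<rho> borel fst))"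
    and "\<phi> = hinge_loss \<or> twice_smooth_classifying_loss \<phi>"
    and "\<forall>x\<in>unit_cube. \<forall>t. cond_phi_risk \<phi> (\<eta> x) (f\<rho> x) \<le> cond_phi_risk \<phi> (\<eta> x) t"
    and "r > 0" and "c0 > 0"
    and "lip_class r c0 f\<rho>"
    and "0 < \<nu>" and "\<nu> < r / (2 * r + real CARD('d))"
  shows "\<exists>C>0. \<forall>m::nat. m \<ge> 1 \<longrightarrow> (\<forall>\<delta>. 0 < \<delta> \<and> \<delta> < 1 \<longrightarrow>
           (\<exists>A\<in>sets (PiM {..<m} (\<lambda>_. \<rho>)).
              measure (PiM {..<m} (\<lambda>_. \<rho>)) A \<ge> 1 - \<delta> \<and>
              (\<forall>D\<in>A. \<forall>f. is_reg_minimizer \<phi> (real m powr (- 1 / (2 * r + real CARD('d)))) (1 / real m) m D f \<longrightarrow>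
                 misclass_risk \<rho> (sign_clf f) - misclass_risk \<rho> (bayes_rule \<eta>)
                   \<le> C * real m powr (- r / (2 * r + real CARD('d)) + \<nu>) * ln (4 / \<delta>))))"
proof -
  define d b \<beta> where "d = real CARD('d)" and "b = 2 * r + d" and "\<beta> = r / b"
  have "d \<ge> 1" by (simp add: d_def Suc_leI)
  then have "b > 0" using \<open>r > 0\<close> by (simp add: b_def)
  have \<beta>: "\<beta> > 0" "2 * \<beta> < 1" "d / b = 1 - 2 * \<beta>"
    using \<open>r > 0\<close> \<open>b > 0\<close> \<open>d \<ge> 1\<close> by (auto simp: \<beta>_def b_def field_simps)
  interpret labelled_sample \<rho> \<eta>
    using assms(1-6) by (intro labelled_sample.intro labelled_sample_axioms.intro)
  have cont: "continuous_on unit_cube f\<rho>" by (rule lip_class_rkhs_approx(1)[OF assms(11,9,10)])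
  obtain K where "K > 0" and K: "\<And>\<sigma>. 0 < \<sigma> \<Longrightarrow> \<sigma> \<le> 1 \<Longrightarrow> \<exists>L. (\<forall>p\<in>set L. snd p \<in> unit_cube) \<and>
    kcomb_norm2 \<sigma> L \<le> K / \<sigma> ^ CARD('d) \<and> (\<forall>x\<in>unit_cube. \<bar>kcomb_eval \<sigma> L x - f\<rho> x\<bar> \<le> K * \<sigma> powr r)"
    using lip_class_rkhs_approx(2)[OF assms(11,9,10)] by blast
  \<comment> \<open>\<open>f\<rho>\<close> is prescribed only on the cube; the cut-off is measurable
    and bounded on the whole space and still minimises on the cube.\<close>
  define ts where "ts x = indicator unit_cube x *\<^sub>R f\<rho> x" for x
  have ts_meas: "ts \<in> borel_measurable borel"
    unfolding ts_def using cont by (intro borel_measurable_continuous_on_indicator) auto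
  have "bounded (f\<rho> ` unit_cube)"
    using cont compact_unit_cube by (intro compact_imp_bounded compact_continuous_image)
  then obtain B where B: "\<And>x. x \<in> unit_cube \<Longrightarrow> \<bar>f\<rho> x\<bar> \<le> B" unfolding bounded_iff by auto
  have tsB: "\<bar>ts x\<bar> \<le> \<bar>B\<bar>" for x
    using B[of x] by (cases "x \<in> unit_cube") (auto simp: ts_def)
  \<comment> \<open>A bound for ts, for the comparison function at distance at most K from it, and
    for functions with values in [-1, 1].\<close>
  define M where "M = \<bar>B\<bar> + K + 1"
  have "M \<ge> 1" using \<open>K > 0\<close> by (simp add: M_def)
  obtain p where p: "p = 1 \<or> p = 2"
    and "\<exists>\<Lambda>>0. \<exists>U>0. \<exists>V>0. loss_bounds \<phi> p M \<Lambda> U V"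
    using loss_bounds_exist[OF assms(7)] \<open>M \<ge> 1\<close> by metis
  then obtain \<Lambda> U V where pos: "\<Lambda> > 0" "U > 0" "V > 0" and lb: "loss_bounds \<phi> p M \<Lambda> U V" by blast
  interpret excess_risk \<rho> \<eta> \<phi> ts p M \<Lambda> U V
  proof
    show "\<bar>ts x\<bar> \<le> M" for x using tsB[of x] \<open>K > 0\<close> by (simp add: M_def)
    show "cond_phi_risk \<phi> (\<eta> x) (ts x) \<le> cond_phi_risk \<phi> (\<eta> x) t" if "x \<in> unit_cube" for x t
      using assms(8) that by (simp add: ts_def)
  qed (use assms(7) p lb pos \<open>M \<ge> 1\<close> ts_meas in auto)
  have "\<phi> 0 \<ge> 0" using loss_basic(1)[OF assms(7)] .
  obtain c1 c3 where "c1 > 0" "c3 > 0" and net: "\<And>m::nat. m \<ge> 1 \<Longrightarrow> \<exists>N :: (real^'d \<Rightarrow> real) set. finite N \<and>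
     (\<forall>q\<in>N. q \<in> borel_measurable borel \<and> (\<forall>x. \<bar>q x\<bar> \<le> 1)) \<and>
     real (card N) \<le> exp (c3 * real m powr (\<nu> + d / b)) \<and>
     (\<forall>f. in_rkhs (real m powr (- 1 / b)) f \<and> rkhs_norm2 (real m powr (- 1 / b)) f \<le> real m * \<phi> 0 \<longrightarrow>
        (\<exists>q\<in>N. \<forall>x\<in>unit_cube. \<bar>clip (f x) - q x\<bar> \<le> c1 / real m))"
    using rkhs_net_rate[OF \<open>r > 0\<close> \<open>0 < \<nu>\<close> \<open>\<phi> 0 \<ge> 0\<close>, where 'd='d] unfolding b_def d_def by blast
  \<comment> \<open>The denominator makes both conditions on s in \<open>excess_deviation\<close>
    hold for every positive s up to s0.\<close>
  define s0 where "s0 = 1 / (2 * \<Lambda> * M + 2 * V)"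
  have den: "2 * \<Lambda> * M + 2 * V > 0" using pos \<open>M \<ge> 1\<close> by (simp add: add_pos_pos)
  then have "s0 > 0" by (simp add: s0_def)
  have s0: "s0 * (2 * \<Lambda> * M) \<le> 1" "s0 * V \<le> 1 / 2"
    using den pos \<open>M \<ge> 1\<close> by (auto simp: s0_def field_simps)
  define c4 c5 where "c4 = (c3 + 1) / s0" and "c5 = s0 * V"
  have "c4 > 0" "c5 > 0" using \<open>s0 > 0\<close> \<open>c3 > 0\<close> pos by (auto simp: c4_def c5_def)
  \<comment> \<open>Constants of the final chain of estimates. Passing between h and q costs
    \<open>\<Lambda> * c1 / m\<close> once in the excess and once on the sample; the latter is
    doubled because the lower deviation bounds only half of the excess. The same doubling turns 1, 3
    / 2 and the pairs of deviation terms into 2, 3 and 4.\<close>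
  define c6 where "c6 = 3 * (\<Lambda> * c1) + 2 * K + 3 * (U * K ^ p) + 4 * c4 + 4 * c5"
  have "c6 > 0" unfolding c6_def using pos \<open>c1 > 0\<close> \<open>K > 0\<close> \<open>c4 > 0\<close> \<open>c5 > 0\<close> by (intro add_pos_pos) auto
  \<comment> \<open>The added 1 ensures C >= 1, so that U * c6 <= C ^ 2 and the square root can be
    taken for p = 2.\<close>
  define C where "C = U * c6 + 1"
  have "C > 0" using pos \<open>c6 > 0\<close> by (simp add: C_def add_pos_pos)
  have main: "\<exists>A\<in>sets (PiM {..<m} (\<lambda>_. \<rho>)).
              measure (PiM {..<m} (\<lambda>_. \<rho>)) A \<ge> 1 - \<delta> \<and>
              (\<forall>D\<in>A. \<forall>f. is_reg_minimizer \<phi> (real m powr (- 1 / b)) (1 / real m) m D f \<longrightarrow>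
                 misclass_risk \<rho> (sign_clf f) - misclass_risk \<rho> (bayes_rule \<eta>)
                   \<le> C * real m powr (- r / b + \<nu>) * ln (4 / \<delta>))"
    if m: "m \<ge> 1" and \<delta>: "0 < \<delta>" "\<delta> < 1" for m :: nat and \<delta>
  proof -
    define x where "x = real m"
    have x: "x \<ge> 1" using m by (simp add: x_def)
    define \<sigma> where "\<sigma> = x powr (- 1 / b)"
    have \<sigma>: "\<sigma> > 0" "\<sigma> \<le> 1"
      using x \<open>b > 0\<close> powr_mono[of "- 1 / b" 0 x] by (auto simp: \<sigma>_def)
    have \<sigma>r: "\<sigma> powr r = x powr (- \<beta>)" by (simp add: \<sigma>_def powr_powr \<beta>_def)
    have \<sigma>d: "1 / \<sigma> ^ CARD('d) = x powr (1 - 2 * \<beta>)"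
    proof -
      have "\<sigma> ^ CARD('d) = x powr (- (d / b))"
        using x by (simp add: \<sigma>_def powr_power d_def)
      then have "1 / \<sigma> ^ CARD('d) = x powr (d / b)" by (simp only: powr_minus_divide) simp
      then show ?thesis by (simp only: \<beta>(3))
    qed
    obtain L where L: "\<forall>p\<in>set L. snd p \<in> unit_cube" "kcomb_norm2 \<sigma> L \<le> K / \<sigma> ^ CARD('d)"
      "\<And>y. y \<in> unit_cube \<Longrightarrow> \<bar>kcomb_eval \<sigma> L y - f\<rho> y\<bar> \<le> K * \<sigma> powr r"
      using K[OF \<sigma>] by blast
    define g where "g y = (if y \<in> unit_cube then kcomb_eval \<sigma> L y else 0)" for y
    have g_meas: "g \<in> borel_measurable borel" unfolding g_def by measurable
    have g_close: "\<bar>g y - ts y\<bar> \<le> K * \<sigma> powr r" if "y \<in> unit_cube" for y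
      using L(3)[OF that] that by (simp add: g_def ts_def)
    have "\<sigma> powr r \<le> 1" using \<sigma> \<open>r > 0\<close> powr_mono2[of r \<sigma> 1] by simp
    then have K_le: "K * \<sigma> powr r \<le> K" using \<open>K > 0\<close> by simp
    have gM: "\<bar>g y\<bar> \<le> M" for y
    proof (cases "y \<in> unit_cube")
      case True
      then show ?thesis using g_close[OF True] tsB[of y] K_le unfolding M_def by linarith
    qed (use \<open>M \<ge> 1\<close> in \<open>simp add: g_def\<close>)
    obtain N :: "(real^'d \<Rightarrow> real) set" where N0: "finite N"
      "\<forall>q\<in>N. q \<in> borel_measurable borel \<and> (\<forall>y. \<bar>q y\<bar> \<le> 1)"
      "real (card N) \<le> exp (c3 * x powr (\<nu> + d / b))"
      "\<forall>f. in_rkhs \<sigma> f \<and> rkhs_norm2 \<sigma> f \<le> x * \<phi> 0 \<longrightarrow> (\<exists>q\<in>N. \<forall>y\<in>unit_cube. \<bar>clip (f y) - q y\<bar> \<le> c1 / x)"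
      using net[OF m] unfolding x_def[symmetric] \<sigma>_def[symmetric] by (elim exE conjE) (rule that)
    have N: "finite N" "\<And>q. q \<in> N \<Longrightarrow> q \<in> borel_measurable borel" "\<And>q y. q \<in> N \<Longrightarrow> \<bar>q y\<bar> \<le> 1"
      "real (card N) \<le> exp (c3 * x powr (\<nu> + d / b))"
      "\<And>f. in_rkhs \<sigma> f \<Longrightarrow> rkhs_norm2 \<sigma> f \<le> x * \<phi> 0 \<Longrightarrow> \<exists>q\<in>N. \<forall>y\<in>unit_cube. \<bar>clip (f y) - q y\<bar> \<le> c1 / x"
      using N0 by auto
    have NM: "\<bar>q y\<bar> \<le> M" if "q \<in> N" for q y using N(3)[OF that, of y] \<open>M \<ge> 1\<close> by simp
    \<comment> \<open>For p = 2 the parameter is constant. For p = 1 it is of order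
      \<open>x powr (- \<beta>)\<close>, which balances T / (s * m) against s * V up to the factor
      \<open>x powr \<nu>\<close> and the logarithm of 1 / \<delta>.\<close>
    define s where "s = s0 * x powr (- ((2 - real p) * \<beta>))"
    have "s > 0" using \<open>s0 > 0\<close> x by (simp add: s_def)
    have "x powr (- ((2 - real p) * \<beta>)) \<le> x powr 0" using x p \<beta>(1) by (intro powr_mono) auto
    then have "s \<le> s0" using \<open>s0 > 0\<close> x by (simp add: s_def)
    have "s * (2 * \<Lambda> * M) \<le> s0 * (2 * \<Lambda> * M)" "s * V \<le> s0 * V"
      using \<open>s \<le> s0\<close> pos \<open>M \<ge> 1\<close> by (auto intro!: mult_right_mono)
    then have s: "s * (2 * \<Lambda> * M) \<le> 1" "s * V \<le> 1 / 2" using s0 by linarith+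
    \<comment> \<open>The first term pays for the size of the net, the second leaves \<delta> / 2
      each for the net and for g.\<close>
    define T where "T = c3 * x powr (\<nu> + d / b) + ln (2 / \<delta>)"
    define \<tau> where "\<tau> = (if p = 1 then s * V else 0)"
    have exp_ln: "exp (- ln (2 / \<delta>)) = \<delta> / 2" using \<delta> by (simp add: exp_minus)
    have T1: "real (card N) * exp (- T) \<le> \<delta> / 2"
    proof -
      have "real (card N) * exp (- T) \<le> exp (c3 * x powr (\<nu> + d / b)) * exp (- T)"
        using N(4) by (intro mult_right_mono) auto
      also have "\<dots> = exp (- ln (2 / \<delta>))" by (simp add: T_def exp_add[symmetric])
      finally show ?thesis by (simp add: exp_ln)
    qed
    have T2: "exp (- T) \<le> \<delta> / 2"
    proof -
      have "exp (- T) \<le> exp (- ln (2 / \<delta>))" using \<open>c3 > 0\<close> by (simp add: T_def)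
      then show ?thesis by (simp add: exp_ln)
    qed
    have "\<exists>A\<in>sets (PiM {..<m} (\<lambda>_. \<rho>)). measure (PiM {..<m} (\<lambda>_. \<rho>)) A \<ge> 1 - \<delta> \<and>
      (\<forall>D\<in>A. (\<forall>i<m. fst (D i) \<in> unit_cube \<and> snd (D i) \<in> {- 1, 1}) \<and>
        (\<forall>q\<in>N. excess q / 2 - 1 / real m * (\<Sum>i<m. loss_gap q (D i)) \<le> T / (s * real m) + \<tau>) \<and>
        1 / real m * (\<Sum>i<m. loss_gap g (D i)) \<le> 3 / 2 * excess g + T / (s * real m) + \<tau>)"
      unfolding \<tau>_def by (intro good_event N(1,2) NM g_meas gM m \<open>s > 0\<close> s T1 T2)
    then obtain A where A: "A \<in> sets (PiM {..<m} (\<lambda>_. \<rho>))" "measure (PiM {..<m} (\<lambda>_. \<rho>)) A \<ge> 1 - \<delta>"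
      and ev: "(\<forall>D\<in>A. (\<forall>i<m. fst (D i) \<in> unit_cube \<and> snd (D i) \<in> {- 1, 1}) \<and>
        (\<forall>q\<in>N. excess q / 2 - 1 / real m * (\<Sum>i<m. loss_gap q (D i)) \<le> T / (s * real m) + \<tau>) \<and>
        1 / real m * (\<Sum>i<m. loss_gap g (D i)) \<le> 3 / 2 * excess g + T / (s * real m) + \<tau>)"
      by (elim bexE conjE) (rule that)
    have good: "\<And>i. i < m \<Longrightarrow> fst (D i) \<in> unit_cube \<and> snd (D i) \<in> {- 1, 1}"
      and low: "\<And>q. q \<in> N \<Longrightarrow> excess q / 2 - 1 / real m * (\<Sum>i<m. loss_gap q (D i)) \<le> T / (s * real m) + \<tau>"
      and up: "1 / real m * (\<Sum>i<m. loss_gap g (D i)) \<le> 3 / 2 * excess g + T / (s * real m) + \<tau>"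
      if "D \<in> A" for D
      using bspec[OF ev that] by simp_all
    define \<l> where "\<l> = ln (4 / \<delta>)"
    \<comment> \<open>The 4 in the logarithm keeps it at least 1 for all \<delta> < 1, so it can be
      multiplied onto terms that do not contain it.\<close>
    have "\<l> \<ge> 1"
    proof -
      have "exp 1 \<le> (4 :: real)" using exp_le by simp
      also have "\<dots> \<le> 4 / \<delta>" using \<delta> by (simp add: field_simps)
      finally show ?thesis unfolding \<l>_def using \<delta> by (simp add: ln_ge_iff)
    qed
    \<comment> \<open>Common scale of all error terms, for the p-th power of the excess
      misclassification risk.\<close>
    define \<theta> where "\<theta> = x powr (\<nu> - real p * \<beta>) * \<l>"
    have "\<theta> \<ge> 0" using \<open>\<l> \<ge> 1\<close> by (simp add: \<theta>_def)
    have le_\<theta>: "x powr a \<le> \<theta>" if "a \<le> \<nu> - real p * \<beta>" for a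
    proof -
      have "x powr a \<le> x powr (\<nu> - real p * \<beta>) * 1" using x that by (simp add: powr_mono)
      also have "\<dots> \<le> \<theta>" unfolding \<theta>_def using \<open>\<l> \<ge> 1\<close> by (intro mult_left_mono) auto
      finally show ?thesis .
    qed
    have p\<beta>: "real p * \<beta> \<le> 2 * \<beta>" using p \<beta>(1) by auto
    have b1: "T / (s * real m) \<le> c4 * \<theta>"
    proof -
      have "ln (2 / \<delta>) \<le> \<l>" unfolding \<l>_def using \<delta> by (simp add: divide_right_mono)
      also have "\<dots> \<le> x powr (\<nu> + d / b) * \<l>"
        using ge_one_powr_ge_zero[OF x, of "\<nu> + d / b"] \<open>0 < \<nu>\<close> \<open>b > 0\<close> \<open>d \<ge> 1\<close> \<open>\<l> \<ge> 1\<close> by (simp add: mult_le_cancel_right1)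
      finally have "T \<le> c3 * (x powr (\<nu> + d / b) * 1) + x powr (\<nu> + d / b) * \<l>" by (simp add: T_def)
      also have "\<dots> \<le> c3 * (x powr (\<nu> + d / b) * \<l>) + x powr (\<nu> + d / b) * \<l>"
        using \<open>c3 > 0\<close> \<open>\<l> \<ge> 1\<close> by (intro add_right_mono mult_left_mono) auto
      finally have "T \<le> (c3 + 1) * \<l> * x powr (\<nu> + d / b)" by (simp add: algebra_simps)
      then have "T / (s * x) \<le> (c3 + 1) * \<l> * x powr (\<nu> + d / b) / (s * x)"
        using \<open>s > 0\<close> x by (intro divide_right_mono) auto
      also have "\<dots> = c4 * \<l> * (x powr (\<nu> + d / b) / x powr (1 - (2 - real p) * \<beta>))"
      proof -
        have "s * x = s0 * x powr (1 - (2 - real p) * \<beta>)"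
          using x by (simp add: s_def powr_diff powr_minus_divide)
        then show ?thesis by (simp add: c4_def)
      qed
      also have "x powr (\<nu> + d / b) / x powr (1 - (2 - real p) * \<beta>) = x powr (\<nu> - real p * \<beta>)"
        unfolding powr_diff[symmetric] \<beta>(3) by (simp add: algebra_simps)
      finally show ?thesis by (simp add: \<theta>_def x_def mult_ac)
    qed
    have b2: "\<tau> \<le> c5 * \<theta>"
    proof (cases "p = 1")
      case True
      have "\<tau> = c5 * x powr (- \<beta>)" using True by (simp add: \<tau>_def s_def c5_def)
      also have "\<dots> \<le> c5 * \<theta>" using True \<open>0 < \<nu>\<close> \<open>c5 > 0\<close> by (intro mult_left_mono le_\<theta>) auto
      finally show ?thesis .
    next
      case False
      then show ?thesis using \<open>c5 > 0\<close> \<open>\<theta> \<ge> 0\<close> by (simp add: \<tau>_def)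
    qed
    have b3: "1 / x \<le> \<theta>"
    proof -
      have "1 / x = x powr (- 1)" using x by (simp add: powr_minus_divide)
      also have "\<dots> \<le> \<theta>" using \<open>0 < \<nu>\<close> p\<beta> \<beta>(2) by (intro le_\<theta>) linarith
      finally show ?thesis .
    qed
    \<comment> \<open>With \<lambda> = 1 / m the regularisation cost
      \<open>K / \<sigma> ^ CARD('d) / m\<close> is of order \<open>x powr (- 2 * \<beta>)\<close>,
      the square of the approximation error \<open>\<sigma> powr r\<close>; the choice of \<sigma>
      equates the two.\<close>
    have b4: "kcomb_norm2 \<sigma> L / real m \<le> K * \<theta>"
    proof -
      have "kcomb_norm2 \<sigma> L / x \<le> K / \<sigma> ^ CARD('d) / x" using L(2) x by (intro divide_right_mono) auto
      also have "\<dots> = K * (1 / \<sigma> ^ CARD('d)) / x" by simp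
      also have "\<dots> = K * x powr (- (2 * \<beta>))" unfolding \<sigma>d using x by (simp add: powr_diff powr_minus_divide)
      also have "\<dots> \<le> K * \<theta>" using \<open>K > 0\<close> \<open>0 < \<nu>\<close> p\<beta> by (intro mult_left_mono le_\<theta>) auto
      finally show ?thesis by (simp add: x_def)
    qed
    have b5: "excess g \<le> U * K ^ p * \<theta>"
    proof -
      have "excess g \<le> U * (K * \<sigma> powr r) ^ p"
        using \<open>K > 0\<close> by (intro excess_le_of_close g_meas gM g_close) auto
      also have "\<dots> = U * K ^ p * x powr (- (real p * \<beta>))"
        unfolding \<sigma>r using x by (simp add: power_mult_distrib powr_power mult_ac)
      also have "\<dots> \<le> U * K ^ p * \<theta>"
        using \<open>K > 0\<close> pos \<open>0 < \<nu>\<close> by (intro mult_left_mono le_\<theta>) auto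
      finally show ?thesis .
    qed
    have "misclass_risk \<rho> (sign_clf f) - misclass_risk \<rho> (bayes_rule \<eta>) \<le> C * x powr (- \<beta> + \<nu>) * \<l>"
      if D: "D \<in> A" and f: "is_reg_minimizer \<phi> \<sigma> (1 / real m) m D f" for D f
    proof -
      define h where "h y = clip (f y)" for y
      have fr: "in_rkhs \<sigma> f" using f by (simp add: is_reg_minimizer_def)
      have f_meas [measurable]: "f \<in> borel_measurable borel" by (rule in_rkhs_measurable[OF fr])
      have h_meas: "h \<in> borel_measurable borel" unfolding h_def by measurable
      have hM: "\<bar>h y\<bar> \<le> M" for y unfolding h_def using abs_clip_le[of "f y"] \<open>M \<ge> 1\<close> by linarith
      have emp: "1 / real m * (\<Sum>i<m. loss_gap h (D i)) \<le> 1 / real m * (\<Sum>i<m. loss_gap g (D i)) + kcomb_norm2 \<sigma> L / real m"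
        unfolding h_def g_def by (rule minimizer_empirical_gap(1)[OF f m good[OF D] L(1)])
      have "rkhs_norm2 \<sigma> f \<le> real m * \<phi> 0"
        by (rule minimizer_empirical_gap(2)[OF f m good[OF D] L(1)])
      from N(5)[OF fr this[folded x_def]] obtain q where q: "q \<in> N" and hq: "\<And>y. y \<in> unit_cube \<Longrightarrow> \<bar>h y - q y\<bar> \<le> c1 / x"
        unfolding h_def by blast
      have c1x: "c1 / x \<ge> 0" using \<open>c1 > 0\<close> x by simp
      have e1: "excess h \<le> excess q + \<Lambda> * (c1 / x)"
        using N(2)[OF q] by (intro excess_perturb h_meas hM NM[OF q] hq c1x)
      have e2: "1 / real m * (\<Sum>i<m. loss_gap q (D i)) \<le> 1 / real m * (\<Sum>i<m. loss_gap h (D i)) + \<Lambda> * (c1 / x)"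
      proof -
        have "(\<Sum>i<m. loss_gap q (D i)) \<le> (\<Sum>i<m. loss_gap h (D i) + \<Lambda> * (c1 / x))"
          using hq by (intro sum_mono loss_gap_perturb hM NM[OF q] c1x) (auto simp: abs_minus_commute)
        then have "1 / real m * (\<Sum>i<m. loss_gap q (D i)) \<le> 1 / real m * (\<Sum>i<m. loss_gap h (D i) + \<Lambda> * (c1 / x))"
          by (intro mult_left_mono) auto
        also have "\<dots> = 1 / real m * (\<Sum>i<m. loss_gap h (D i)) + \<Lambda> * (c1 / x)"
          using m by (simp add: sum.distrib distrib_left)
        finally show ?thesis .
      qed
      have e3: "\<Lambda> * (c1 / x) \<le> \<Lambda> * c1 * \<theta>"
        using b3 pos \<open>c1 > 0\<close> mult_left_mono[of "1 / x" \<theta> "\<Lambda> * c1"] by simp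
      have "excess h \<le> 3 * (\<Lambda> * c1 * \<theta>) + 2 * (K * \<theta>) + 3 * (U * K ^ p * \<theta>) + 4 * (c4 * \<theta>) + 4 * (c5 * \<theta>)"
        using e1 e2 e3 emp low[OF D q] up[OF D] b1 b2 b4 b5 by linarith
      also have "\<dots> = c6 * \<theta>" by (simp add: c6_def algebra_simps)
      finally have "U * excess h \<le> U * (c6 * \<theta>)" using pos by (intro mult_left_mono) auto
      then have cal: "(misclass_risk \<rho> (sign_clf f) - misclass_risk \<rho> (bayes_rule \<eta>)) ^ p \<le> U * c6 * \<theta>"
        using calibration[OF f_meas] unfolding h_def by simp
      show ?thesis
      proof (cases "p = 1")
        case True
        have "U * c6 * \<theta> \<le> C * \<theta>" using \<open>\<theta> \<ge> 0\<close> by (intro mult_right_mono) (auto simp: C_def)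
        then show ?thesis using cal True by (simp add: \<theta>_def mult_ac)
      next
        case False
        with p have p2: "p = 2" by simp
        define y where "y = x powr (- \<beta> + \<nu>) * \<l>"
        \<comment> \<open>A square root would halve both \<nu> and the power of the logarithm; since
          \<nu> > 0 and \<open>\<l> \<ge> 1\<close>, the weaker bound without halving
          follows.\<close>
        have "\<theta> \<le> y\<^sup>2"
        proof -
          have "\<theta> \<le> x powr (2 * (- \<beta> + \<nu>)) * \<l>\<^sup>2"
            unfolding \<theta>_def p2 using x \<open>0 < \<nu>\<close> \<open>\<l> \<ge> 1\<close>
            by (intro mult_mono powr_mono) (auto simp: power2_eq_square mult_le_cancel_left1)
          also have "x powr (2 * (- \<beta> + \<nu>)) = (x powr (- \<beta> + \<nu>))\<^sup>2"
            using x by (simp add: powr_power)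
          finally show ?thesis by (simp add: y_def power_mult_distrib)
        qed
        have "U * c6 \<ge> 0" using pos \<open>c6 > 0\<close> by simp
        then have "C \<ge> 1" "U * c6 \<le> C" by (simp_all add: C_def)
        moreover have "C * 1 \<le> C * C" using \<open>C \<ge> 1\<close> by (intro mult_left_mono) auto
        ultimately have "U * c6 \<le> C\<^sup>2" unfolding power2_eq_square by linarith
        then have "U * c6 * \<theta> \<le> C\<^sup>2 * y\<^sup>2"
          using \<open>\<theta> \<le> y\<^sup>2\<close> \<open>\<theta> \<ge> 0\<close> by (intro mult_mono) auto
        with cal have "(misclass_risk \<rho> (sign_clf f) - misclass_risk \<rho> (bayes_rule \<eta>))\<^sup>2 \<le> (C * y)\<^sup>2"
          unfolding p2 by (simp add: power_mult_distrib)
        then have "misclass_risk \<rho> (sign_clf f) - misclass_risk \<rho> (bayes_rule \<eta>) \<le> C * y"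
          by (rule power2_le_imp_le) (use \<open>C > 0\<close> \<open>\<l> \<ge> 1\<close> in \<open>simp add: y_def\<close>)
        then show ?thesis by (simp add: y_def mult.assoc)
      qed
    qed
    then show ?thesis using A unfolding \<sigma>_def x_def \<l>_def \<beta>_def by (intro bexI[of _ A]) auto
  qed
  then show ?thesis using \<open>C > 0\<close> unfolding b_def d_def by blast
qed

end
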